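(* Let $\mathbb{K}$ be an infinite field, $R=\mathbb{K}[X_1,\dots,X_6]$ with its standard $\mathbb{Z}^6$-grading, $\mathfrak{m}=(X_1,\dots,X_6)\subset R$, and $M=\mathfrak{m}\oplus R^{9}$. Then $$\operatorname{sdepth}M=5>4\ge\operatorname{sdepth}\operatorname{Syz}^1_R(M).$$ In particular, $\operatorname{sdepth}M>\operatorname{sdepth}\operatorname{Syz}_R^1(M)$.
   Context: Stanley decomposition of a finitely generated $\mathbb{Z}^n$-graded $R$-module $N$ ($R=\mathbb{K}[X_1,\dots,X_n]$): a finite family $(R_i,m_i)_{i\in I}$ with $m_i\in N$ homogeneous and $R_i$ subalgebras of $R$ generated by subsets of the indeterminates, such that $R_i\cap\operatorname{Ann}m_i=0$ for each $i$ and $N=\bigoplus_{i\in I}m_iR_i$ as a multigraded $\mathbb{K}$-vector space. Its depth is the minimal Krull dimension of the subalgebras $R_i$ (i.e. the minimal number of indeterminates generating an $R_i$). The Stanley depth $\operatorname{sdepth}N$ is the maximal depth of a Stanley decomposition of $N$. $\operatorname{Syz}^1_R(N)$ denotes the first syzygy module of $N$, i.e. the kernel of $F_0\to N$ in a minimal multigraded free resolution of $N$; in particular $\operatorname{Syz}^1_R(\mathfrak{m}\oplus R^9)=\operatorname{Syz}_R^1(\mathfrak{m})$. The summands of $R^9$ are unshifted copies of $R$. *)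

theory Defs
  imports
    Complex_Main
    "HOL-Library.Poly_Mapping"
    "HOL-Library.Numeral_Type"
    "HOL-Library.Function_Algebras"
    "HOL-Library.Product_Plus"
    "HOL-Library.FuncSet"
begin

section \<open>The polynomial ring\<close>

text \<open>Exponent vectors are finitely supported maps \<open>'n \<Rightarrow>\<^sub>0 nat\<close>; the indeterminates are indexed by the
  finite type \<open>'n\<close>.\<close>

type_synonym ('n, 'k) mpoly = "('n \<Rightarrow>\<^sub>0 nat) \<Rightarrow>\<^sub>0 'k"

definition Const :: "'k::comm_ring_1 \<Rightarrow> ('n, 'k) mpoly" where
  "Const c = Poly_Mapping.single 0 c"

definition Var :: "'n \<Rightarrow> ('n, 'k::comm_ring_1) mpoly" where
  "Var i = Poly_Mapping.single (Poly_Mapping.single i 1) 1"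

definition mdeg :: "('n \<Rightarrow>\<^sub>0 nat) \<Rightarrow> 'n \<Rightarrow> int" where
  "mdeg u = (\<lambda>i. int (Poly_Mapping.lookup u i))"

text \<open>The component of degree \<open>a\<close> of the polynomial ring in its standard grading; it vanishes
  unless all entries of \<open>a\<close> are nonnegative.\<close>

definition poly_comp :: "('n \<Rightarrow> int) \<Rightarrow> ('n, 'k::comm_ring_1) mpoly set" where
  "poly_comp a = {p. \<forall>u \<in> Poly_Mapping.keys p. mdeg u = a}"

definition is_subalgebra :: "('n, 'k::comm_ring_1) mpoly set \<Rightarrow> bool" where
  "is_subalgebra S \<longleftrightarrow> range Const \<subseteq> S \<and> (\<forall>p \<in> S. \<forall>q \<in> S. p + q \<in> S \<and> p * q \<in> S)"

definition var_subalgebra :: "'n set \<Rightarrow> ('n, 'k::comm_ring_1) mpoly set" where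
  "var_subalgebra Z = is_subalgebra hull (Var ` Z)"

definition max_ideal :: "('n, 'k::comm_ring_1) mpoly set" where
  "max_ideal = module.span (*) (range Var)"


section \<open>Multigraded modules\<close>

text \<open>A module is a submodule (the carrier) of an ambient module given by a type and a scalar
  multiplication, together with its family of homogeneous components.\<close>

record (overloaded) ('n, 'k, 'b) gmod =
  gcarrier :: "'b set"
  gscale :: "('n, 'k::zero) mpoly \<Rightarrow> 'b \<Rightarrow> 'b"
  gcomp :: "('n \<Rightarrow> int) \<Rightarrow> 'b set"

locale multigraded_module =
  fixes N :: "('n::finite, 'k::field, 'b::ab_group_add) gmod"
  assumes module_scale: "module (gscale N)"
    and subspace_carrier: "module.subspace (gscale N) (gcarrier N)"
    and finitely_generated:
      "\<exists>G. finite G \<and> G \<subseteq> gcarrier N \<and> gcarrier N = module.span (gscale N) G"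
    and comp_subset: "gcomp N a \<subseteq> gcarrier N"
    and comp_zero: "0 \<in> gcomp N a"
    and comp_add: "x \<in> gcomp N a \<Longrightarrow> y \<in> gcomp N a \<Longrightarrow> x + y \<in> gcomp N a"
    and comp_scale: "p \<in> poly_comp c \<Longrightarrow> x \<in> gcomp N a \<Longrightarrow> gscale N p x \<in> gcomp N (c + a)"
    and decomposition: "x \<in> gcarrier N \<Longrightarrow>
      \<exists>!f. (\<forall>a. f a \<in> gcomp N a) \<and> finite {a. f a \<noteq> 0} \<and> x = (\<Sum>a | f a \<noteq> 0. f a)"

definition ideal_gmod :: "('n, 'k::comm_ring_1) mpoly set \<Rightarrow> ('n, 'k, ('n, 'k) mpoly) gmod" where
  "ideal_gmod J = \<lparr>gcarrier = J, gscale = (*), gcomp = (\<lambda>a. J \<inter> poly_comp a)\<rparr>"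

text \<open>The free module \<open>R(- b 0) \<oplus> \<dots> \<oplus> R(- b (r - 1))\<close>, whose \<open>j\<close>-th basis vector has degree \<open>b j\<close>.\<close>

definition free_gmod ::
    "nat \<Rightarrow> (nat \<Rightarrow> 'n \<Rightarrow> int) \<Rightarrow> ('n, 'k::comm_ring_1, nat \<Rightarrow> ('n, 'k) mpoly) gmod" where
  "free_gmod r b =
     \<lparr>gcarrier = {v. \<forall>j \<ge> r. v j = 0},
      gscale = (\<lambda>p v j. p * v j),
      gcomp = (\<lambda>a. {v. (\<forall>j < r. v j \<in> poly_comp (a - b j)) \<and> (\<forall>j \<ge> r. v j = 0)})\<rparr>"

definition dsum_gmod ::
    "('n, 'k::zero, 'b) gmod \<Rightarrow> ('n, 'k, 'c) gmod \<Rightarrow> ('n, 'k, 'b \<times> 'c) gmod" where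
  "dsum_gmod N L =
     \<lparr>gcarrier = gcarrier N \<times> gcarrier L,
      gscale = (\<lambda>p (x, y). (gscale N p x, gscale L p y)),
      gcomp = (\<lambda>a. gcomp N a \<times> gcomp L a)\<rparr>"

definition kernel_gmod ::
    "('n, 'k::zero, 'b) gmod \<Rightarrow> ('b \<Rightarrow> 'c::zero) \<Rightarrow> ('n, 'k, 'b) gmod" where
  "kernel_gmod N f =
     \<lparr>gcarrier = {x \<in> gcarrier N. f x = 0},
      gscale = gscale N,
      gcomp = (\<lambda>a. {x \<in> gcomp N a. f x = 0})\<rparr>"

definition graded_hom ::
    "('n, 'k::zero, 'b::plus) gmod \<Rightarrow> ('n, 'k, 'c::plus) gmod \<Rightarrow> ('b \<Rightarrow> 'c) \<Rightarrow> bool" where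
  "graded_hom N L f \<longleftrightarrow>
     f ` gcarrier N \<subseteq> gcarrier L \<and>
     (\<forall>x \<in> gcarrier N. \<forall>y \<in> gcarrier N. f (x + y) = f x + f y) \<and>
     (\<forall>p. \<forall>x \<in> gcarrier N. f (gscale N p x) = gscale L p (f x)) \<and>
     (\<forall>a. f ` gcomp N a \<subseteq> gcomp L a)"


section \<open>Syzygies\<close>

definition max_ideal_times :: "('n, 'k::comm_ring_1, 'b::ab_group_add) gmod \<Rightarrow> 'b set" where
  "max_ideal_times N = module.span (gscale N) {gscale N p x | p x. p \<in> max_ideal \<and> x \<in> gcarrier N}"

text \<open>The resolution is \<open>\<dots> \<rightarrow> F\<^sub>2 \<rightarrow> F\<^sub>1 \<rightarrow> F\<^sub>0 \<rightarrow> N\<close> with \<open>F\<^sub>i\<close> free of finite rank \<open>r i\<close> on a basis of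
  degrees \<open>b i\<close>, augmentation \<open>\<epsilon>\<close> and differentials \<open>d i : F\<^bsub>i+1\<^esub> \<rightarrow> F\<^sub>i\<close>. Finite resolutions are padded
  with modules of rank zero.\<close>

definition minimal_free_resolution ::
    "('n, 'k::comm_ring_1, 'b::ab_group_add) gmod \<Rightarrow> (nat \<Rightarrow> nat) \<Rightarrow> (nat \<Rightarrow> nat \<Rightarrow> 'n \<Rightarrow> int) \<Rightarrow>
     ((nat \<Rightarrow> ('n, 'k) mpoly) \<Rightarrow> 'b) \<Rightarrow>
     (nat \<Rightarrow> (nat \<Rightarrow> ('n, 'k) mpoly) \<Rightarrow> nat \<Rightarrow> ('n, 'k) mpoly) \<Rightarrow> bool" where
  "minimal_free_resolution N r b \<epsilon> d \<longleftrightarrow>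
     (let F = (\<lambda>i. free_gmod (r i) (b i)) in
       graded_hom (F 0) N \<epsilon> \<and>
       (\<forall>i. graded_hom (F (Suc i)) (F i) (d i)) \<and>
       \<epsilon> ` gcarrier (F 0) = gcarrier N \<and>
       gcarrier (kernel_gmod (F 0) \<epsilon>) = d 0 ` gcarrier (F 1) \<and>
       (\<forall>i. gcarrier (kernel_gmod (F (Suc i)) (d i)) = d (Suc i) ` gcarrier (F (Suc (Suc i)))) \<and>
       (\<forall>i. d i ` gcarrier (F (Suc i)) \<subseteq> max_ideal_times (F i)))"

text \<open>The first syzygy module depends on the choice of a minimal resolution (up to isomorphism it
  does not), so it is rendered as a relation.\<close>

definition is_first_syzygy ::
    "('n, 'k::comm_ring_1, 'b::ab_group_add) gmod \<Rightarrow>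
     ('n, 'k, nat \<Rightarrow> ('n, 'k) mpoly) gmod \<Rightarrow> bool" where
  "is_first_syzygy N S \<longleftrightarrow>
     (\<exists>r b \<epsilon> d. minimal_free_resolution N r b \<epsilon> d \<and> S = kernel_gmod (free_gmod (r 0) (b 0)) \<epsilon>)"


section \<open>Stanley decompositions and Stanley depth\<close>

definition ann :: "('n, 'k::zero, 'b::zero) gmod \<Rightarrow> 'b \<Rightarrow> ('n, 'k) mpoly set" where
  "ann N x = {p. gscale N p x = 0}"

definition internal_direct_sum :: "'b::comm_monoid_add set \<Rightarrow> 'i set \<Rightarrow> ('i \<Rightarrow> 'b set) \<Rightarrow> bool" where
  "internal_direct_sum V I W \<longleftrightarrow>
     (\<forall>i \<in> I. W i \<subseteq> V) \<and> (\<forall>x \<in> V. \<exists>!f. f \<in> (\<Pi>\<^sub>E i \<in> I. W i) \<and> x = (\<Sum>i \<in> I. f i))"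

text \<open>The algebra \<open>R\<^sub>i\<close> is the one generated by the indeterminates in \<open>Z i\<close>. Since the \<open>m i\<close> are
  homogeneous, each \<open>m\<^sub>i R\<^sub>i\<close> is a multigraded subspace, so a direct sum decomposition of vector
  spaces is automatically one of multigraded vector spaces.\<close>

definition stanley_decomposition ::
    "('n, 'k::comm_ring_1, 'b::ab_group_add) gmod \<Rightarrow> 'i set \<Rightarrow> ('i \<Rightarrow> 'n set) \<Rightarrow> ('i \<Rightarrow> 'b) \<Rightarrow> bool" where
  "stanley_decomposition N I Z m \<longleftrightarrow>
     finite I \<and>
     (\<forall>i \<in> I. \<exists>a. m i \<in> gcomp N a) \<and>
     (\<forall>i \<in> I. var_subalgebra (Z i) \<inter> ann N (m i) = {0}) \<and>
     internal_direct_sum (gcarrier N) I (\<lambda>i. (\<lambda>p. gscale N p (m i)) ` var_subalgebra (Z i))"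

text \<open>The Krull dimension of the polynomial ring in the indeterminates from \<open>Z i\<close> is \<open>card (Z i)\<close>.\<close>

definition stanley_depth :: "'i set \<Rightarrow> ('i \<Rightarrow> 'n::finite set) \<Rightarrow> nat" where
  "stanley_depth I Z = Min ((\<lambda>i. card (Z i)) ` I)"

text \<open>Finite families may be indexed by sets of natural numbers. For a nonzero module the
  set below is finite, its members being at most the number of indeterminates.\<close>

definition sdepth :: "('n::finite, 'k::comm_ring_1, 'b::ab_group_add) gmod \<Rightarrow> nat" where
  "sdepth N = Max {stanley_depth I Z | (I :: nat set) Z m. stanley_decomposition N I Z m}"


section \<open>The modules in question are multigraded modules\<close>

lemma mdeg_inj: "mdeg u = mdeg v \<Longrightarrow> u = v"
  by (rule poly_mapping_eqI) (auto simp: mdeg_def fun_eq_iff)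

lemma mdeg_add: "mdeg (u + v) = mdeg u + mdeg v"
  by (auto simp: mdeg_def fun_eq_iff lookup_add)

lemma module_mult: "module ((*) :: 'a::comm_ring_1 \<Rightarrow> 'a \<Rightarrow> 'a)"
  by unfold_locales (auto simp: algebra_simps)

lemma module_fun: "module (\<lambda>(p::'a::comm_ring_1) (v::nat \<Rightarrow> 'a) j. p * v j)"
  by unfold_locales (auto simp: algebra_simps fun_eq_iff)

lemma poly_comp_add: "p \<in> poly_comp a \<Longrightarrow> q \<in> poly_comp a \<Longrightarrow> p + q \<in> poly_comp a"
  using keys_add[of p q] by (auto simp: poly_comp_def)

lemma poly_comp_zero: "0 \<in> poly_comp a"
  by (auto simp: poly_comp_def)

lemma poly_comp_mult: "p \<in> poly_comp a \<Longrightarrow> q \<in> poly_comp b \<Longrightarrow> p * q \<in> poly_comp (a + b)"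
  using keys_mult[of p q] by (fastforce simp: poly_comp_def mdeg_add)

text \<open>The homogeneous part of degree \<open>a\<close> of a polynomial.\<close>

definition hpart :: "('n \<Rightarrow> int) \<Rightarrow> ('n, 'k::comm_ring_1) mpoly \<Rightarrow> ('n, 'k) mpoly" where
  "hpart a p = (\<Sum>u \<in> {u \<in> Poly_Mapping.keys p. mdeg u = a}. Poly_Mapping.single u (Poly_Mapping.lookup p u))"

lemma lookup_hpart: "Poly_Mapping.lookup (hpart a p) u = (if mdeg u = a then Poly_Mapping.lookup p u else 0)"
proof -
  have "Poly_Mapping.lookup (hpart a p) u =
    (\<Sum>w \<in> {u \<in> Poly_Mapping.keys p. mdeg u = a}. if w = u then Poly_Mapping.lookup p u else 0)"
    unfolding hpart_def lookup_sum by (rule sum.cong) (auto simp: lookup_single when_def)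
  also have "\<dots> = (if mdeg u = a then Poly_Mapping.lookup p u else 0)"
    by (subst sum.delta) (auto simp: in_keys_iff)
  finally show ?thesis .
qed

lemma hpart_mem: "hpart a p \<in> poly_comp a"
  by (auto simp: poly_comp_def in_keys_iff lookup_hpart split: if_splits)

lemma hpart_eq_0: "hpart a p = 0 \<longleftrightarrow> (\<forall>u \<in> Poly_Mapping.keys p. mdeg u \<noteq> a)"
  by (auto simp: poly_mapping_eq_iff fun_eq_iff lookup_hpart in_keys_iff split: if_splits)

lemma finite_hpart: "finite {a. hpart a p \<noteq> 0}"
  by (rule finite_subset[of _ "mdeg ` Poly_Mapping.keys p"]) (auto simp: hpart_eq_0)

lemma sum_hpart: "finite A \<Longrightarrow> {a. hpart a p \<noteq> 0} \<subseteq> A \<Longrightarrow> (\<Sum>a \<in> A. hpart a p) = p"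
proof (rule poly_mapping_eqI)
  fix u assume A: "finite A" "{a. hpart a p \<noteq> 0} \<subseteq> A"
  have "Poly_Mapping.lookup (\<Sum>a \<in> A. hpart a p) u = (\<Sum>a \<in> A. if mdeg u = a then Poly_Mapping.lookup p u else 0)"
    by (simp add: lookup_sum lookup_hpart)
  also have "\<dots> = Poly_Mapping.lookup p u"
  proof (cases "mdeg u \<in> A")
    case False
    then have "hpart (mdeg u) p = 0" using A by auto
    then have "Poly_Mapping.lookup p u = 0" by (auto simp: hpart_eq_0 in_keys_iff)
    then show ?thesis using A False by (simp add: sum.delta')
  qed (use A in \<open>simp add: sum.delta'\<close>)
  finally show "Poly_Mapping.lookup (\<Sum>a \<in> A. hpart a p) u = Poly_Mapping.lookup p u" .
qed

lemma lookup_comp: "p \<in> poly_comp a \<Longrightarrow> mdeg u \<noteq> a \<Longrightarrow> Poly_Mapping.lookup p u = 0"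
  by (auto simp: poly_comp_def in_keys_iff)

lemma hpart_sum:
  assumes "finite A" "\<And>a. a \<in> A \<Longrightarrow> f a \<in> poly_comp a" "\<And>a. a \<notin> A \<Longrightarrow> f a = 0"
  shows "hpart c (\<Sum>a \<in> A. f a) = f c"
proof (rule poly_mapping_eqI)
  fix u
  have fm: "f a \<in> poly_comp a" for a using assms(2,3) by (cases "a \<in> A") (auto simp: poly_comp_zero)
  have "(\<Sum>a \<in> A. Poly_Mapping.lookup (f a) u) = (\<Sum>a \<in> A. if mdeg u = a then Poly_Mapping.lookup (f (mdeg u)) u else 0)"
    by (rule sum.cong) (auto simp: lookup_comp[OF fm])
  also have "\<dots> = Poly_Mapping.lookup (f (mdeg u)) u"
    using assms(1,3) by (subst sum.delta') auto
  finally show "Poly_Mapping.lookup (hpart c (\<Sum>a \<in> A. f a)) u = Poly_Mapping.lookup (f c) u"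
    by (auto simp: lookup_hpart lookup_sum lookup_comp[OF fm])
qed

lemma poly_eq_sum: "p = (\<Sum>u \<in> Poly_Mapping.keys p. Poly_Mapping.single u (Poly_Mapping.lookup p u))"
proof (rule poly_mapping_eqI)
  fix w
  have "(\<Sum>u \<in> Poly_Mapping.keys p. Poly_Mapping.lookup (Poly_Mapping.single u (Poly_Mapping.lookup p u)) w)
      = (\<Sum>u \<in> Poly_Mapping.keys p. if u = w then Poly_Mapping.lookup p w else 0)"
    by (rule sum.cong) (auto simp: lookup_single when_def)
  then show "Poly_Mapping.lookup p w = Poly_Mapping.lookup (\<Sum>u \<in> Poly_Mapping.keys p. Poly_Mapping.single u (Poly_Mapping.lookup p u)) w"
    by (simp add: lookup_sum in_keys_iff)
qed

lemma zero_keys_add: "(u::'n \<Rightarrow>\<^sub>0 nat) + v = 0 \<Longrightarrow> u = 0"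
  by (auto simp: poly_mapping_eq_iff fun_eq_iff lookup_add)

lemma lookup_mult_0:
  fixes p q :: "('n, 'k::comm_ring_1) mpoly"
  assumes "Poly_Mapping.lookup p 0 = 0"
  shows "Poly_Mapping.lookup (q * p) 0 = 0"
proof (rule ccontr)
  assume "Poly_Mapping.lookup (q * p) 0 \<noteq> 0"
  then have "0 \<in> Poly_Mapping.keys (q * p)" by (simp add: in_keys_iff)
  then obtain u v where uv: "v \<in> Poly_Mapping.keys p" "u + v = 0"
    using keys_mult[of q p] by fastforce
  then have "v = 0" using zero_keys_add[of v u] by (simp add: add.commute)
  then show False using uv assms by (simp add: in_keys_iff)
qed

lemma single_Suc_nz: "Poly_Mapping.single i (Suc 0) \<noteq> 0"
proof
  assume "Poly_Mapping.single i (Suc 0) = 0"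
  then have "Poly_Mapping.lookup (Poly_Mapping.single i (Suc 0)) i = 0" by simp
  then show False by simp
qed

lemma max_ideal_iff: "p \<in> max_ideal \<longleftrightarrow> Poly_Mapping.lookup p 0 = 0"
proof
  interpret module "(*) :: ('a,'b) mpoly \<Rightarrow> _" by (rule module_mult)
  show "Poly_Mapping.lookup p 0 = 0" if "p \<in> max_ideal"
    using that unfolding max_ideal_def
  proof (induction rule: span_induct_alt)
    case (step c x y)
    have "Poly_Mapping.lookup x 0 = 0"
      using step(1) by (auto simp: Var_def lookup_single when_def single_Suc_nz)
    then show ?case using step by (simp add: lookup_add lookup_mult_0)
  qed simp
  assume 0: "Poly_Mapping.lookup p 0 = 0"
  have "Poly_Mapping.single u c \<in> max_ideal" if "u \<noteq> 0" for u :: "'a \<Rightarrow>\<^sub>0 nat" and c :: 'b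
  proof -
    from that obtain i where i: "Poly_Mapping.lookup u i \<noteq> 0"
      by (auto simp: poly_mapping_eq_iff fun_eq_iff)
    define v where "v = u - Poly_Mapping.single i 1"
    have "u = v + Poly_Mapping.single i 1"
      using i by (intro poly_mapping_eqI) (auto simp: v_def lookup_add lookup_minus lookup_single when_def)
    then have "Poly_Mapping.single u c = Poly_Mapping.single v c * Var i"
      by (simp add: Var_def mult_single)
    then show ?thesis by (simp add: max_ideal_def span_scale span_base)
  qed
  moreover have "u \<noteq> 0" if "u \<in> Poly_Mapping.keys p" for u using that 0 by (auto simp: in_keys_iff)
  ultimately have "(\<Sum>u \<in> Poly_Mapping.keys p. Poly_Mapping.single u (Poly_Mapping.lookup p u)) \<in> max_ideal"
    unfolding max_ideal_def by (intro span_sum) blast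
  then show "p \<in> max_ideal"
    by (rule ssubst[OF poly_eq_sum[of p], where P = "\<lambda>q. q \<in> max_ideal"])
qed

lemma multigraded_max_ideal:
  "multigraded_module (ideal_gmod max_ideal :: ('n::finite, 'k::field, _) gmod)"
proof -
  interpret module "(*) :: ('n,'k) mpoly \<Rightarrow> _" by (rule module_mult)
  show ?thesis
  proof (rule multigraded_module.intro, goal_cases)
    case 1 show ?case using module_axioms by (simp add: ideal_gmod_def)
  next
    case 2 show ?case
      by (auto simp: ideal_gmod_def max_ideal_def subspace_span)
  next
    case 3 show ?case
      by (rule exI[of _ "range Var"]) (auto simp: ideal_gmod_def max_ideal_def intro: span_base)
  next
    case (8 x)
    have x: "Poly_Mapping.lookup x 0 = 0" using 8 by (simp add: ideal_gmod_def max_ideal_iff)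
    show ?case
    proof (rule ex1I[of _ "\<lambda>a. hpart a x"], goal_cases)
      case 1
      have "x = (\<Sum>a | hpart a x \<noteq> 0. hpart a x)"
        by (rule sum_hpart[symmetric]) (simp_all add: finite_hpart)
      then show ?case using x
        by (simp add: ideal_gmod_def hpart_mem finite_hpart max_ideal_iff lookup_hpart)
    next
      case (2 f)
      then have f: "f a \<in> poly_comp a" "finite {a. f a \<noteq> 0}" for a
        by (simp_all add: ideal_gmod_def)
      have "hpart c (\<Sum>a | f a \<noteq> 0. f a) = f c" for c
        by (rule hpart_sum) (use f(1,2) in auto)
      then show ?case using 2 by metis
    qed
  next
    case 4 show ?case by (auto simp: ideal_gmod_def)
  next
    case 5 show ?case by (auto simp: ideal_gmod_def poly_comp_zero max_ideal_iff)
  next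
    case 6 then show ?case by (simp add: ideal_gmod_def max_ideal_iff lookup_add poly_comp_add)
  next
    case 7 then show ?case by (simp add: ideal_gmod_def max_ideal_iff lookup_mult_0 poly_comp_mult)
  qed
qed

lemma free_span:
  fixes r :: nat
  shows "{v :: nat \<Rightarrow> 'a::comm_ring_1. \<forall>j \<ge> r. v j = 0} =
    module.span (\<lambda>p v j. p * v j) ((\<lambda>i j. if j = i then 1 else 0) ` {..<r})"
proof -
  interpret module "\<lambda>(p::'a) (v::nat \<Rightarrow> 'a) j. p * v j" by (rule module_fun)
  show ?thesis
  proof safe
    fix v :: "nat \<Rightarrow> 'a" assume v: "\<forall>j \<ge> r. v j = 0"
    have "v = (\<Sum>i<r. (\<lambda>j. v i * (if j = i then 1 else 0)))"
    proof
      fix j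
      have "(\<Sum>i<r. (\<lambda>j. v i * (if j = i then 1 else 0))) j = (\<Sum>i<r. if j = i then v i else 0)"
        by (induction r) auto
      then show "v j = (\<Sum>i<r. (\<lambda>j. v i * (if j = i then 1 else 0))) j" using v by (auto simp: not_less)
    qed
    also have "\<dots> \<in> span ((\<lambda>i j. if j = i then 1 else 0) ` {..<r})"
      by (intro span_sum span_scale span_base) auto
    finally show "v \<in> span ((\<lambda>i j. if j = i then 1 else 0) ` {..<r})" .
  next
    fix v :: "nat \<Rightarrow> 'a" and j assume "v \<in> span ((\<lambda>i j. if j = i then 1 else 0) ` {..<r})" "r \<le> j"
    then show "v j = 0" by (induction rule: span_induct_alt) auto
  qed
qed

lemma sum_fun_apply: "(\<Sum>a \<in> A. f a) j = (\<Sum>a \<in> A. f a j)"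
  by (induction A rule: infinite_finite_induct) auto

lemma poly_comp_mult_shift:
  "p \<in> poly_comp c \<Longrightarrow> q \<in> poly_comp (a - b) \<Longrightarrow> p * q \<in> poly_comp (c + a - b)"
  using poly_comp_mult[of p c q "a - b"] by (simp add: algebra_simps)

lemma multigraded_free:
  "multigraded_module (free_gmod r b :: ('n::finite, 'k::field, _) gmod)"
proof -
  interpret module "\<lambda>(p::('n,'k) mpoly) (v::nat \<Rightarrow> _) j. p * v j" by (rule module_fun)
  show ?thesis
  proof (rule multigraded_module.intro, goal_cases)
    case 1 show ?case using module_axioms by (simp add: free_gmod_def)
  next
    case 2 show ?case by (auto simp: free_gmod_def subspace_def)
  next
    case 3 show ?case
      by (rule exI[of _ "(\<lambda>i j. if j = i then 1 else 0) ` {..<r}"]) (auto simp: free_gmod_def free_span intro!: span_base)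
  next
    case (8 x)
    then have x: "x j = 0" if "r \<le> j" for j using that by (simp add: free_gmod_def)
    define f where "f = (\<lambda>a j. hpart (a - b j) (x j))"
    have h0: "hpart a 0 = 0" for a :: "'n \<Rightarrow> int" by (simp add: hpart_def)
    have shift: "{a. hpart (a - b j) (x j) \<noteq> 0} = (\<lambda>a. a + b j) ` {a. hpart a (x j) \<noteq> 0}" for j
    proof (intro set_eqI iffI)
      fix a assume "a \<in> {a. hpart (a - b j) (x j) \<noteq> 0}"
      then show "a \<in> (\<lambda>a. a + b j) ` {a. hpart a (x j) \<noteq> 0}"
        by (intro image_eqI[of _ _ "a - b j"]) auto
    qed auto
    have fin: "finite {a. f a \<noteq> 0}"
    proof (rule finite_subset)
      show "{a. f a \<noteq> 0} \<subseteq> (\<Union>j<r. {a. hpart (a - b j) (x j) \<noteq> 0})"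
      proof
        fix a assume "a \<in> {a. f a \<noteq> 0}"
        then obtain j where j: "hpart (a - b j) (x j) \<noteq> 0" by (auto simp: f_def fun_eq_iff)
        then have "j < r" using x[of j] h0 by (metis not_less)
        then show "a \<in> (\<Union>j<r. {a. hpart (a - b j) (x j) \<noteq> 0})" using j by blast
      qed
      show "finite (\<Union>j<r. {a. hpart (a - b j) (x j) \<noteq> 0})"
        by (intro finite_UN_I) (simp_all only: shift finite_imageI finite_hpart finite_lessThan)
    qed
    show ?case
    proof (rule ex1I[of _ f], goal_cases)
      case 1
      have "x = sum f {a. f a \<noteq> 0}"
      proof
        fix j
        have "sum f {a. f a \<noteq> 0} j = (\<Sum>a | f a \<noteq> 0. hpart (a - b j) (x j))"
          by (simp add: sum_fun_apply f_def)
        also have "\<dots> = (\<Sum>a \<in> (\<lambda>a. a - b j) ` {a. f a \<noteq> 0}. hpart a (x j))"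
          by (subst sum.reindex) (auto simp: inj_on_def)
        also have "\<dots> = x j"
        proof (rule sum_hpart)
          show "{a. hpart a (x j) \<noteq> 0} \<subseteq> (\<lambda>a. a - b j) ` {a. f a \<noteq> 0}"
          proof
            fix a assume "a \<in> {a. hpart a (x j) \<noteq> 0}"
            then have "f (a + b j) j \<noteq> 0" by (simp add: f_def)
            then have "f (a + b j) \<noteq> 0" by auto
            then show "a \<in> (\<lambda>a. a - b j) ` {a. f a \<noteq> 0}" by (intro image_eqI[of _ _ "a + b j"]) auto
          qed
        qed (use fin in auto)
        finally show "x j = sum f {a. f a \<noteq> 0} j" ..
      qed
      moreover have "f a \<in> gcomp (free_gmod r b) a" for a
        by (simp add: free_gmod_def f_def x h0 hpart_mem)
      ultimately show ?case using fin by blast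
    next
      case (2 g)
      show ?case
      proof (intro ext)
        fix c j
        have gm: "g a j \<in> poly_comp (a - b j)" for a
          using 2 by (cases "j < r") (simp_all add: free_gmod_def poly_comp_zero)
        let ?A = "{a. g a \<noteq> 0}"
        have "x j = (\<Sum>a \<in> ?A. g a j)" using 2 by (metis sum_fun_apply)
        also have "\<dots> = (\<Sum>a \<in> (\<lambda>a. a - b j) ` ?A. g (a + b j) j)"
          by (subst sum.reindex) (auto simp: inj_on_def)
        also have "hpart (c - b j) \<dots> = g (c - b j + b j) j"
        proof (rule hpart_sum)
          show "g (a + b j) j = 0" if "a \<notin> (\<lambda>a. a - b j) ` ?A" for a
          proof (rule ccontr)
            assume "g (a + b j) j \<noteq> 0"
            then have "a + b j \<in> ?A" by auto
            then have "a + b j - b j \<in> (\<lambda>a. a - b j) ` ?A" by (rule imageI)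
            then show False using that by simp
          qed
          show "g (a + b j) j \<in> poly_comp a" for a using gm[of "a + b j"] by simp
        qed (use 2 in auto)
        finally show "g c j = f c j" unfolding f_def diff_add_cancel by (rule sym)
      qed
    qed
  next
    case 4 show ?case by (auto simp: free_gmod_def)
  next
    case 5 show ?case by (auto simp: free_gmod_def poly_comp_zero)
  next
    case 6 then show ?case by (simp add: free_gmod_def poly_comp_add)
  next
    case 7 then show ?case by (simp add: free_gmod_def poly_comp_mult_shift)
  qed
qed


lemma prod_sum: "(\<Sum>a \<in> A. (f a, g a)) = (sum f A, sum g A)"
  by (induction A rule: infinite_finite_induct) (auto simp: zero_prod_def)

lemma sum_support: "finite A \<Longrightarrow> {a. f a \<noteq> 0} \<subseteq> A \<Longrightarrow> (\<Sum>a | f a \<noteq> 0. f a) = sum f A"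
  by (rule sum.mono_neutral_left) auto

lemma multigraded_dsum:
  assumes "multigraded_module N" "multigraded_module L"
  shows "multigraded_module (dsum_gmod N L)"
proof -
  interpret N: multigraded_module N by fact
  interpret L: multigraded_module L by fact
  interpret Nm: module "gscale N" by (rule N.module_scale)
  interpret Lm: module "gscale L" by (rule L.module_scale)
  let ?s = "\<lambda>p (x, y). (gscale N p x, gscale L p y)"
  interpret P: module ?s
    by unfold_locales (auto simp: Nm.scale_right_distrib Nm.scale_left_distrib
      Lm.scale_right_distrib Lm.scale_left_distrib)
  have s: "gscale (dsum_gmod N L) = ?s" by (simp add: dsum_gmod_def)
  have sub: "P.subspace (gcarrier N \<times> gcarrier L)"
    using N.subspace_carrier L.subspace_carrier
    unfolding P.subspace_def Nm.subspace_def Lm.subspace_def by (auto simp: zero_prod_def)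
  show ?thesis
  proof (rule multigraded_module.intro, unfold s, goal_cases)
    case 1 show ?case by (rule P.module_axioms)
  next
    case 2 show ?case using sub by (simp add: dsum_gmod_def)
  next
    case 3
    obtain G where G: "finite G" "G \<subseteq> gcarrier N" "gcarrier N = Nm.span G"
      using N.finitely_generated by blast
    obtain H where H: "finite H" "H \<subseteq> gcarrier L" "gcarrier L = Lm.span H"
      using L.finitely_generated by blast
    let ?GH = "(\<lambda>x. (x, 0)) ` G \<union> (\<lambda>y. (0, y)) ` H"
    have 0: "0 \<in> gcarrier N" "0 \<in> gcarrier L"
      using N.subspace_carrier L.subspace_carrier by (auto simp: Nm.subspace_def Lm.subspace_def)
    have "(x, 0) \<in> P.span ?GH" if "x \<in> Nm.span G" for x
      using that
    proof (induction rule: Nm.span_induct_alt)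
      case base then show ?case using P.span_zero[of ?GH] by (simp add: zero_prod_def)
    next
      case (step c x y)
      then have "?s c (x, 0) + (y, 0) \<in> P.span ?GH"
        by (intro P.span_add P.span_scale) (auto intro: P.span_base)
      then show ?case by simp
    qed
    moreover have "(0, x) \<in> P.span ?GH" if "x \<in> Lm.span H" for x
      using that
    proof (induction rule: Lm.span_induct_alt)
      case base then show ?case using P.span_zero[of ?GH] by (simp add: zero_prod_def)
    next
      case (step c x y)
      then have "?s c (0, x) + (0, y) \<in> P.span ?GH"
        by (intro P.span_add P.span_scale) (auto intro: P.span_base)
      then show ?case by simp
    qed
    ultimately have "(x, y) \<in> P.span ?GH" if "x \<in> Nm.span G" "y \<in> Lm.span H" for x y
      using P.span_add[of "(x, 0)" ?GH "(0, y)"] that by simp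
    moreover have GH: "?GH \<subseteq> gcarrier N \<times> gcarrier L" using 0 G(2) H(2) by auto
    ultimately have "gcarrier N \<times> gcarrier L = P.span ?GH"
      using P.span_minimal[OF GH sub] G(3) H(3) by auto
    then show ?case using GH G(1) H(1) by (intro exI[of _ ?GH]) (auto simp: dsum_gmod_def)
  next
    case (8 z)
    then obtain x y where z: "z = (x, y)" "x \<in> gcarrier N" "y \<in> gcarrier L"
      by (auto simp: dsum_gmod_def)
    obtain f where f: "\<forall>a. f a \<in> gcomp N a" "finite {a. f a \<noteq> 0}" "x = (\<Sum>a | f a \<noteq> 0. f a)"
      using N.decomposition[OF z(2)] by blast
    obtain g where g: "\<forall>a. g a \<in> gcomp L a" "finite {a. g a \<noteq> 0}" "y = (\<Sum>a | g a \<noteq> 0. g a)"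
      using L.decomposition[OF z(3)] by blast
    have supp: "{a. (h a, k a) \<noteq> 0} = {a. h a \<noteq> 0} \<union> {a. k a \<noteq> 0}"
      for h :: "('a \<Rightarrow> int) \<Rightarrow> 'c" and k :: "('a \<Rightarrow> int) \<Rightarrow> 'd"
      by (auto simp: zero_prod_def)
    show ?case
    proof (rule ex1I[of _ "\<lambda>a. (f a, g a)"], goal_cases)
      case 1
      have "z = (\<Sum>a | (f a, g a) \<noteq> 0. (f a, g a))"
        unfolding supp prod_sum z(1) f(3) g(3)
        using f(2) g(2) by (auto intro!: sum_support)
      then show ?case using f(1,2) g(1,2) unfolding supp by (auto simp: dsum_gmod_def)
    next
      case (2 h)
      define h1 where "h1 = fst \<circ> h"
      define h2 where "h2 = snd \<circ> h"
      have h: "h = (\<lambda>a. (h1 a, h2 a))" by (auto simp: h1_def h2_def)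
      have fin: "finite {a. h1 a \<noteq> 0}" "finite {a. h2 a \<noteq> 0}"
        using 2 unfolding h supp by auto
      have "(x, y) = (\<Sum>a \<in> {a. h1 a \<noteq> 0} \<union> {a. h2 a \<noteq> 0}. (h1 a, h2 a))"
        using 2 unfolding h supp z(1) by auto
      then have "x = (\<Sum>a | h1 a \<noteq> 0. h1 a)" "y = (\<Sum>a | h2 a \<noteq> 0. h2 a)"
        using fin unfolding prod_sum by (auto intro!: sum_support[symmetric])
      moreover have "\<forall>a. h1 a \<in> gcomp N a" "\<forall>a. h2 a \<in> gcomp L a"
        using 2 unfolding h by (auto simp: dsum_gmod_def)
      ultimately have "h1 = f" "h2 = g"
        using N.decomposition[OF z(2)] L.decomposition[OF z(3)] f g fin by blast+
      then show ?case using h by simp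
    qed
  next
    case (4 a) show ?case using N.comp_subset[of a] L.comp_subset[of a] by (auto simp: dsum_gmod_def)
  next
    case 5 show ?case by (simp add: dsum_gmod_def zero_prod_def N.comp_zero L.comp_zero)
  next
    case (6 x a y) then show ?case
      by (cases x; cases y) (simp add: dsum_gmod_def N.comp_add L.comp_add)
  next
    case (7 p c x a) then show ?case
      by (cases x) (simp add: dsum_gmod_def N.comp_scale L.comp_scale)
  qed
qed

lemma graded_hom_sum:
  fixes F :: "('n::finite, 'k::field, 'b::ab_group_add) gmod" and h :: "'b::ab_group_add \<Rightarrow> 'c::ab_group_add"
  assumes "graded_hom F N h" "multigraded_module F" "\<And>a. a \<in> A \<Longrightarrow> f a \<in> gcarrier F"
  shows "h (sum f A) = (\<Sum>a \<in> A. h (f a))"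
proof -
  interpret F: multigraded_module F by fact
  interpret Fm: module "gscale F" by (rule F.module_scale)
  have 0: "0 \<in> gcarrier F" using F.subspace_carrier by (simp add: Fm.subspace_def)
  then have "h (0 + 0) = h 0 + h 0" using assms(1) unfolding graded_hom_def by blast
  then have h0: "h 0 = 0" by simp
  show ?thesis
    using assms(3)
  proof (induction A rule: infinite_finite_induct)
    case (insert x A)
    have "sum f A \<in> gcarrier F"
      using Fm.subspace_sum[OF F.subspace_carrier] insert.prems by blast
    then have "h (f x + sum f A) = h (f x) + h (sum f A)"
      using assms(1) insert.prems unfolding graded_hom_def by blast
    then show ?case using insert by simp
  qed (auto simp: h0)
qed

lemma ex1_unique: "\<exists>!x. P x \<Longrightarrow> P a \<Longrightarrow> P b \<Longrightarrow> a = b"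
  by blast

lemma multigraded_syzygy:
  fixes N :: "('n::finite, 'k::field, 'b::ab_group_add) gmod"
  assumes "multigraded_module N" "is_first_syzygy N S"
  shows "multigraded_module S"
proof -
  obtain r b e d where res: "minimal_free_resolution N r b e d"
    and S: "S = kernel_gmod (free_gmod (r 0) (b 0)) e"
    using assms(2) by (auto simp: is_first_syzygy_def)
  define F :: "('n, 'k, nat \<Rightarrow> ('n, 'k) mpoly) gmod" where "F = free_gmod (r 0) (b 0)"
  define F1 :: "('n, 'k, nat \<Rightarrow> ('n, 'k) mpoly) gmod" where "F1 = free_gmod (r 1) (b 1)"
  interpret N: multigraded_module N by fact
  have mF: "multigraded_module F" and mF1: "multigraded_module F1"
    unfolding F_def F1_def by (rule multigraded_free)+
  interpret F: multigraded_module F by (rule mF)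
  interpret F1: multigraded_module F1 by (rule mF1)
  interpret Nm: module "gscale N" by (rule N.module_scale)
  interpret Fm: module "gscale F" by (rule F.module_scale)
  interpret F1m: module "gscale F1" by (rule F1.module_scale)
  have e: "graded_hom F N e" and d: "graded_hom F1 F (d 0)"
    and ker: "gcarrier S = d 0 ` gcarrier F1"
    using res by (auto simp: minimal_free_resolution_def Let_def S F_def F1_def)
  have S': "gcarrier S = {x \<in> gcarrier F. e x = 0}" "gscale S = gscale F"
      "gcomp S = (\<lambda>a. {x \<in> gcomp F a. e x = 0})"
    by (simp_all add: S kernel_gmod_def F_def)
  have e0: "e 0 = 0" using graded_hom_sum[OF e mF, of "{}"] by simp
  have d0: "d 0 0 = 0" using graded_hom_sum[OF d mF1, of "{}"] by simp
  have F1z: "0 \<in> gcarrier F1" using F1.subspace_carrier by (simp add: F1m.subspace_def)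
  have dadd: "d 0 (x + y) = d 0 x + d 0 y" if "x \<in> gcarrier F1" "y \<in> gcarrier F1" for x y
    using d that unfolding graded_hom_def by blast
  have dsc: "d 0 (gscale F1 p x) = gscale F p (d 0 x)" if "x \<in> gcarrier F1" for p x
    using d that unfolding graded_hom_def by blast
  have eadd: "e (x + y) = e x + e y" if "x \<in> gcarrier F" "y \<in> gcarrier F" for x y
    using e that unfolding graded_hom_def by blast
  have esc: "e (gscale F p x) = gscale N p (e x)" if "x \<in> gcarrier F" for p x
    using e that unfolding graded_hom_def by blast
  have ecomp: "e x \<in> gcomp N a" if "x \<in> gcomp F a" for x a
    using e that unfolding graded_hom_def by blast
  have cs: "x \<in> gcarrier F" if "x \<in> gcomp F a" for x a using F.comp_subset that by blast
  have sub: "Fm.subspace {x \<in> gcarrier F. e x = 0}"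
    using F.subspace_carrier by (auto simp: Fm.subspace_def e0 eadd esc)
  show ?thesis
  proof (rule multigraded_module.intro, unfold S'(2), goal_cases)
    case 1 show ?case by (rule F.module_scale)
  next
    case 2 show ?case using sub by (simp add: S')
  next
    case 3
    obtain G where G: "finite G" "G \<subseteq> gcarrier F1" "gcarrier F1 = F1m.span G"
      using F1.finitely_generated by blast
    have "x \<in> gcarrier F1 \<and> d 0 x \<in> Fm.span (d 0 ` G)" if "x \<in> F1m.span G" for x
      using that
    proof (induction rule: F1m.span_induct_alt)
      case base then show ?case by (simp only: d0 Fm.span_zero F1z simp_thms)
    next
      case (step c x y)
      have x: "x \<in> gcarrier F1" "gscale F1 c x \<in> gcarrier F1"
        using step(1) G(2) F1.subspace_carrier by (auto simp: F1m.subspace_def)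
      have y: "y \<in> gcarrier F1" using step(2) by simp
      have "d 0 (gscale F1 c x + y) = gscale F c (d 0 x) + d 0 y"
        using dadd[OF x(2) y] dsc[OF x(1)] by metis
      moreover have "gscale F c (d 0 x) + d 0 y \<in> Fm.span (d 0 ` G)"
        by (rule Fm.span_add[OF Fm.span_scale[OF Fm.span_base[OF imageI[OF step(1)]]] conjunct2[OF step(2)]])
      moreover have "gscale F1 c x + y \<in> gcarrier F1"
        by (rule F1m.subspace_add[OF F1.subspace_carrier x(2) y])
      ultimately show ?case by (simp only: simp_thms)
    qed
    then have "gcarrier S \<subseteq> Fm.span (d 0 ` G)" using ker G(3) by auto
    moreover have dG: "d 0 ` G \<subseteq> gcarrier S" using ker G(2) by auto
    ultimately have "gcarrier S = Fm.span (d 0 ` G)"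
      using Fm.span_minimal[OF dG] sub unfolding S' by blast
    then show ?case using G(1) dG by blast
  next
    case (8 x)
    then have x: "x \<in> gcarrier F" "e x = 0" by (auto simp: S')
    have ex1: "\<exists>!f. (\<forall>a. f a \<in> gcomp F a) \<and> finite {a. f a \<noteq> 0} \<and> x = (\<Sum>a | f a \<noteq> 0. f a)"
      by (rule F.decomposition[OF x(1)])
    then obtain f where f: "\<forall>a. f a \<in> gcomp F a" "finite {a. f a \<noteq> 0}" "x = (\<Sum>a | f a \<noteq> 0. f a)"
      by blast
    have fin: "finite {a. e (f a) \<noteq> 0}"
      by (rule finite_subset[OF _ f(2)]) (auto simp: e0)
    have "e x = (\<Sum>a | f a \<noteq> 0. e (f a))"
      unfolding f(3) using f(1) cs by (intro graded_hom_sum[OF e mF]) blast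
    also have "\<dots> = (\<Sum>a | e (f a) \<noteq> 0. e (f a))"
      by (rule sum_support[symmetric, OF f(2)]) (auto simp: e0)
    finally have s0: "0 = (\<Sum>a | e (f a) \<noteq> 0. e (f a))" using x(2) by simp
    have z: "0 \<in> gcarrier N" using N.subspace_carrier by (simp add: Nm.subspace_def)
    have "(\<lambda>a. e (f a)) = (\<lambda>_. 0)"
    proof -
      let ?P = "\<lambda>h. (\<forall>a. h a \<in> gcomp N a) \<and> finite {a. h a \<noteq> 0} \<and> 0 = (\<Sum>a | h a \<noteq> 0. h a)"
      have "?P (\<lambda>a. e (f a))" using f(1) ecomp fin s0 by blast
      moreover have "?P (\<lambda>_. 0)" by (simp add: N.comp_zero)
      ultimately show ?thesis by (rule ex1_unique[OF N.decomposition[OF z]])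
    qed
    then have ef: "e (f a) = 0" for a by (rule fun_cong)
    show ?case
    proof (rule ex1I[of _ f], goal_cases)
      case 1 show ?case using f ef unfolding S' by blast
    next
      case (2 g)
      then have "(\<forall>a. g a \<in> gcomp F a) \<and> finite {a. g a \<noteq> 0} \<and> x = (\<Sum>a | g a \<noteq> 0. g a)"
        unfolding S' by blast
      moreover have "(\<forall>a. f a \<in> gcomp F a) \<and> finite {a. f a \<noteq> 0} \<and> x = (\<Sum>a | f a \<noteq> 0. f a)"
        using f by blast
      ultimately show ?case by (rule ex1_unique[OF ex1])
    qed
  next
    case (4 a) show ?case unfolding S' using cs by blast
  next
    case (5 a) show ?case unfolding S' using F.comp_zero e0 by blast
  next
    case (6 x a y)
    then have "x \<in> gcomp F a" "y \<in> gcomp F a" "e x = 0" "e y = 0" unfolding S' by blast+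
    moreover from this have "e (x + y) = 0" using eadd[OF cs cs] by (metis add_0)
    ultimately show ?case unfolding S' using F.comp_add by blast
  next
    case (7 p c x a)
    then have "x \<in> gcomp F a" "e x = 0" unfolding S' by blast+
    moreover from this have "e (gscale F p x) = 0" using esc[OF cs] by (metis Nm.scale_zero_right)
    ultimately show ?case unfolding S' using F.comp_scale 7(1) by blast
  qed
qed

lemma multigraded_max_ideal_dsum_free:
  "multigraded_module (dsum_gmod (ideal_gmod max_ideal) (free_gmod r b) ::
     ('n::finite, 'k::field, _) gmod)"
  by (intro multigraded_dsum multigraded_max_ideal multigraded_free)

end

theory Submission
  imports Defs
begin

text \<open>A family of homogeneous elements and subalgebras is a Stanley decomposition iff in every degree the
  monomial multiples of the generators active there form a basis of the component. In particular the
  number of active generators is the Hilbert function, and both upper bounds are counting arguments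
  based on this. The decomposition of \<open>M\<close> of depth five grows by one variable at a time: the ideal
  \<open>(X 0, X 1, X 2)\<close> has a decomposition of depth two, each further variable \<open>y\<close> is adjoined to
  all pieces found so far, and what is left, the new free summands together with the powers of \<open>y\<close>,
  is decomposed into pieces that miss at most one variable. For the syzygies,
  lifts of the elements \<open>X i\<close> to an arbitrary minimal free cover are part of a basis of it, so the
  syzygy module is the module of Koszul syzygies, with Hilbert function \<open>|supp a| - 1\<close>.\<close>

section \<open>Monomials\<close>

text \<open>The number 9 is 2 + 3 + 4. Adjoining a variable y to k old ones with k - 1 new free
  summands leaves, among the multiples of y, a remainder of dimension k at the powers of y and k - 1
  in the other degrees. So k pieces can start at y, each missing a different old variable:
  multiplying by one old variable removes exactly one of them. This costs k - 1 summands for k = 3,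
  4, 5, and none for the three variables at the start. Where several old variables occur, too many
  of these pieces are lost and pieces with labels of the same block replace them. The k vectors of a
  block are therefore chosen such that any k - 1 of them together with \<open>u\<close> span the
  same space as all k. Then only the number of distinct active labels per block matters, and the
  table of pieces becomes a finite check. Six variables matter for the syzygies: they have 20
  triples and 15 pairs, whereas five variables have 10 of each. The minimal cover is arbitrary, so
  the degrees of its basis are unknown at first; what is needed about them has to be extracted from
  minimality and surjectivity.\<close>

lemma Const_0 [simp]: "Const 0 = 0"
  by (simp add: Const_def)

lemma Const_1: "Const 1 = 1"
  by (simp add: Const_def)

lemma Const_add: "Const (c + d) = Const c + Const d"
  by (simp add: Const_def single_add)

lemma Const_uminus: "Const (- c) = - Const c"
  by (simp add: Const_def single_uminus)

lemma Const_mult: "Const (c * d) = Const c * Const d"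
  by (simp add: Const_def mult_single)

lemma lookup_Const_mult [simp]:
  "Poly_Mapping.lookup (Const c * p) u = c * Poly_Mapping.lookup p u"
proof -
  have "Const c * p = (\<Sum>v \<in> Poly_Mapping.keys p. Poly_Mapping.single v (c * Poly_Mapping.lookup p v))"
    by (subst (1) poly_eq_sum[of p]) (simp add: sum_distrib_left Const_def mult_single)
  then have "Poly_Mapping.lookup (Const c * p) u
      = (\<Sum>v \<in> Poly_Mapping.keys p. if v = u then c * Poly_Mapping.lookup p u else 0)"
    by (simp add: lookup_sum lookup_single when_def)
  then show ?thesis by (simp add: in_keys_iff)
qed

definition expo :: "('n::finite \<Rightarrow> int) \<Rightarrow> 'n \<Rightarrow>\<^sub>0 nat" where
  "expo a = Abs_poly_mapping (\<lambda>i. nat (a i))"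

definition nonneg :: "('n \<Rightarrow> int) \<Rightarrow> bool" where
  "nonneg a \<longleftrightarrow> (\<forall>i. 0 \<le> a i)"

text \<open>The zero polynomial when \<open>a\<close> has a negative entry.\<close>

definition mon :: "('n::finite \<Rightarrow> int) \<Rightarrow> ('n, 'k::comm_ring_1) mpoly" where
  "mon a = (if nonneg a then Poly_Mapping.single (expo a) 1 else 0)"

definition unit_deg :: "'n \<Rightarrow> 'n \<Rightarrow> int" where
  "unit_deg i = (\<lambda>k. if k = i then 1 else 0)"

lemma lookup_expo [simp]: "Poly_Mapping.lookup (expo a) i = nat (a i)"
  by (simp add: expo_def)

lemma mdeg_expo: "nonneg a \<Longrightarrow> mdeg (expo a) = a"
  by (auto simp: mdeg_def nonneg_def)

lemma nonneg_mdeg [simp]: "nonneg (mdeg u)"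
  by (simp add: nonneg_def mdeg_def)

lemma expo_mdeg [simp]: "expo (mdeg u) = u"
  by (rule poly_mapping_eqI) (simp add: mdeg_def)

lemma nonneg_add: "nonneg a \<Longrightarrow> nonneg b \<Longrightarrow> nonneg (a + b)"
  by (simp add: nonneg_def)

lemma nonneg_0 [simp]: "nonneg 0"
  by (simp add: nonneg_def)

lemma nonneg_unit_deg [simp]: "nonneg (unit_deg i)"
  by (simp add: nonneg_def unit_deg_def)

lemma lookup_mon: "Poly_Mapping.lookup (mon a) u = (if mdeg u = a then 1 else 0)"
  using nonneg_mdeg[of u] by (auto simp: mon_def lookup_single when_def mdeg_expo simp del: nonneg_mdeg)

lemma mon_not_nonneg: "\<not> nonneg a \<Longrightarrow> mon a = 0"
  by (simp add: mon_def)

lemma expo_add: "nonneg a \<Longrightarrow> nonneg b \<Longrightarrow> expo (a + b) = expo a + expo b"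
  by (rule poly_mapping_eqI) (auto simp: nonneg_def nat_add_distrib lookup_add)

lemma mon_mult: "nonneg a \<Longrightarrow> nonneg b \<Longrightarrow> mon a * mon b = mon (a + b)"
  by (simp add: mon_def mult_single nonneg_add expo_add)

lemma mon_mdeg: "mon (mdeg u) = Poly_Mapping.single u 1"
  by (simp add: mon_def)

lemma mon_0 [simp]: "mon 0 = 1"
  using mon_mdeg[of 0] by (simp add: mdeg_def zero_fun_def)

lemma Var_eq_mon: "Var i = mon (unit_deg i)"
proof -
  have "mdeg (Poly_Mapping.single i 1) = unit_deg i"
    by (auto simp: mdeg_def unit_deg_def lookup_single when_def)
  then show ?thesis by (metis Var_def mon_mdeg)
qed

lemma Const_mult_mon_eq_0_iff:
  "Const c * mon a = 0 \<longleftrightarrow> c = 0 \<or> \<not> nonneg a"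
proof
  assume 0: "Const c * mon a = 0"
  show "c = 0 \<or> \<not> nonneg a"
  proof (rule disjCI, simp)
    assume "nonneg a"
    then have "Poly_Mapping.lookup (Const c * mon a) (expo a) = c" by (simp add: lookup_mon mdeg_expo)
    then show "c = 0" using 0 by simp
  qed
qed (auto simp: mon_not_nonneg)

lemma Const_mult_mon_mem: "Const c * mon a \<in> poly_comp a"
  by (auto simp: poly_comp_def in_keys_iff lookup_mon split: if_splits)

lemma mon_mem: "mon a \<in> poly_comp a"
  by (auto simp: poly_comp_def in_keys_iff lookup_mon split: if_splits)

lemma hpart_eq: "hpart a p = Const (Poly_Mapping.lookup p (expo a)) * mon a"
  by (rule poly_mapping_eqI) (auto simp: lookup_hpart lookup_mon)

lemma poly_comp_eq: "p \<in> poly_comp a \<Longrightarrow> p = Const (Poly_Mapping.lookup p (expo a)) * mon a"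
  by (rule poly_mapping_eqI) (auto simp: lookup_mon lookup_comp)

text \<open>The polynomials of this shape form a subalgebra, and each of their monomials is a
  product of variables from \<open>Z\<close>, by induction on the total degree. Membership thus
  becomes a condition on single exponents, which passes to homogeneous parts.\<close>

lemma var_subalgebra_iff:
  fixes p :: "('n::finite, 'k::comm_ring_1) mpoly"
  shows "p \<in> var_subalgebra Z \<longleftrightarrow>
    (\<forall>u \<in> Poly_Mapping.keys p. \<forall>i. Poly_Mapping.lookup u i \<noteq> 0 \<longrightarrow> i \<in> Z)"
proof
  let ?T = "{p :: ('n, 'k) mpoly. \<forall>u \<in> Poly_Mapping.keys p. \<forall>i. Poly_Mapping.lookup u i \<noteq> 0 \<longrightarrow> i \<in> Z}"
  have "p + q \<in> ?T \<and> p * q \<in> ?T" if "p \<in> ?T" "q \<in> ?T" for p q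
  proof -
    have "i \<in> Z" if u: "u \<in> Poly_Mapping.keys (p + q)" "Poly_Mapping.lookup u i \<noteq> 0" for u i
      using keys_add[of p q] u \<open>p \<in> ?T\<close> \<open>q \<in> ?T\<close> by blast
    moreover have "i \<in> Z" if u: "u \<in> Poly_Mapping.keys (p * q)" "Poly_Mapping.lookup u i \<noteq> 0" for u i
    proof -
      obtain v w where "u = v + w" "v \<in> Poly_Mapping.keys p" "w \<in> Poly_Mapping.keys q"
        using subsetD[OF keys_mult u(1)] by auto
      moreover from this(1) u(2) have "Poly_Mapping.lookup v i \<noteq> 0 \<or> Poly_Mapping.lookup w i \<noteq> 0"
        by (simp add: lookup_add)
      ultimately show ?thesis using \<open>p \<in> ?T\<close> \<open>q \<in> ?T\<close> by blast
    qed
    ultimately show ?thesis by simp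
  qed
  moreover have "range Const \<subseteq> ?T" by (auto simp: Const_def split: if_splits)
  ultimately have "is_subalgebra ?T" unfolding is_subalgebra_def by (intro conjI ballI) blast+
  moreover have "Var ` Z \<subseteq> ?T" by (auto simp: Var_def lookup_single when_def split: if_splits)
  ultimately have "var_subalgebra Z \<subseteq> ?T"
    unfolding var_subalgebra_def by (intro hull_minimal)
  then show "p \<in> var_subalgebra Z \<Longrightarrow> \<forall>u \<in> Poly_Mapping.keys p. \<forall>i. Poly_Mapping.lookup u i \<noteq> 0 \<longrightarrow> i \<in> Z"
    by blast
next
  assume p: "\<forall>u \<in> Poly_Mapping.keys p. \<forall>i. Poly_Mapping.lookup u i \<noteq> 0 \<longrightarrow> i \<in> Z"
  let ?V = "var_subalgebra Z :: ('n, 'k) mpoly set"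
  have V: "is_subalgebra ?V"
    unfolding var_subalgebra_def by (rule hull_in) (auto simp: is_subalgebra_def)
  have VZ: "Var i \<in> ?V" if "i \<in> Z" for i
    unfolding var_subalgebra_def using that by (intro hull_inc) auto
  have CV: "Const c \<in> ?V" for c using V by (auto simp: is_subalgebra_def)
  have AV: "x + y \<in> ?V" "x * y \<in> ?V" if "x \<in> ?V" "y \<in> ?V" for x y
    using V that by (auto simp: is_subalgebra_def)
  have 1: "Poly_Mapping.single u 1 \<in> ?V" if "\<forall>i. Poly_Mapping.lookup u i \<noteq> 0 \<longrightarrow> i \<in> Z" for u
    using that
  proof (induction "\<Sum>i\<in>UNIV. Poly_Mapping.lookup u i" arbitrary: u rule: less_induct)
    case less
    show ?case
    proof (cases "u = 0")
      case True
      then show ?thesis using CV[of 1] by (simp add: Const_def)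
    next
      case False
      then obtain i where i: "Poly_Mapping.lookup u i \<noteq> 0"
        by (auto simp: poly_mapping_eq_iff fun_eq_iff)
      define v where "v = u - Poly_Mapping.single i 1"
      have u: "u = v + Poly_Mapping.single i 1"
        using i by (intro poly_mapping_eqI) (auto simp: v_def lookup_add lookup_minus lookup_single when_def)
      have "Poly_Mapping.single v 1 \<in> ?V"
      proof (rule less.hyps)
        show "(\<Sum>i\<in>UNIV. Poly_Mapping.lookup v i) < (\<Sum>i\<in>UNIV. Poly_Mapping.lookup u i)"
          by (rule sum_strict_mono_ex1) (auto simp: u lookup_add lookup_single intro!: exI[of _ i])
        show "\<forall>i. Poly_Mapping.lookup v i \<noteq> 0 \<longrightarrow> i \<in> Z"
          using less.prems by (auto simp: u lookup_add)
      qed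
      moreover have "Poly_Mapping.single u 1 = Poly_Mapping.single v 1 * (Var i :: ('n, 'k) mpoly)"
        by (simp add: Var_def mult_single u)
      moreover have "Var i \<in> ?V" using VZ less.prems i by blast
      ultimately show ?thesis by (simp only: AV(2))
    qed
  qed
  have "Poly_Mapping.single u c \<in> ?V" if "\<forall>i. Poly_Mapping.lookup u i \<noteq> 0 \<longrightarrow> i \<in> Z" for u c
    using AV(2)[OF CV[of c] 1[OF that]] by (simp add: Const_def mult_single)
  moreover have "sum f A \<in> ?V" if "\<And>u. u \<in> A \<Longrightarrow> f u \<in> ?V" for f :: "('n \<Rightarrow>\<^sub>0 nat) \<Rightarrow> _" and A
    using that CV[of 0] by (induction A rule: infinite_finite_induct) (auto intro: AV)
  ultimately show "p \<in> ?V"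
    by (subst poly_eq_sum) (use p in auto)
qed


section \<open>Stanley decompositions degree by degree\<close>

text \<open>\<open>dg p\<close> is the degree of the generator of piece \<open>p\<close>. A piece
  has at most one monomial multiple in a given degree; \<open>p\<close> is active where the required
  monomial lies in the subalgebra of \<open>Z p\<close>.\<close>

definition active :: "'i set \<Rightarrow> ('i \<Rightarrow> 'n set) \<Rightarrow> ('i \<Rightarrow> 'n \<Rightarrow> int) \<Rightarrow> ('n \<Rightarrow> int) \<Rightarrow> 'i set" where
  "active I Z dg a = {p \<in> I. \<forall>i. dg p i \<le> a i \<and> (dg p i < a i \<longrightarrow> i \<in> Z p)}"

text \<open>Independence is stated for families over the indices, not for sets of vectors: two
  active pieces giving the same vector, or one giving zero, already violate it. This is how the
  annihilator condition is captured.\<close>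

definition homogeneous_basis ::
    "('n::finite, 'k::comm_ring_1, 'b::ab_group_add) gmod \<Rightarrow> 'i set \<Rightarrow> ('i \<Rightarrow> 'n set) \<Rightarrow> ('i \<Rightarrow> 'b) \<Rightarrow>
     ('i \<Rightarrow> 'n \<Rightarrow> int) \<Rightarrow> ('n \<Rightarrow> int) \<Rightarrow> bool" where
  "homogeneous_basis N I Z m dg a \<longleftrightarrow>
     (\<forall>x \<in> gcomp N a. \<exists>c. x = (\<Sum>p \<in> active I Z dg a. gscale N (Const (c p) * mon (a - dg p)) (m p))) \<and>
     (\<forall>c. (\<Sum>p \<in> active I Z dg a. gscale N (Const (c p) * mon (a - dg p)) (m p)) = 0 \<longrightarrow>
        (\<forall>p \<in> active I Z dg a. c p = 0))"

lemma active_nonneg: "p \<in> active I Z dg a \<Longrightarrow> nonneg (a - dg p)"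
  by (simp add: active_def nonneg_def)

lemma active_self: "p \<in> I \<Longrightarrow> p \<in> active I Z dg (dg p)"
  by (simp add: active_def)

lemma active_monomial_mem:
  assumes "p \<in> active I Z dg a"
  shows "Const c * mon (a - dg p) \<in> var_subalgebra (Z p)"
  unfolding var_subalgebra_iff
proof (intro ballI allI impI)
  fix u i assume "u \<in> Poly_Mapping.keys (Const c * mon (a - dg p))" "Poly_Mapping.lookup u i \<noteq> 0"
  then have "mdeg u = a - dg p" "0 < mdeg u i"
    by (auto simp: in_keys_iff lookup_mon mdeg_def split: if_splits)
  then show "i \<in> Z p" using assms by (simp add: active_def)
qed

lemma hpart_not_active:
  fixes q :: "('n::finite, 'k::comm_ring_1) mpoly"
  assumes "q \<in> var_subalgebra (Z p)" "p \<in> I" "p \<notin> active I Z dg a"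
  shows "hpart (a - dg p) q = 0"
  unfolding hpart_eq_0
proof (intro ballI notI)
  fix u assume u: "u \<in> Poly_Mapping.keys q" "mdeg u = a - dg p"
  then have e: "int (Poly_Mapping.lookup u i) = a i - dg p i" for i by (simp add: mdeg_def fun_eq_iff)
  have "dg p i \<le> a i \<and> (dg p i < a i \<longrightarrow> i \<in> Z p)" for i
    using e[of i] assms(1) u(1) by (auto simp: var_subalgebra_iff)
  then show False using assms(2,3) by (auto simp: active_def)
qed

context multigraded_module
begin

sublocale sm: module "gscale N"
  by (rule module_scale)

sublocale vs: vector_space "\<lambda>c. gscale N (Const c)"
  by unfold_locales
    (simp_all add: sm.scale_right_distrib sm.scale_left_distrib Const_add Const_mult Const_1)

lemma comp_carrier: "x \<in> gcomp N a \<Longrightarrow> x \<in> gcarrier N"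
  using comp_subset by blast

lemma comp_Const_mon: "x \<in> gcomp N b \<Longrightarrow> gscale N (Const c * mon (a - b)) x \<in> gcomp N a"
  using comp_scale[OF Const_mult_mon_mem, of x b c "a - b"] by simp

lemma comp_sum: "(\<And>p. p \<in> A \<Longrightarrow> f p \<in> gcomp N a) \<Longrightarrow> sum f A \<in> gcomp N a"
  by (induction A rule: infinite_finite_induct) (auto simp: comp_zero comp_add)

lemma comp_uminus: assumes "x \<in> gcomp N a" shows "- x \<in> gcomp N a"
proof -
  have "gscale N (Const (- 1) * mon (a - a)) x \<in> gcomp N a" using assms by (rule comp_Const_mon)
  moreover have "gscale N (Const (- 1) * mon (a - a)) x = - x"
    by (simp only: diff_self mon_0 mult_1_right Const_uminus Const_1 sm.scale_minus_left sm.scale_one)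
  ultimately show ?thesis by simp
qed

lemma comp_diff: "x \<in> gcomp N a \<Longrightarrow> y \<in> gcomp N a \<Longrightarrow> x - y \<in> gcomp N a"
  using comp_add[of x a "- y"] comp_uminus[of y a] by simp

text \<open>The family extended by zero and the zero family both decompose 0, so the uniqueness of
  homogeneous decompositions applies.\<close>

lemma homogeneous_sum_eq_0:
  assumes "finite A" "\<And>a. a \<in> A \<Longrightarrow> f a \<in> gcomp N a" "(\<Sum>a \<in> A. f a) = 0" "a \<in> A"
  shows "f a = 0"
proof -
  let ?g = "\<lambda>a. if a \<in> A then f a else 0"
  let ?P = "\<lambda>h. (\<forall>a. h a \<in> gcomp N a) \<and> finite {a. h a \<noteq> 0} \<and> 0 = (\<Sum>a | h a \<noteq> 0. h a)"
  have z: "0 \<in> gcarrier N" using comp_carrier[OF comp_zero] .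
  have "(\<Sum>a | ?g a \<noteq> 0. ?g a) = (\<Sum>a \<in> A. f a)"
    using assms(1) by (intro sum.mono_neutral_cong_left) auto
  moreover have "finite {a. ?g a \<noteq> 0}"
    using assms(1) by (rule rev_finite_subset) auto
  ultimately have "?P ?g" using assms(2,3) by (simp add: comp_zero)
  moreover have "?P (\<lambda>_. 0)" by (simp add: comp_zero)
  ultimately have "?g = (\<lambda>_. 0)" by (rule ex1_unique[OF decomposition[OF z]])
  then have "?g a = 0" by (rule fun_cong)
  then show ?thesis using assms(4) by simp
qed

text \<open>The identity is claimed for all larger finite sets of degrees, so that a degree under
  consideration can be inserted even when no term of the sum has it.\<close>

lemma sum_scale_by_degree:
  assumes "finite I"
  shows "\<exists>A. finite A \<and> (\<forall>B. finite B \<longrightarrow> A \<subseteq> B \<longrightarrow>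
       (\<Sum>p \<in> I. gscale N (q p) (m p)) = (\<Sum>a \<in> B. \<Sum>p \<in> I. gscale N (hpart (a - dg p) (q p)) (m p)))"
proof (intro exI conjI allI impI)
  let ?A = "\<Union>p \<in> I. (\<lambda>d. d + dg p) ` {d. hpart d (q p) \<noteq> 0}"
  show "finite ?A" using assms by (auto simp: finite_hpart)
  fix B assume B: "finite B" "?A \<subseteq> B"
  have "gscale N (q p) (m p) = (\<Sum>a \<in> B. gscale N (hpart (a - dg p) (q p)) (m p))" if "p \<in> I" for p
  proof -
    have "(\<Sum>a \<in> B. hpart (a - dg p) (q p)) = (\<Sum>a \<in> (\<lambda>a. a - dg p) ` B. hpart a (q p))"
      by (subst sum.reindex) (auto simp: inj_on_def)
    also have "\<dots> = q p"
    proof (rule sum_hpart)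
      show "{a. hpart a (q p) \<noteq> 0} \<subseteq> (\<lambda>a. a - dg p) ` B"
      proof
        fix d assume "d \<in> {a. hpart a (q p) \<noteq> 0}"
        then have "d + dg p \<in> B" using B(2) that by blast
        then show "d \<in> (\<lambda>a. a - dg p) ` B" by (intro image_eqI[of _ _ "d + dg p"]) auto
      qed
    qed (use B in auto)
    finally show ?thesis by (simp add: sm.scale_sum_left[symmetric])
  qed
  then show "(\<Sum>p \<in> I. gscale N (q p) (m p)) = (\<Sum>a \<in> B. \<Sum>p \<in> I. gscale N (hpart (a - dg p) (q p)) (m p))"
    by (subst sum.swap) simp
qed

lemma PiE_image_choice:
  assumes "f \<in> (\<Pi>\<^sub>E p \<in> I. g p ` V p)"
  shows "\<exists>q. \<forall>p \<in> I. q p \<in> V p \<and> f p = g p (q p)"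
proof (rule bchoice, rule ballI)
  fix p assume "p \<in> I"
  then show "\<exists>q. q \<in> V p \<and> f p = g p q" using assms by (auto dest!: PiE_mem)
qed

lemma sum_hpart_active:
  assumes "finite I" "\<And>p. p \<in> I \<Longrightarrow> q p \<in> var_subalgebra (Z p)"
  shows "(\<Sum>p \<in> I. gscale N (hpart (a - dg p) (q p)) (m p)) =
    (\<Sum>p \<in> active I Z dg a. gscale N (Const (Poly_Mapping.lookup (q p) (expo (a - dg p))) * mon (a - dg p)) (m p))"
proof (rule sum.mono_neutral_cong_right)
  show "active I Z dg a \<subseteq> I" by (auto simp: active_def)
  show "\<forall>p \<in> I - active I Z dg a. gscale N (hpart (a - dg p) (q p)) (m p) = 0"
  proof
    fix p assume "p \<in> I - active I Z dg a"
    then have "hpart (a - dg p) (q p) = 0" using assms(2) by (blast intro: hpart_not_active)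
    then show "gscale N (hpart (a - dg p) (q p)) (m p) = 0" by (simp only: sm.scale_zero_left)
  qed
qed (use assms(1) in \<open>simp_all add: hpart_eq\<close>)

lemma comp_hpart: "x \<in> gcomp N b \<Longrightarrow> gscale N (hpart (a - b) q) x \<in> gcomp N a"
  by (simp add: hpart_eq comp_Const_mon)

lemma homogeneous_basis_if_stanley_decomposition:
  assumes sd: "stanley_decomposition N I Z m" and dg: "\<And>p. p \<in> I \<Longrightarrow> m p \<in> gcomp N (dg p)"
  shows "homogeneous_basis N I Z m dg a"
  unfolding homogeneous_basis_def
proof (intro conjI ballI allI impI)
  let ?W = "\<lambda>p. (\<lambda>q. gscale N q (m p)) ` var_subalgebra (Z p)"
  have fin: "finite I" and ids: "internal_direct_sum (gcarrier N) I ?W"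
    and ann: "\<And>p. p \<in> I \<Longrightarrow> var_subalgebra (Z p) \<inter> ann N (m p) = {0}"
    using sd by (auto simp: stanley_decomposition_def)
  fix x assume x: "x \<in> gcomp N a"
  obtain f where f: "f \<in> Pi\<^sub>E I ?W" "x = sum f I"
    using ids comp_carrier[OF x] unfolding internal_direct_sum_def by blast
  obtain q where "\<forall>p \<in> I. q p \<in> var_subalgebra (Z p) \<and> f p = gscale N (q p) (m p)"
    using PiE_image_choice[OF f(1)] by (rule exE)
  then have q: "\<And>p. p \<in> I \<Longrightarrow> q p \<in> var_subalgebra (Z p)" "\<And>p. p \<in> I \<Longrightarrow> f p = gscale N (q p) (m p)"
    by blast+
  obtain A where A: "finite A" "\<forall>B. finite B \<longrightarrow> A \<subseteq> B \<longrightarrow>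
       (\<Sum>p \<in> I. gscale N (q p) (m p)) = (\<Sum>a \<in> B. \<Sum>p \<in> I. gscale N (hpart (a - dg p) (q p)) (m p))"
    using sum_scale_by_degree[OF fin, of q m dg] by (elim exE conjE)
  define y where "y = (\<lambda>a. \<Sum>p \<in> I. gscale N (hpart (a - dg p) (q p)) (m p))"
  have yc: "y b \<in> gcomp N b" for b
    unfolding y_def using dg by (intro comp_sum comp_hpart) auto
  let ?B = "insert a A"
  have "x = sum y ?B" using A(2)[rule_format, of ?B] A(1) f(2) q(2) by (auto simp: y_def)
  \<comment> \<open>Removing \<open>x\<close> from the component of degree \<open>a\<close> leaves a
    vanishing sum of homogeneous elements; hence \<open>x\<close> is the degree \<open>a\<close>
    part of the chosen representation.\<close>
  then have "(\<Sum>b \<in> ?B. y b - (if b = a then x else 0)) = 0"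
    using A(1) by (simp add: sum_subtractf)
  then have "y a - (if a = a then x else 0) = 0"
    using A(1) x yc by (intro homogeneous_sum_eq_0[of ?B "\<lambda>b. y b - (if b = a then x else 0)" a])
      (auto intro: comp_diff)
  then have "x = y a" by simp
  then have "x = (\<Sum>p \<in> active I Z dg a.
      gscale N (Const (Poly_Mapping.lookup (q p) (expo (a - dg p))) * mon (a - dg p)) (m p))"
    by (simp only: y_def sum_hpart_active[where q = q and Z = Z, OF fin q(1)])
  then show "\<exists>c. x = (\<Sum>p \<in> active I Z dg a. gscale N (Const (c p) * mon (a - dg p)) (m p))"
    by (rule exI[of _ "\<lambda>p. Poly_Mapping.lookup (q p) (expo (a - dg p))"])
next
  let ?W = "\<lambda>p. (\<lambda>q. gscale N q (m p)) ` var_subalgebra (Z p)"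
  have fin: "finite I" and ids: "internal_direct_sum (gcarrier N) I ?W"
    and ann: "\<And>p. p \<in> I \<Longrightarrow> var_subalgebra (Z p) \<inter> ann N (m p) = {0}"
    using sd by (auto simp: stanley_decomposition_def)
  fix c p
  let ?g = "\<lambda>p. gscale N (Const (c p) * mon (a - dg p)) (m p)"
  assume 0: "(\<Sum>p \<in> active I Z dg a. ?g p) = 0" and p: "p \<in> active I Z dg a"
  have act: "active I Z dg a \<subseteq> I" by (auto simp: active_def)
  \<comment> \<open>\<open>f\<close> and \<open>h\<close> both represent 0 in the direct sum, one by
    the given relation and one trivially; uniqueness makes every term of the relation
    vanish.\<close>
  define f where "f = (\<lambda>p \<in> I. if p \<in> active I Z dg a then ?g p else 0)"
  define h :: "_ \<Rightarrow> 'b" where "h = (\<lambda>p \<in> I. 0)"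
  have W0: "0 \<in> ?W p" for p
    by (rule image_eqI[of _ _ 0]) (auto simp: var_subalgebra_iff)
  let ?P = "\<lambda>f. f \<in> Pi\<^sub>E I ?W \<and> 0 = sum f I"
  have "f \<in> Pi\<^sub>E I ?W"
    unfolding f_def using W0 active_monomial_mem by fastforce
  moreover have "sum f I = 0"
    unfolding f_def using 0 fin act by (simp add: sum.If_cases Int_absorb1)
  ultimately have "?P f" by simp
  moreover have "?P h" using W0 by (auto simp: h_def)
  moreover have "\<exists>!f. ?P f"
    using ids comp_carrier[OF comp_zero] unfolding internal_direct_sum_def by blast
  ultimately have "f = h" by (blast intro: ex1_unique[of ?P])
  then have "f p = h p" by simp
  then have "?g p = 0" using p act by (auto simp: f_def h_def)
  then have "Const (c p) * mon (a - dg p) \<in> var_subalgebra (Z p) \<inter> ann N (m p)"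
    using active_monomial_mem[OF p] by (simp add: ann_def)
  then have "Const (c p) * mon (a - dg p) = 0" using ann p act by blast
  then show "c p = 0" using active_nonneg[OF p] by (simp add: Const_mult_mon_eq_0_iff)
qed

lemma stanley_decomposition_if_homogeneous_bases:
  assumes fin: "finite I" and dg: "\<And>p. p \<in> I \<Longrightarrow> m p \<in> gcomp N (dg p)"
    and basis: "\<And>a. homogeneous_basis N I Z m dg a"
  shows "stanley_decomposition N I Z m"
proof -
  let ?V = "\<lambda>p. var_subalgebra (Z p) :: ('n, 'k) mpoly set"
  let ?W = "\<lambda>p. (\<lambda>q. gscale N q (m p)) ` ?V p"
  \<comment> \<open>A monomial \<open>u\<close> of \<open>q p\<close> shows up in degree
    \<open>mdeg u + dg p\<close>, where \<open>p\<close> is active, and independence there excludes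
    it. Applied to a single nonzero coefficient this gives the annihilator condition, applied to
    differences the uniqueness of representations.\<close>
  have lin: "q p = 0" if q: "\<And>p. p \<in> I \<Longrightarrow> q p \<in> ?V p" "(\<Sum>p \<in> I. gscale N (q p) (m p)) = 0" and p: "p \<in> I"
    for q p
  proof (rule ccontr)
    assume "q p \<noteq> 0"
    then obtain u where u: "u \<in> Poly_Mapping.keys (q p)" by fastforce
    let ?a = "mdeg u + dg p"
    obtain A where A: "finite A" "\<forall>B. finite B \<longrightarrow> A \<subseteq> B \<longrightarrow>
       (\<Sum>p \<in> I. gscale N (q p) (m p)) = (\<Sum>a \<in> B. \<Sum>p \<in> I. gscale N (hpart (a - dg p) (q p)) (m p))"
      using sum_scale_by_degree[OF fin, of q m dg] by (elim exE conjE)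
    let ?y = "\<lambda>a. \<Sum>p \<in> I. gscale N (hpart (a - dg p) (q p)) (m p)"
    have yc: "?y b \<in> gcomp N b" for b using dg by (intro comp_sum comp_hpart)
    have "?y ?a = 0"
    proof (rule homogeneous_sum_eq_0[of "insert ?a A"])
      show "sum ?y (insert ?a A) = 0" using A(2)[rule_format, of "insert ?a A"] A(1) q(2) by auto
    qed (use A(1) yc in blast)+
    then have "(\<Sum>p \<in> active I Z dg ?a. gscale N (Const (Poly_Mapping.lookup (q p) (expo (?a - dg p))) * mon (?a - dg p)) (m p)) = 0"
      by (simp only: sum_hpart_active[OF fin q(1)])
    moreover have "p \<in> active I Z dg ?a"
      using q(1)[OF p] p u by (auto simp: active_def mdeg_def var_subalgebra_iff)
    ultimately have "Poly_Mapping.lookup (q p) (expo (?a - dg p)) = 0"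
      using basis[of ?a] unfolding homogeneous_basis_def
      by (drule_tac conjunct2) (drule spec, drule mp, assumption, blast)
    then show False using u by (simp add: in_keys_iff)
  qed
  have 0: "0 \<in> ?V p" for p by (simp add: var_subalgebra_iff)
  have Vdiff: "q - q' \<in> ?V p" if "q \<in> ?V p" "q' \<in> ?V p" for q q' p
  proof -
    have "u \<in> Poly_Mapping.keys q \<or> u \<in> Poly_Mapping.keys q'" if "u \<in> Poly_Mapping.keys (q - q')" for u
      using that by (auto simp: in_keys_iff lookup_minus)
    then show ?thesis using that unfolding var_subalgebra_iff by blast
  qed
  have sumV: "sum f A \<in> ?V p" if "\<And>a. a \<in> A \<Longrightarrow> f a \<in> ?V p" for f :: "('n \<Rightarrow> int) \<Rightarrow> _" and A p
    using that 0
  proof (induction A rule: infinite_finite_induct)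
    case (insert x F)
    have "f x \<in> ?V p" "sum f F \<in> ?V p" using insert by auto
    then show ?case
      using keys_add[of "f x" "sum f F"] insert.hyps unfolding sum.insert[OF insert.hyps] var_subalgebra_iff
      by blast
  qed auto
  have ann: "?V p \<inter> ann N (m p) = {0}" if p: "p \<in> I" for p
  proof -
    have "q = 0" if "q \<in> ?V p" "gscale N q (m p) = 0" for q
      using lin[of "\<lambda>r. if r = p then q else 0" p] p that 0 fin
      by (simp add: if_distrib[of "\<lambda>q. gscale N q _"] cong: if_cong)
    then show ?thesis using 0 by (auto simp: ann_def)
  qed
  have ids: "\<exists>!f. f \<in> Pi\<^sub>E I ?W \<and> x = sum f I" if x: "x \<in> gcarrier N" for x
  proof -
    obtain h where h: "\<And>a. h a \<in> gcomp N a" "finite {a. h a \<noteq> 0}" "x = (\<Sum>a | h a \<noteq> 0. h a)"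
      using decomposition[OF x] by blast
    have "\<forall>a. \<exists>c. h a = (\<Sum>p \<in> active I Z dg a. gscale N (Const (c p) * mon (a - dg p)) (m p))"
      using basis h(1) unfolding homogeneous_basis_def by blast
    from choice[OF this]
    obtain c where c: "\<forall>a. h a = (\<Sum>p \<in> active I Z dg a. gscale N (Const (c a p) * mon (a - dg p)) (m p))"
      by (rule exE)
    define k where "k = (\<lambda>a p. if p \<in> active I Z dg a then Const (c a p) * mon (a - dg p) else 0)"
    have hk: "h a = (\<Sum>p \<in> I. gscale N (k a p) (m p))" for a
      unfolding c[rule_format] k_def using fin by (intro sum.mono_neutral_cong_left) (auto simp: active_def)
    define q where "q = (\<lambda>p. \<Sum>a | h a \<noteq> 0. k a p)"
    have q: "q p \<in> ?V p" for p
      unfolding q_def by (rule sumV) (use active_monomial_mem 0 in \<open>auto simp: k_def\<close>)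
    have "x = (\<Sum>p \<in> I. gscale N (q p) (m p))"
      unfolding q_def sm.scale_sum_left by (subst sum.swap) (use h(3) hk in simp)
    then have ex: "(\<lambda>p \<in> I. gscale N (q p) (m p)) \<in> Pi\<^sub>E I ?W \<and> x = sum (\<lambda>p \<in> I. gscale N (q p) (m p)) I"
      using q by auto
    have "f = g" if fg: "f \<in> Pi\<^sub>E I ?W \<and> x = sum f I" "g \<in> Pi\<^sub>E I ?W \<and> x = sum g I" for f g
    proof -
      obtain q where "\<forall>p \<in> I. q p \<in> ?V p \<and> f p = gscale N (q p) (m p)"
        using PiE_image_choice[OF conjunct1[OF fg(1)]] by (rule exE)
      then have q: "\<And>p. p \<in> I \<Longrightarrow> q p \<in> ?V p" "\<And>p. p \<in> I \<Longrightarrow> f p = gscale N (q p) (m p)"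
        by blast+
      obtain r where "\<forall>p \<in> I. r p \<in> ?V p \<and> g p = gscale N (r p) (m p)"
        using PiE_image_choice[OF conjunct1[OF fg(2)]] by (rule exE)
      then have r: "\<And>p. p \<in> I \<Longrightarrow> r p \<in> ?V p" "\<And>p. p \<in> I \<Longrightarrow> g p = gscale N (r p) (m p)"
        by blast+
      have "(\<Sum>p \<in> I. gscale N (q p - r p) (m p)) = 0"
        using fg q(2) r(2) by (simp add: sm.scale_left_diff_distrib sum_subtractf)
      then have "q p - r p = 0" if "p \<in> I" for p
        using lin[of "\<lambda>p. q p - r p" p] Vdiff q(1) r(1) that by blast
      then have "f p = g p" if "p \<in> I" for p using that q(2) r(2) by simp
      moreover have "f \<in> extensional I" "g \<in> extensional I" using fg by (auto simp: PiE_def)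
      ultimately show "f = g" by (intro extensionalityI[of f I g]) auto
    qed
    then show ?thesis using ex by blast
  qed
  have "?W p \<subseteq> gcarrier N" if "p \<in> I" for p
    using comp_carrier[OF dg[OF that]] subspace_carrier by (auto simp: sm.subspace_def)
  then show ?thesis
    unfolding stanley_decomposition_def internal_direct_sum_def
    by (intro conjI ballI) (assumption | rule fin ann ids exI | erule dg)+
qed

text \<open>With scalars restricted to the constants, the vectors contributed by the active pieces
  are a basis in the sense of vector spaces, and different pieces contribute different
  vectors.\<close>

lemma card_active_eq_dim:
  assumes fin: "finite I" and dg: "\<And>p. p \<in> I \<Longrightarrow> m p \<in> gcomp N (dg p)"
    and basis: "homogeneous_basis N I Z m dg a"
  shows "card (active I Z dg a) = vs.dim (gcomp N a)"
proof -
  let ?P = "active I Z dg a"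
  let ?g = "\<lambda>p. gscale N (mon (a - dg p)) (m p)"
  have finP: "finite ?P" using fin by (simp add: active_def)
  have sc: "gscale N (Const c * mon (a - dg p)) (m p) = gscale N (Const c) (?g p)" for c p by simp
  have ind: "\<forall>p \<in> ?P. c p = 0" if "(\<Sum>p \<in> ?P. gscale N (Const (c p)) (?g p)) = 0" for c
    using basis that unfolding homogeneous_basis_def sc by blast
  have inj: "inj_on ?g ?P"
  proof (rule inj_onI, rule ccontr)
    fix p q assume pq: "p \<in> ?P" "q \<in> ?P" "?g p = ?g q" "p \<noteq> q"
    let ?c = "\<lambda>r. if r = p then 1 else if r = q then - 1 else (0 :: 'k)"
    have "(\<Sum>r \<in> ?P. gscale N (Const (?c r)) (?g r)) = (\<Sum>r \<in> {p, q}. gscale N (Const (?c r)) (?g r))"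
      using pq finP by (intro sum.mono_neutral_right) auto
    also have "\<dots> = 0" using pq by (simp add: Const_uminus Const_1)
    finally have "\<forall>r \<in> ?P. ?c r = 0" by (rule ind)
    then have "?c p = 0" using pq(1) by (rule bspec)
    then show False by simp
  qed
  have "vs.independent (?g ` ?P)"
  proof (rule vs.independent_if_scalars_zero)
    fix f x assume f: "(\<Sum>x \<in> ?g ` ?P. gscale N (Const (f x)) x) = 0" "x \<in> ?g ` ?P"
    then have "(\<Sum>p \<in> ?P. gscale N (Const (f (?g p))) (?g p)) = 0" by (simp add: sum.reindex[OF inj] o_def)
    then have "\<forall>p \<in> ?P. f (?g p) = 0" by (rule ind)
    then show "f x = 0" using f(2) by blast
  qed (use finP in simp)
  moreover have sub: "?g ` ?P \<subseteq> gcomp N a"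
    using comp_Const_mon[of _ _ 1 a] dg by (auto simp: active_def Const_1)
  moreover have "gcomp N a \<subseteq> vs.span (?g ` ?P)"
  proof
    fix x assume "x \<in> gcomp N a"
    then obtain c where "x = (\<Sum>p \<in> ?P. gscale N (Const (c p)) (?g p))"
      using basis unfolding homogeneous_basis_def sc by blast
    then show "x \<in> vs.span (?g ` ?P)"
      by (simp only:) (intro vs.span_sum vs.span_scale vs.span_base imageI)
  qed
  ultimately have "vs.dim (gcomp N a) = card (?g ` ?P)" by (metis vs.dim_unique)
  then show ?thesis using card_image[OF inj] by simp
qed

text \<open>Both sides are the dimension of the component. An explicit decomposition thus supplies
  the counts for every other one, without any dimension being computed.\<close>

lemma card_active_cong:
  assumes "stanley_decomposition N I Z m" "\<And>p. p \<in> I \<Longrightarrow> m p \<in> gcomp N (dg p)"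
    "stanley_decomposition N I' Z' m'" "\<And>p. p \<in> I' \<Longrightarrow> m' p \<in> gcomp N (dg' p)"
  shows "card (active I Z dg a) = card (active I' Z' dg' a)"
proof -
  have fin: "finite I" "finite I'" using assms(1,3) by (auto simp: stanley_decomposition_def)
  show ?thesis
    using card_active_eq_dim[OF fin(1) assms(2) homogeneous_basis_if_stanley_decomposition[OF assms(1,2)]]
      card_active_eq_dim[OF fin(2) assms(4) homogeneous_basis_if_stanley_decomposition[OF assms(3,4)]]
    by simp
qed

end

section \<open>Bounds on the Stanley depth\<close>

lemma le_stanley_depth_iff:
  "finite I \<Longrightarrow> I \<noteq> {} \<Longrightarrow> k \<le> stanley_depth I Z \<longleftrightarrow> (\<forall>p \<in> I. k \<le> card (Z p))"
  by (simp add: stanley_depth_def)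

text \<open>Without a decomposition, or if depths were unbounded, the maximum in the definition of
  \<open>sdepth\<close> would be a junk value.\<close>

lemma sdepth_le:
  assumes "\<exists>(I :: nat set) Z m. stanley_decomposition N I Z m"
    and "\<And>(I :: nat set) Z m. stanley_decomposition N I Z m \<Longrightarrow> stanley_depth I Z \<le> k"
  shows "sdepth N \<le> k"
proof -
  let ?S = "{stanley_depth I Z | (I :: nat set) Z m. stanley_decomposition N I Z m}"
  have "finite ?S" by (rule finite_subset[of _ "{..k}"]) (use assms(2) in auto)
  moreover have "?S \<noteq> {}" using assms(1) by blast
  ultimately show ?thesis unfolding sdepth_def using assms(2) by (subst Max_le_iff) auto
qed

lemma le_sdepth:
  assumes "stanley_decomposition N (I :: nat set) Z m"
    and "\<And>(I :: nat set) Z m. stanley_decomposition N I Z m \<Longrightarrow> stanley_depth I Z \<le> k"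
  shows "stanley_depth I Z \<le> sdepth N"
proof -
  let ?S = "{stanley_depth I Z | (I :: nat set) Z m. stanley_decomposition N I Z m}"
  have "finite ?S" by (rule finite_subset[of _ "{..k}"]) (use assms(2) in auto)
  then show ?thesis unfolding sdepth_def using assms(1) by (intro Max_ge) blast+
qed

lemma stanley_decomposition_degrees:
  assumes "stanley_decomposition N I Z m"
  shows "\<exists>dg. \<forall>p \<in> I. m p \<in> gcomp N (dg p)"
  using assms by (intro bchoice) (simp add: stanley_decomposition_def)


section \<open>A decomposition of depth five\<close>

text \<open>\<open>K\<^sup>1\<^sup>0\<close> has the coordinates 0 to 8 of the free summand and the coordinate 9 of the maximal
  ideal. It is generated by \<open>u\<close> (label 9) and three blocks of vectors, each with sum \<open>u\<close>:
  labels 0, 1, 10 for the variable 3, labels 2, 3, 4, 11 for the variable 4, and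
  labels 5 to 8, 12 for the variable 5.\<close>

definition block_sum :: "nat \<Rightarrow> nat" where
  "block_sum k = (if k < 2 then 10 else if k < 5 then 11 else 12)"

text \<open>Labels 0 to 8 are the unit vectors of the free coordinates, 9 is \<open>u\<close>, the
  unit vector of coordinate 9, and 10, 11, 12 are \<open>u\<close> minus the unit vectors of their
  block.\<close>

definition label_vec :: "nat \<Rightarrow> nat \<Rightarrow> 'k::comm_ring_1" where
  "label_vec l k =
     (if k = 9 then (if 9 \<le> l then 1 else 0)
      else if l = k then 1 else if l = block_sum k then - 1 else 0)"

definition blocks :: "nat list list" where
  "blocks = [[0, 1, 10], [2, 3, 4, 11], [5, 6, 7, 8, 12]]"

text \<open>The linear map from \<open>K^13\<close> to \<open>K^10\<close> that takes the unit
  vectors to the label vectors, in coordinates.\<close>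

definition lin_comb :: "(nat \<Rightarrow> 'k::comm_ring_1) \<Rightarrow> nat \<Rightarrow> 'k" where
  "lin_comb d k = (if k = 9 then d 9 + d 10 + d 11 + d 12 else d k - d (block_sum k))"

lemma sum_label_vec:
  fixes d :: "nat \<Rightarrow> 'k::comm_ring_1"
  assumes "L \<subseteq> {..<13}" "k < 10"
  shows "(\<Sum>l \<in> L. d l * label_vec l k) = lin_comb (\<lambda>l. if l \<in> L then d l else 0) k"
proof -
  define e where "e = (\<lambda>l. if l \<in> L then d l else 0)"
  have "(\<Sum>l \<in> L. d l * label_vec l k) = (\<Sum>l < 13. e l * label_vec l k)"
    using assms(1) by (intro sum.mono_neutral_cong_left) (auto simp: e_def)
  also have "\<dots> = lin_comb e k"
  proof -
    have "k \<in> {0, 1, 2, 3, 4, 5, 6, 7, 8, 9}" using assms(2) by auto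
    then show ?thesis
      by (elim insertE emptyE) (simp_all add: numeral_eq_Suc label_vec_def lin_comb_def block_sum_def)
  qed
  finally show ?thesis by (simp add: e_def)
qed

definition misses :: "nat list \<Rightarrow> nat list \<Rightarrow> nat list" where
  "misses L b = filter (\<lambda>l. l \<notin> set L) b"

text \<open>Since each block sums to \<open>u\<close>, the labels in \<open>L\<close> give a basis in two cases: \<open>u\<close> together with
  all but one vector of each block, or one complete block together with all but one vector of the
  other two.\<close>

definition basis_labels :: "nat list \<Rightarrow> bool" where
  "basis_labels L \<longleftrightarrow> distinct L \<and> length L = 10 \<and> list_all (\<lambda>l. l < 13) L \<and>
     map (\<lambda>b. length (misses L b)) blocks \<in>
       (if 9 \<in> set L then {[1, 1, 1]} else {[0, 1, 1], [1, 0, 1], [1, 1, 0]})"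

lemma misses_length:
  "length (misses L b) = Suc 0 \<Longrightarrow> \<exists>x \<in> set b. \<forall>l \<in> set b. l \<notin> set L \<longleftrightarrow> l = x"
  "length (misses L b) = 0 \<Longrightarrow> \<forall>l \<in> set b. l \<in> set L"
proof -
  assume "length (misses L b) = Suc 0"
  then obtain x where "filter (\<lambda>l. l \<notin> set L) b = [x]" by (auto simp: misses_def length_Suc_conv)
  then have "set (filter (\<lambda>l. l \<notin> set L) b) = {x}" by simp
  then show "\<exists>x \<in> set b. \<forall>l \<in> set b. l \<notin> set L \<longleftrightarrow> l = x" unfolding set_filter by blast
qed (auto simp: misses_def filter_empty_conv)

text \<open>The complement of the chosen labels is listed because coefficients have to vanish there:
  its three elements give three equations for the three parameters of \<open>coeffs\<close>.\<close>

lemma basis_labels_cases: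
  assumes "basis_labels L"
  obtains x y z where "x \<in> {0, 1, 10}" "y \<in> {2, 3, 4, 11}" "z \<in> {5, 6, 7, 8, 12}"
      "{..<13} - set L = {x, y, z}"
  | x y where "x \<in> {0, 1, 10}" "y \<in> {2, 3, 4, 11}" "{..<13} - set L = {9, x, y}"
  | x y where "x \<in> {0, 1, 10}" "y \<in> {5, 6, 7, 8, 12}" "{..<13} - set L = {9, x, y}"
  | x y where "x \<in> {2, 3, 4, 11}" "y \<in> {5, 6, 7, 8, 12}" "{..<13} - set L = {9, x, y}"
proof -
  define A B C :: "nat set" where ABC: "A = {0, 1, 10}" "B = {2, 3, 4, 11}" "C = {5, 6, 7, 8, 12}"
  have disj: "A \<inter> B = {}" "A \<inter> C = {}" "B \<inter> C = {}" "9 \<notin> A" "9 \<notin> B" "9 \<notin> C"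
    by (auto simp: ABC)
  have un: "{..<13} = A \<union> B \<union> C \<union> {9}" unfolding ABC by (auto simp: lessThan_def) presburger
  have len: "(9 \<in> set L \<and> length (misses L [0, 1, 10]) = Suc 0 \<and> length (misses L [2, 3, 4, 11]) = Suc 0 \<and>
        length (misses L [5, 6, 7, 8, 12]) = Suc 0)
    \<or> (9 \<notin> set L \<and> length (misses L [0, 1, 10]) = Suc 0 \<and> length (misses L [2, 3, 4, 11]) = Suc 0 \<and>
        length (misses L [5, 6, 7, 8, 12]) = 0)
    \<or> (9 \<notin> set L \<and> length (misses L [0, 1, 10]) = Suc 0 \<and> length (misses L [2, 3, 4, 11]) = 0 \<and>
        length (misses L [5, 6, 7, 8, 12]) = Suc 0)
    \<or> (9 \<notin> set L \<and> length (misses L [0, 1, 10]) = 0 \<and> length (misses L [2, 3, 4, 11]) = Suc 0 \<and>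
        length (misses L [5, 6, 7, 8, 12]) = Suc 0)"
    using assms unfolding basis_labels_def blocks_def by (cases "9 \<in> set L") auto
  have sets: "set [0, 1, 10] = A" "set [2, 3, 4, 11] = B" "set [5, 6, 7, 8, 12] = C"
    by (simp_all add: ABC)
  note miss = misses_length[of L "[0, 1, 10]", unfolded sets] misses_length[of L "[2, 3, 4, 11]", unfolded sets]
    misses_length[of L "[5, 6, 7, 8, 12]", unfolded sets]
  consider
      x y z where "9 \<in> set L" "x \<in> A" "y \<in> B" "z \<in> C" "\<forall>l \<in> A. l \<notin> set L \<longleftrightarrow> l = x"
        "\<forall>l \<in> B. l \<notin> set L \<longleftrightarrow> l = y" "\<forall>l \<in> C. l \<notin> set L \<longleftrightarrow> l = z"
    | x y where "9 \<notin> set L" "x \<in> A" "y \<in> B" "\<forall>l \<in> A. l \<notin> set L \<longleftrightarrow> l = x"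
        "\<forall>l \<in> B. l \<notin> set L \<longleftrightarrow> l = y" "\<forall>l \<in> C. l \<in> set L"
    | x y where "9 \<notin> set L" "x \<in> A" "y \<in> C" "\<forall>l \<in> A. l \<notin> set L \<longleftrightarrow> l = x"
        "\<forall>l \<in> C. l \<notin> set L \<longleftrightarrow> l = y" "\<forall>l \<in> B. l \<in> set L"
    | x y where "9 \<notin> set L" "x \<in> B" "y \<in> C" "\<forall>l \<in> B. l \<notin> set L \<longleftrightarrow> l = x"
        "\<forall>l \<in> C. l \<notin> set L \<longleftrightarrow> l = y" "\<forall>l \<in> A. l \<in> set L"
    using len by (elim disjE conjE) (drule miss | (erule bexE, blast))+
  then show thesis
  proof cases
    case (1 x y z)
    then have "{..<13} - set L = {x, y, z}" unfolding un using disj by blast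
    then show thesis using that(1)[of x y z] 1(2-4) unfolding ABC by blast
  next
    case (2 x y)
    then have "{..<13} - set L = {9, x, y}" unfolding un using disj by blast
    then show thesis using that(2)[of x y] 2(2-3) unfolding ABC by blast
  next
    case (3 x y)
    then have "{..<13} - set L = {9, x, y}" unfolding un using disj by blast
    then show thesis using that(3)[of x y] 3(2-3) unfolding ABC by blast
  next
    case (4 x y)
    then have "{..<13} - set L = {9, x, y}" unfolding un using disj by blast
    then show thesis using that(4)[of x y] 4(2-3) unfolding ABC by blast
  qed
qed

text \<open>The coefficient vectors with image \<open>s\<close> form a three-parameter family, because adding a constant
  to the coefficients of a block is compensated by the coefficient of \<open>u\<close>.\<close>

definition coeffs :: "(nat \<Rightarrow> 'k::comm_ring_1) \<Rightarrow> (nat \<Rightarrow> 'k) \<Rightarrow> nat \<Rightarrow> 'k" where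
  "coeffs s t l = (if l < 9 then s l + t (block_sum l) else if l = 9 then s 9 - t 10 - t 11 - t 12 else t l)"

lemma lin_comb_coeffs: "k < 10 \<Longrightarrow> lin_comb (coeffs s t) k = s k"
  by (cases "k = 9") (auto simp: lin_comb_def coeffs_def block_sum_def)

text \<open>The kernel of \<open>lin_comb\<close> is parametrized by its own entries at 10, 11 and
  12: a coordinate below 9 forces its entry to equal the one at the sum label of its block, and
  coordinate 9 fixes the entry of \<open>u\<close>.\<close>

lemma lin_comb_eq_0D:
  assumes "\<forall>k < 10. lin_comb d k = 0" "l < 13"
  shows "d l = coeffs (\<lambda>_. 0) d l"
proof (cases "l = 9")
  case True
  have "lin_comb d 9 = 0" using assms(1) by simp
  then show ?thesis using True by (simp add: lin_comb_def coeffs_def algebra_simps eq_neg_iff_add_eq_0)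
next
  case False
  show ?thesis
  proof (cases "l < 9")
    case True
    then have "lin_comb d l = 0" using assms(1) by simp
    then show ?thesis using True by (simp add: lin_comb_def coeffs_def)
  qed (use False in \<open>simp add: coeffs_def\<close>)
qed

lemma coeffs_block:
  "x \<in> {0, 1, 10} \<Longrightarrow> coeffs s t x = (if x < 9 then s x else 0) + t 10"
  "x \<in> {2, 3, 4, 11} \<Longrightarrow> coeffs s t x = (if x < 9 then s x else 0) + t 11"
  "x \<in> {5, 6, 7, 8, 12} \<Longrightarrow> coeffs s t x = (if x < 9 then s x else 0) + t 12"
  "coeffs s t 9 = s 9 - t 10 - t 11 - t 12"
  by (auto simp: coeffs_def block_sum_def)

text \<open>For \<open>s = 0\<close> all coefficients in a block equal its parameter, so a missing
  label kills the parameter of its block. If \<open>u\<close> is missing, the sum of the parameters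
  vanishes as well, which settles the complete block.\<close>

lemma basis_labels_indep:
  fixes t :: "nat \<Rightarrow> 'k::comm_ring_1"
  assumes "basis_labels L" "\<forall>l \<in> {..<13} - set L. coeffs (\<lambda>_. 0) t l = 0"
  shows "t 10 = 0 \<and> t 11 = 0 \<and> t 12 = 0"
  using assms(1)
proof (cases rule: basis_labels_cases)
  case (1 x y z)
  then show ?thesis using assms(2) unfolding 1(4) by (simp add: coeffs_block del: insert_iff)
next
  case (2 x y)
  then have t: "t 10 = 0" "t 11 = 0" "coeffs (\<lambda>_. 0) t 9 = 0"
    using assms(2) unfolding 2(3) by (simp_all add: coeffs_block(1-3) del: insert_iff)
  then show ?thesis by (simp add: coeffs_block(4))
next
  case (3 x y)
  then have t: "t 10 = 0" "t 12 = 0" "coeffs (\<lambda>_. 0) t 9 = 0"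
    using assms(2) unfolding 3(3) by (simp_all add: coeffs_block(1-3) del: insert_iff)
  then show ?thesis by (simp add: coeffs_block(4))
next
  case (4 x y)
  then have t: "t 11 = 0" "t 12 = 0" "coeffs (\<lambda>_. 0) t 9 = 0"
    using assms(2) unfolding 4(3) by (simp_all add: coeffs_block(1-3) del: insert_iff)
  then show ?thesis by (simp add: coeffs_block(4))
qed

lemma basis_labels_solve:
  fixes s :: "nat \<Rightarrow> 'k::comm_ring_1"
  assumes "basis_labels L"
  shows "\<exists>t. \<forall>l \<in> {..<13} - set L. coeffs s t l = 0"
proof -
  \<comment> \<open>\<open>s'\<close> is zero at the labels 10 to 12, whose coefficient is the bare
    parameter; so \<open>- s' x\<close> is the right parameter for any missing label
    \<open>x\<close> of a block.\<close>
  define s' where "s' = (\<lambda>l. if l < 9 then s l else 0)"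
  from assms show ?thesis
  proof (cases rule: basis_labels_cases)
    case (1 x y z)
    show ?thesis unfolding 1(4)
      by (rule exI[of _ "\<lambda>b. if b = 10 then - s' x else if b = 11 then - s' y else - s' z"])
        (use 1 in \<open>simp add: coeffs_block s'_def del: insert_iff\<close>)
  next
    case (2 x y)
    \<comment> \<open>The parameter of the complete block is forced by the missing \<open>u\<close>:
      the equation \<open>s 9 - t 10 - t 11 - t 12 = 0\<close> is solved for it.\<close>
    show ?thesis unfolding 2(3)
      by (rule exI[of _ "\<lambda>b. if b = 10 then - s' x else if b = 11 then - s' y else s 9 + s' x + s' y"])
        (use 2 in \<open>simp add: coeffs_block s'_def del: insert_iff\<close>)
  next
    case (3 x y)
    show ?thesis unfolding 3(3)
      by (rule exI[of _ "\<lambda>b. if b = 10 then - s' x else if b = 12 then - s' y else s 9 + s' x + s' y"])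
        (use 3 in \<open>simp add: coeffs_block s'_def del: insert_iff\<close>)
  next
    case (4 x y)
    show ?thesis unfolding 4(3)
      by (rule exI[of _ "\<lambda>b. if b = 11 then - s' x else if b = 12 then - s' y else s 9 + s' x + s' y"])
        (use 4 in \<open>simp add: coeffs_block s'_def del: insert_iff\<close>)
  qed
qed

text \<open>\<open>V\<close> is the set of vectors to be reached: everything, or in degree zero only
  the vectors with vanishing coordinate 9, since the maximal ideal has no constants.\<close>

definition labels_span :: "nat set \<Rightarrow> (nat \<Rightarrow> 'k::comm_ring_1) set \<Rightarrow> bool" where
  "labels_span L V \<longleftrightarrow>
     (\<forall>s \<in> V. \<exists>d. \<forall>k < 10. s k = (\<Sum>l \<in> L. d l * label_vec l k)) \<and>
     (\<forall>d :: nat \<Rightarrow> 'k. (\<forall>k < 10. (\<Sum>l \<in> L. d l * label_vec l k) = 0) \<longrightarrow> (\<forall>l \<in> L. d l = 0))"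

text \<open>A combination of labels in \<open>L\<close> is a coefficient vector vanishing off
  \<open>L\<close>. So spanning asks for such a vector in the fibre over \<open>s\<close>, which
  \<open>coeffs s\<close> parametrizes, and independence asks that the fibre over 0 contain only the
  zero vector of this kind.\<close>

lemma labels_spanI:
  fixes V :: "(nat \<Rightarrow> 'k::comm_ring_1) set"
  assumes L: "L \<subseteq> {..<13}"
    and solve: "\<And>s. s \<in> V \<Longrightarrow> \<exists>t. \<forall>l \<in> {..<13} - L. coeffs s t l = 0"
    and indep: "\<And>t :: nat \<Rightarrow> 'k. \<forall>l \<in> {..<13} - L. coeffs (\<lambda>_. 0) t l = 0 \<Longrightarrow> t 10 = 0 \<and> t 11 = 0 \<and> t 12 = 0"
  shows "labels_span L V"
  unfolding labels_span_def
proof (intro conjI ballI allI impI)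
  fix s assume "s \<in> V"
  then obtain t where t: "\<forall>l \<in> {..<13} - L. coeffs s t l = 0" using solve by blast
  have "s k = (\<Sum>l \<in> L. coeffs s t l * label_vec l k)" if "k < 10" for k
  proof -
    have "lin_comb (\<lambda>l. if l \<in> L then coeffs s t l else 0) k = lin_comb (coeffs s t) k"
      using t that by (auto simp: lin_comb_def block_sum_def)
    then show ?thesis using that by (simp add: sum_label_vec[OF L] lin_comb_coeffs)
  qed
  then show "\<exists>d. \<forall>k < 10. s k = (\<Sum>l \<in> L. d l * label_vec l k)" by blast
next
  fix d :: "nat \<Rightarrow> 'k" and l
  assume 0: "\<forall>k < 10. (\<Sum>l \<in> L. d l * label_vec l k) = 0" and l: "l \<in> L"
  define e where "e = (\<lambda>l. if l \<in> L then d l else 0)"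
  have "\<forall>k < 10. lin_comb e k = 0" using 0 by (simp add: sum_label_vec[OF L] e_def)
  then have e: "e j = coeffs (\<lambda>_. 0) e j" if "j < 13" for j using lin_comb_eq_0D that by blast
  have "coeffs (\<lambda>_. 0) e j = 0" if "j \<in> {..<13} - L" for j
    using e[of j] that by (simp add: e_def)
  then have "e 10 = 0 \<and> e 11 = 0 \<and> e 12 = 0" by (intro indep) blast
  then have "coeffs (\<lambda>_. 0) e l = 0"
  proof -
    have "l < 13" using l L by auto
    then have "l < 9 \<or> l = 9 \<or> l = 10 \<or> l = 11 \<or> l = 12" by arith
    then show ?thesis using \<open>e 10 = 0 \<and> e 11 = 0 \<and> e 12 = 0\<close>
      by (elim disjE) (simp_all add: coeffs_def block_sum_def)
  qed
  then show "d l = 0" using e[of l] l L by (auto simp: e_def)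
qed

lemma labels_span_basis: "basis_labels L \<Longrightarrow> labels_span (set L) UNIV"
  by (rule labels_spanI[OF _ basis_labels_solve basis_labels_indep])
    (auto simp: basis_labels_def list_all_iff)

lemma labels_span_zero: "labels_span {..<9} {s :: nat \<Rightarrow> 'k::comm_ring_1. s 9 = 0}"
proof (rule labels_spanI)
  fix s :: "nat \<Rightarrow> 'k" assume "s \<in> {s. s 9 = 0}"
  then show "\<exists>t. \<forall>l \<in> {..<13} - {..<9}. coeffs s t l = 0"
    by (intro exI[of _ "\<lambda>_. 0"]) (auto simp: coeffs_def)
next
  fix t :: "nat \<Rightarrow> 'k" assume "\<forall>l \<in> {..<13} - {..<9}. coeffs (\<lambda>_. 0) t l = 0"
  then have "coeffs (\<lambda>_. 0) t 10 = 0" "coeffs (\<lambda>_. 0) t 11 = 0" "coeffs (\<lambda>_. 0) t 12 = 0" by auto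
  then show "t 10 = 0 \<and> t 11 = 0 \<and> t 12 = 0" by (simp add: coeffs_def)
qed auto

text \<open>A triple \<open>(D, c, l)\<close> stands for the generator \<open>\<Prod>i\<in>D. X i\<close> times the vector with label \<open>l\<close>, over the
  subalgebra without the variable \<open>c\<close>, or over the full polynomial ring if \<open>c = 6\<close>.\<close>

definition pieces :: "(nat list \<times> nat \<times> nat) list" where
  "pieces =
  [([], 3, 0), ([], 3, 1),
   ([], 4, 2), ([], 4, 3), ([], 4, 4),
   ([], 5, 5), ([], 5, 6), ([], 5, 7), ([], 5, 8),
   ([0], 1, 9), ([1], 2, 9), ([2], 0, 9), ([0, 1, 2], 6, 9),
   ([3], 0, 0), ([3], 1, 1), ([3], 2, 10), ([0, 1, 3], 2, 0), ([1, 2, 3], 6, 1), ([0, 2, 3], 6, 10),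
   ([4], 0, 2), ([4], 1, 3), ([4], 2, 4), ([4], 3, 11),
   ([0, 1, 4], 2, 2), ([1, 2, 4], 3, 3), ([2, 3, 4], 0, 4), ([0, 3, 4], 1, 11),
   ([0, 2, 4], 6, 2), ([1, 3, 4], 6, 3), ([0, 1, 2, 3, 4], 6, 4),
   ([5], 0, 5), ([5], 1, 6), ([5], 2, 7), ([5], 3, 8), ([5], 4, 12),
   ([0, 1, 5], 2, 5), ([1, 2, 5], 3, 6), ([2, 3, 5], 4, 7), ([3, 4, 5], 0, 8), ([0, 4, 5], 1, 12),
   ([0, 2, 5], 3, 5), ([1, 3, 5], 4, 6), ([2, 4, 5], 0, 7), ([0, 3, 5], 1, 8), ([1, 4, 5], 2, 12),
   ([0, 1, 2, 3, 5], 4, 5), ([1, 2, 3, 4, 5], 6, 6), ([0, 2, 3, 4, 5], 6, 7),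
   ([0, 1, 3, 4, 5], 6, 8), ([0, 1, 2, 4, 5], 6, 12)]"

text \<open>\<open>bs\<close> records the variables with positive exponent. The appended
  \<open>False\<close> serves the index 6, which stands for no missing variable.\<close>

definition piece_active :: "bool list \<Rightarrow> nat list \<times> nat \<times> nat \<Rightarrow> bool" where
  "piece_active bs = (\<lambda>(D, c, l). list_all (\<lambda>d. bs ! d) D \<and> \<not> (bs @ [False]) ! c)"

definition active_labels :: "bool list \<Rightarrow> nat list" where
  "active_labels bs = map (snd \<circ> snd) (filter (piece_active bs) pieces)"

text \<open>A generator of degree zero may not involve coordinate 9, as the maximal ideal has no
  constants; hence \<open>l < 9\<close> for empty \<open>D\<close>. Keeping the missing variable
  outside \<open>D\<close> makes activity depend only on the support of a degree.\<close>

lemma pieces_wellformed: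
  "distinct pieces \<and> length pieces = 50 \<and>
   list_all (\<lambda>(D, c, l). list_all (\<lambda>d. d < 6 \<and> d \<noteq> c) D \<and> c \<le> 6 \<and> (D = [] \<longrightarrow> l < 9)) pieces"
  by code_simp

lemma active_labels_zero: "active_labels (replicate 6 False) = [0..<9]"
  by code_simp

text \<open>The infinitely many nonzero degrees reduce to 63 nonempty supports, each checked by
  evaluation.\<close>

lemma basis_labels_all:
  "list_all (\<lambda>bs. list_all Not bs \<or> basis_labels (active_labels bs)) (List.n_lists 6 [True, False])"
  by code_simp

lemma basis_labels_active:
  assumes "length bs = 6" "True \<in> set bs"
  shows "basis_labels (active_labels bs)"
proof -
  have "bs \<in> set (List.n_lists 6 [True, False])" using assms(1) by (auto simp: set_n_lists)
  moreover have "\<not> list_all Not bs" using assms(2) by (auto simp: list_all_iff)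
  ultimately show ?thesis using basis_labels_all by (auto simp: list_all_iff)
qed


text \<open>Pieces are indexed by their positions in the table, while the evaluation works on lists
  of labels; distinct labels in the filtered list give injectivity on positions.\<close>

lemma filtered_indices:
  assumes "distinct xs"
  shows "(\<lambda>p. f (xs ! p)) ` {p. p < length xs \<and> P (xs ! p)} = set (map f (filter P xs))"
    and "distinct (map f (filter P xs)) \<Longrightarrow> inj_on (\<lambda>p. f (xs ! p)) {p. p < length xs \<and> P (xs ! p)}"
proof -
  have *: "(!) xs ` {p. p < length xs \<and> P (xs ! p)} = set (filter P xs)"
    unfolding set_filter by (auto simp: in_set_conv_nth)
  then show "(\<lambda>p. f (xs ! p)) ` {p. p < length xs \<and> P (xs ! p)} = set (map f (filter P xs))"
    by (simp flip: image_image[of f "(!) xs"])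
  assume "distinct (map f (filter P xs))"
  then have "inj_on f ((!) xs ` {p. p < length xs \<and> P (xs ! p)})"
    unfolding * by (simp add: distinct_map)
  moreover have "inj_on ((!) xs) {p. p < length xs \<and> P (xs ! p)}"
    using assms by (auto simp: inj_on_def nth_eq_iff_index_eq)
  ultimately show "inj_on (\<lambda>p. f (xs ! p)) {p. p < length xs \<and> P (xs ! p)}"
    using comp_inj_on[of "(!) xs" _ f] by (simp add: o_def)
qed

section \<open>Homogeneous components of M as vectors over K\<close>

abbreviation (input) max_ideal_plus_free :: "('n, 'k::comm_ring_1, ('n, 'k) mpoly \<times> (nat \<Rightarrow> ('n, 'k) mpoly)) gmod"
  where "max_ideal_plus_free \<equiv> dsum_gmod (ideal_gmod max_ideal) (free_gmod 9 (\<lambda>_. 0))"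

text \<open>Slots 0 to 8 of \<open>s\<close> belong to the free summand and slot 9 to the ideal.
  Every element of a component has this form because the polynomial ring is at most one-dimensional
  in each degree.\<close>

definition hvec :: "('n::finite \<Rightarrow> int) \<Rightarrow> (nat \<Rightarrow> 'k::comm_ring_1) \<Rightarrow> ('n, 'k) mpoly \<times> (nat \<Rightarrow> ('n, 'k) mpoly)" where
  "hvec a s = (Const (s 9) * mon a, \<lambda>k. if k < 9 then Const (s k) * mon a else 0)"

lemma mdeg_0 [simp]: "mdeg 0 = 0"
  by (simp add: mdeg_def fun_eq_iff)

lemma expo_0 [simp]: "expo 0 = 0"
  by (rule poly_mapping_eqI) simp

lemma hvec_mem: "(a = 0 \<Longrightarrow> s 9 = 0) \<Longrightarrow> hvec a s \<in> gcomp max_ideal_plus_free a"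
  by (auto simp: hvec_def dsum_gmod_def ideal_gmod_def free_gmod_def Const_mult_mon_mem max_ideal_iff lookup_mon)

lemma hvec_surj:
  assumes "x \<in> gcomp max_ideal_plus_free a"
  obtains s where "x = hvec a s" "a = 0 \<Longrightarrow> s 9 = 0"
proof -
  obtain p v where x: "x = (p, v)" "Poly_Mapping.lookup p 0 = 0" "p \<in> poly_comp a"
      "\<forall>j < 9. v j \<in> poly_comp a" "\<forall>j \<ge> 9. v j = 0"
    using assms by (auto simp: dsum_gmod_def ideal_gmod_def free_gmod_def max_ideal_iff)
  let ?s = "\<lambda>k. if k = 9 then Poly_Mapping.lookup p (expo a) else Poly_Mapping.lookup (v k) (expo a)"
  have "p = Const (?s 9) * mon a" using poly_comp_eq[OF x(3)] by simp
  moreover have "v k = (if k < 9 then Const (?s k) * mon a else 0)" for k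
    using poly_comp_eq[of "v k" a] x(4,5) by auto
  ultimately have "x = hvec a ?s" unfolding hvec_def x(1) by (simp add: fun_eq_iff)
  then show ?thesis by (rule that) (use x(2) in auto)
qed

lemma hvec_scale:
  assumes "nonneg (a - b)" "nonneg b"
  shows "gscale max_ideal_plus_free (Const c * mon (a - b)) (hvec b s) = hvec a (\<lambda>k. c * s k)"
proof -
  have "Const c * mon (a - b) * (Const d * mon b) = Const (c * d) * mon a" for d :: 'b
    using mon_mult[OF assms, where 'b = 'b] by (simp add: Const_mult algebra_simps)
  then show ?thesis
    by (simp add: hvec_def dsum_gmod_def ideal_gmod_def free_gmod_def fun_eq_iff)
qed

lemma hvec_add: "hvec a s + hvec a t = hvec a (\<lambda>k. s k + t k)"
  by (simp add: hvec_def Const_add distrib_right fun_eq_iff)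

lemma hvec_zero: "hvec a (\<lambda>k. 0) = 0"
  by (simp add: hvec_def zero_prod_def fun_eq_iff)

lemma hvec_sum: "(\<Sum>p \<in> A. hvec a (s p)) = hvec a (\<lambda>k. \<Sum>p \<in> A. s p k)"
  by (induction A rule: infinite_finite_induct) (simp_all add: hvec_zero hvec_add)

lemma hvec_eq_0_iff: "hvec a s = 0 \<longleftrightarrow> (\<forall>k < 10. s k = 0) \<or> \<not> nonneg a"
proof -
  have "hvec a s = 0 \<longleftrightarrow> Const (s 9) * mon a = 0 \<and> (\<forall>k < 9. Const (s k) * mon a = 0)"
    by (auto simp: hvec_def zero_prod_def fun_eq_iff)
  also have "\<dots> \<longleftrightarrow> (s 9 = 0 \<and> (\<forall>k < 9. s k = 0)) \<or> \<not> nonneg a"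
    by (auto simp: Const_mult_mon_eq_0_iff)
  also have "(s 9 = 0 \<and> (\<forall>k < 9. s k = 0)) \<longleftrightarrow> (\<forall>k < 10. s k = 0)"
  proof -
    have "k < 10 \<longleftrightarrow> k = 9 \<or> k < 9" for k :: nat by auto
    then show ?thesis by metis
  qed
  finally show ?thesis .
qed

text \<open>The table speaks of variables 0 to 5, while the polynomial ring is indexed by an
  abstract type with six elements; \<open>idx\<close> and \<open>var\<close> translate between the
  two.\<close>

locale six_variables =
  fixes idx :: "'n::finite \<Rightarrow> nat" and var :: "nat \<Rightarrow> 'n"
  assumes var_idx: "var (idx i) = i" and idx_var: "k < 6 \<Longrightarrow> idx (var k) = k" and idx_less: "idx i < 6"
begin

definition piece_deg :: "nat \<Rightarrow> 'n \<Rightarrow> int" where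
  "piece_deg p = (\<lambda>i. if idx i \<in> set (fst (pieces ! p)) then 1 else 0)"

definition piece_vars :: "nat \<Rightarrow> 'n set" where
  "piece_vars p = {i. idx i \<noteq> fst (snd (pieces ! p))}"

definition piece_label :: "nat \<Rightarrow> nat" where
  "piece_label p = snd (snd (pieces ! p))"

definition piece_gen :: "nat \<Rightarrow> ('n, 'k::comm_ring_1) mpoly \<times> (nat \<Rightarrow> ('n, 'k) mpoly)" where
  "piece_gen p = hvec (piece_deg p) (label_vec (piece_label p))"

definition support :: "('n \<Rightarrow> int) \<Rightarrow> bool list" where
  "support a = map (\<lambda>k. 0 < a (var k)) [0..<6]"

abbreviation "active_pieces a \<equiv> active {..<50} piece_vars piece_deg a"

lemma piece_cases:
  assumes "p < 50"
  shows "\<exists>D c l. pieces ! p = (D, c, l) \<and> (\<forall>d \<in> set D. d < 6) \<and> c \<notin> set D \<and> c \<le> 6 \<and> (D = [] \<longrightarrow> l < 9)"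
proof -
  obtain D c l where p: "pieces ! p = (D, c, l)" by (rule prod_cases3)
  have "(D, c, l) \<in> set pieces" using nth_mem[of p pieces] assms pieces_wellformed p by auto
  then have "(\<forall>d \<in> set D. d < 6 \<and> d \<noteq> c) \<and> c \<le> 6 \<and> (D = [] \<longrightarrow> l < 9)"
    using pieces_wellformed by (auto simp: list_all_iff)
  then show ?thesis using p by blast
qed

lemma nonneg_piece_deg: "nonneg (piece_deg p)"
  by (simp add: nonneg_def piece_deg_def)

lemma piece_gen_mem:
  assumes "p < 50"
  shows "piece_gen p \<in> gcomp max_ideal_plus_free (piece_deg p)"
  unfolding piece_gen_def
proof (rule hvec_mem)
  assume 0: "piece_deg p = 0"
  obtain D c l where p: "pieces ! p = (D, c, l)" "\<And>d. d \<in> set D \<Longrightarrow> d < 6" "D = [] \<Longrightarrow> l < 9"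
    using piece_cases[OF assms] by blast
  have "D = []"
  proof (rule ccontr)
    assume "D \<noteq> []"
    then obtain d where d: "d \<in> set D" by (cases D) auto
    then have "piece_deg p (var d) = 1" using p(1,2) by (simp add: piece_deg_def idx_var)
    then show False using 0 by simp
  qed
  then show "label_vec (piece_label p) 9 = 0" using p by (simp add: piece_label_def label_vec_def)
qed

lemma card_variables: "CARD('n) = 6"
proof -
  have "inj idx" using var_idx by (metis injI)
  moreover have "k \<in> range idx" if "k < 6" for k using idx_var[OF that] by (metis rangeI)
  then have "range idx = {..<6}" using idx_less by auto
  ultimately show ?thesis using card_image[of idx UNIV] by simp
qed

lemma card_piece_vars: "5 \<le> card (piece_vars p)"
proof -
  have "UNIV \<subseteq> insert (var (fst (snd (pieces ! p)))) (piece_vars p)"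
    by (auto simp: piece_vars_def) (metis var_idx)
  then have "CARD('n) \<le> card (insert (var (fst (snd (pieces ! p)))) (piece_vars p))"
    by (intro card_mono) auto
  also have "\<dots> \<le> Suc (card (piece_vars p))" by (rule card_insert_le_m1) auto
  finally show ?thesis by (simp add: card_variables)
qed

text \<open>The degree of a generator has entries 0 and 1, so lying below \<open>a\<close> means
  positivity of \<open>a\<close> on \<open>D\<close>. At the missing variable this degree is 0, so
  there activity forces \<open>a\<close> to be 0.\<close>

lemma active_pieces_eq:
  assumes "nonneg a"
  shows "active_pieces a = {p. p < length pieces \<and> piece_active (support a) (pieces ! p)}"
proof -
  have "(\<forall>i. piece_deg p i \<le> a i \<and> (piece_deg p i < a i \<longrightarrow> i \<in> piece_vars p))
      \<longleftrightarrow> piece_active (support a) (pieces ! p)" (is "?L \<longleftrightarrow> ?R") if "p < 50" for p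
  proof -
    obtain D c l where p: "pieces ! p = (D, c, l)" "\<And>d. d \<in> set D \<Longrightarrow> d < 6" "c \<notin> set D" "c \<le> 6"
      using piece_cases[OF \<open>p < 50\<close>] by blast
    have bit: "support a ! k \<longleftrightarrow> 0 < a (var k)" if "k < 6" for k
      using that by (simp add: support_def)
    have bit': "(support a @ [False]) ! k \<longleftrightarrow> k < 6 \<and> 0 < a (var k)" if "k \<le> 6" for k
      using that bit[of k] by (auto simp: nth_append support_def)
    have R: "?R \<longleftrightarrow> (\<forall>d \<in> set D. 0 < a (var d)) \<and> \<not> (c < 6 \<and> 0 < a (var c))"
      using p(2,4) bit bit' by (auto simp: piece_active_def p(1) list_all_iff)
    have deg: "piece_deg p i = (if idx i \<in> set D then 1 else 0)" for i
      by (simp add: piece_deg_def p(1))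
    have vars: "i \<in> piece_vars p \<longleftrightarrow> idx i \<noteq> c" for i by (simp add: piece_vars_def p(1))
    show ?thesis
    proof
      assume L: ?L
      have "0 < a (var d)" if "d \<in> set D" for d
        using L[rule_format, of "var d"] that p(2)[OF that] by (simp add: deg idx_var)
      moreover have "\<not> (c < 6 \<and> 0 < a (var c))"
        using L[rule_format, of "var c"] p(3) by (auto simp: deg vars idx_var)
      ultimately show ?R unfolding R by blast
    next
      assume ?R
      then have R': "\<And>d. d \<in> set D \<Longrightarrow> 0 < a (var d)" "c < 6 \<Longrightarrow> \<not> 0 < a (var c)" unfolding R by blast+
      show ?L
      proof (intro allI conjI impI)
        fix i
        show "piece_deg p i \<le> a i"
          using assms R'(1)[of "idx i"] by (auto simp: deg nonneg_def var_idx)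
        assume "piece_deg p i < a i"
        then show "i \<in> piece_vars p"
          using R'(2) p(3) idx_less[of i] by (auto simp: deg vars var_idx)
      qed
    qed
  qed
  then show ?thesis using pieces_wellformed by (auto simp: active_def)
qed

lemma support_zero: "support 0 = replicate 6 False"
  by (simp add: support_def map_replicate_const)

lemma distinct_active_labels: "distinct (active_labels (support a))"
proof (cases "True \<in> set (support a)")
  case True
  then show ?thesis using basis_labels_active[of "support a"] by (simp add: basis_labels_def support_def)
next
  case False
  then have "support a = replicate 6 False" by (intro replicate_eqI) (auto simp: support_def)
  then show ?thesis by (simp add: active_labels_zero)
qed

lemma active_labels_eq:
  assumes "nonneg a"
  shows "piece_label ` active_pieces a = set (active_labels (support a))"
    and "inj_on piece_label (active_pieces a)"
    and "card (active_pieces a) = length (active_labels (support a))"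
proof -
  have "distinct pieces" using pieces_wellformed by simp
  note filt = filtered_indices[OF this, of "snd \<circ> snd" "piece_active (support a)",
      folded active_labels_def active_pieces_eq[OF assms]]
  have lab: "piece_label = (\<lambda>p. (snd \<circ> snd) (pieces ! p))" by (simp add: piece_label_def fun_eq_iff)
  show 1: "piece_label ` active_pieces a = set (active_labels (support a))"
    unfolding lab by (rule filt(1))
  show 2: "inj_on piece_label (active_pieces a)"
    unfolding lab by (rule filt(2)[OF distinct_active_labels])
  show "card (active_pieces a) = length (active_labels (support a))"
    using card_image[OF 2] distinct_card[OF distinct_active_labels[of a]] 1 by simp
qed

lemma support_pos:
  assumes "nonneg a" "a \<noteq> 0"
  shows "True \<in> set (support a)"
proof -
  obtain i where "a i \<noteq> 0" using assms(2) by (auto simp: fun_eq_iff)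
  then have "0 < a (var (idx i))" using assms(1) by (simp add: var_idx nonneg_def order_less_le)
  then show ?thesis using idx_less[of i] by (force simp: support_def)
qed

lemma card_active_pieces:
  "nonneg a \<Longrightarrow> card (active_pieces a) = (if a = 0 then 9 else 10)"
  using active_labels_eq(3)[of a] support_pos[of a] basis_labels_active[of "support a"]
  by (cases "a = 0")
    (simp_all add: support_zero active_labels_zero basis_labels_def, simp add: support_def)

lemma labels_span_active:
  assumes "nonneg a"
  shows "labels_span (piece_label ` active_pieces a) {s :: nat \<Rightarrow> 'k::comm_ring_1. a = 0 \<longrightarrow> s 9 = 0}"
proof (cases "a = 0")
  case True
  have "set [0..<9] = {..<9::nat}" by auto
  then show ?thesis using labels_span_zero
    by (simp add: True active_labels_eq(1)[OF nonneg_0] support_zero active_labels_zero)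
next
  case False
  then show ?thesis
    using labels_span_basis[OF basis_labels_active[OF _ support_pos[OF assms]]]
    by (simp add: active_labels_eq(1)[OF assms] support_def)
qed

text \<open>In degree \<open>a\<close> every active generator becomes its label vector times the
  same monomial, so the claim is linear algebra over the field, settled by
  \<open>labels_span_active\<close>.\<close>

lemma homogeneous_basis_pieces:
  "homogeneous_basis (max_ideal_plus_free :: ('n, 'k::field, _) gmod) {..<50} piece_vars piece_gen piece_deg a"
proof (cases "nonneg a")
  case False
  have "active_pieces a = {}"
    using False by (force simp: active_def nonneg_def piece_deg_def split: if_splits)
  moreover have "x = 0" if "x \<in> gcomp (max_ideal_plus_free :: ('n, 'k, _) gmod) a" for x
    using hvec_surj[OF that] False hvec_eq_0_iff by metis
  ultimately show ?thesis by (simp add: homogeneous_basis_def)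
next
  case True
  let ?P = "active_pieces a" and ?M = "max_ideal_plus_free :: ('n, 'k, _) gmod"
  have sum: "(\<Sum>p \<in> ?P. gscale ?M (Const (c p) * mon (a - piece_deg p)) (piece_gen p))
      = hvec a (\<lambda>k. \<Sum>p \<in> ?P. c p * label_vec (piece_label p) k)" for c
  proof -
    have "gscale ?M (Const (c p) * mon (a - piece_deg p)) (piece_gen p)
        = hvec a (\<lambda>k. c p * label_vec (piece_label p) k)" if "p \<in> ?P" for p
      unfolding piece_gen_def by (rule hvec_scale[OF active_nonneg[OF that] nonneg_piece_deg])
    then show ?thesis by (simp add: hvec_sum)
  qed
  have reindex: "(\<Sum>l \<in> piece_label ` ?P. d l * label_vec l k) = (\<Sum>p \<in> ?P. d (piece_label p) * label_vec (piece_label p) k)"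
    for d :: "nat \<Rightarrow> 'k" and k
    by (subst sum.reindex[OF active_labels_eq(2)[OF True]]) simp
  have "labels_span (piece_label ` ?P) {s :: nat \<Rightarrow> 'k. a = 0 \<longrightarrow> s 9 = 0}"
    by (rule labels_span_active[OF True])
  note span = this[unfolded labels_span_def reindex]
  show ?thesis
    unfolding homogeneous_basis_def sum
  proof (intro conjI ballI allI impI)
    fix x assume "x \<in> gcomp ?M a"
    then obtain s where s: "x = hvec a s" "a = 0 \<longrightarrow> s 9 = 0" by (rule hvec_surj) blast
    then obtain d where "\<forall>k < 10. s k = (\<Sum>p \<in> ?P. d (piece_label p) * label_vec (piece_label p) k)"
      using span by blast
    then have "x = hvec a (\<lambda>k. \<Sum>p \<in> ?P. d (piece_label p) * label_vec (piece_label p) k)"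
      unfolding s hvec_def by (simp add: fun_eq_iff)
    then show "\<exists>c. x = hvec a (\<lambda>k. \<Sum>p \<in> ?P. c p * label_vec (piece_label p) k)"
      by (rule exI[of _ "\<lambda>p. d (piece_label p)"])
  next
    fix c :: "nat \<Rightarrow> 'k" and p
    assume 0: "hvec a (\<lambda>k. \<Sum>p \<in> ?P. c p * label_vec (piece_label p) k) = 0" and p: "p \<in> ?P"
    \<comment> \<open>Coefficients on pieces turn into coefficients on labels, which is well defined
      because active pieces have distinct labels.\<close>
    let ?d = "\<lambda>l. c (the_inv_into ?P piece_label l)"
    have d: "?d (piece_label q) = c q" if "q \<in> ?P" for q
      using the_inv_into_f_f[OF active_labels_eq(2)[OF True] that] by simp
    have "\<forall>k < 10. (\<Sum>p \<in> ?P. ?d (piece_label p) * label_vec (piece_label p) k) = 0"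
      using 0 True by (simp add: hvec_eq_0_iff d)
    then have "\<forall>l \<in> piece_label ` ?P. ?d l = 0" using conjunct2[OF span, rule_format, of ?d] by blast
    then show "c p = 0" using p d[OF p] by auto
  qed
qed

lemma stanley_decomposition_pieces:
  "stanley_decomposition (max_ideal_plus_free :: ('n, 'k::field, _) gmod) {..<50} piece_vars piece_gen"
  by (rule multigraded_module.stanley_decomposition_if_homogeneous_bases
      [OF multigraded_max_ideal_dsum_free _ _ homogeneous_basis_pieces])
    (simp_all add: piece_gen_mem)

text \<open>Full pieces would make the ten generators active in degree \<open>X i\<close> and the ten in degree \<open>X j\<close>
  share only the nine of degree zero, which leaves eleven in degree \<open>X i X j\<close>.\<close>

lemma stanley_depth_le_5:
  assumes sd: "stanley_decomposition (max_ideal_plus_free :: ('n, 'k::field, _) gmod) I Z m"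
  shows "I \<noteq> {}" "stanley_depth I Z \<le> 5"
proof -
  let ?M = "max_ideal_plus_free :: ('n, 'k, _) gmod"
  obtain dg where dg: "\<forall>p \<in> I. m p \<in> gcomp ?M (dg p)"
    using stanley_decomposition_degrees[OF sd] by (rule exE)
  have fin: "finite I" using sd by (simp add: stanley_decomposition_def)
  have card: "card (active I Z dg a) = (if a = 0 then 9 else 10)" if "nonneg a" for a
    unfolding card_active_pieces[OF that, symmetric]
    by (rule multigraded_module.card_active_cong[OF multigraded_max_ideal_dsum_free sd _ stanley_decomposition_pieces])
      (use dg piece_gen_mem in auto)
  show "I \<noteq> {}" using card[of 0] by (auto simp: active_def)
  show "stanley_depth I Z \<le> 5"
  proof (rule ccontr)
    assume "\<not> stanley_depth I Z \<le> 5"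
    then have "\<forall>p \<in> I. 6 \<le> card (Z p)" using le_stanley_depth_iff[OF fin \<open>I \<noteq> {}\<close>, of 6 Z] by simp
    then have Z: "Z p = UNIV" if "p \<in> I" for p
      using that by (intro card_seteq) (simp_all add: card_variables)
    then have act: "active I Z dg a = {p \<in> I. \<forall>i. dg p i \<le> a i}" for a
      by (auto simp: active_def)
    have ne: "var 0 \<noteq> var 1" using idx_var[of 0] idx_var[of 1] by auto
    let ?x = "unit_deg (var 0) :: 'n \<Rightarrow> int" and ?y = "unit_deg (var 1) :: 'n \<Rightarrow> int"
    have pos: "?x \<noteq> 0" "?y \<noteq> 0" "?x + ?y \<noteq> 0"
      by (auto simp: fun_eq_iff unit_deg_def)
    have "active I Z dg ?x \<union> active I Z dg ?y \<subseteq> active I Z dg (?x + ?y)"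
    proof -
      have "b \<le> (?x + ?y) i" if "b \<le> ?x i \<or> b \<le> ?y i" for b i
        using that by (auto simp: unit_deg_def)
      then show ?thesis unfolding act by blast
    qed
    then have "card (active I Z dg ?x \<union> active I Z dg ?y) \<le> card (active I Z dg (?x + ?y))"
      using fin by (intro card_mono) (simp_all add: active_def)
    moreover have "active I Z dg ?x \<inter> active I Z dg ?y \<subseteq> active I Z dg 0"
    proof -
      have "b \<le> 0 i" if "b \<le> ?x i" "b \<le> ?y i" for b i
        using that ne by (auto simp: unit_deg_def split: if_splits)
      then show ?thesis unfolding act by blast
    qed
    then have "card (active I Z dg ?x \<inter> active I Z dg ?y) \<le> card (active I Z dg 0)"
      using fin by (intro card_mono) (simp_all add: active_def)
    moreover have "card (active I Z dg ?x) = 10" "card (active I Z dg ?y) = 10"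
        "card (active I Z dg (?x + ?y)) = 10" "card (active I Z dg 0) = 9"
      using card pos by (simp_all add: nonneg_add)
    moreover have "finite (active I Z dg ?x)" "finite (active I Z dg ?y)" using fin by (simp_all add: active_def)
    ultimately show False using card_Un_Int[of "active I Z dg ?x" "active I Z dg ?y"] by simp
  qed
qed

lemma sdepth_max_ideal_plus_free: "sdepth (max_ideal_plus_free :: ('n, 'k::field, _) gmod) = 5"
proof (rule antisym)
  show "sdepth (max_ideal_plus_free :: ('n, 'k, _) gmod) \<le> 5"
    by (intro sdepth_le exI) (rule stanley_decomposition_pieces, erule stanley_depth_le_5(2))
  have "5 \<le> stanley_depth {..<50::nat} piece_vars"
    using card_piece_vars by (subst le_stanley_depth_iff) (auto simp: lessThan_empty_iff)
  also have "\<dots> \<le> sdepth (max_ideal_plus_free :: ('n, 'k, _) gmod)"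
    using stanley_decomposition_pieces stanley_depth_le_5(2) by (rule le_sdepth)
  finally show "5 \<le> sdepth (max_ideal_plus_free :: ('n, 'k, _) gmod)" .
qed

end

section \<open>The first syzygy module\<close>

lemma poly_comp_eq_0: "(p :: ('n::finite, 'k::comm_ring_1) mpoly) \<in> poly_comp a \<Longrightarrow> \<not> nonneg a \<Longrightarrow> p = 0"
  using poly_comp_eq[of p a] by (simp add: mon_not_nonneg)

lemma Const_mem: "(Const c :: ('n::finite, 'k::comm_ring_1) mpoly) \<in> poly_comp 0"
  using Const_mult_mon_mem[of c 0] by simp

lemma nonneg_diff_unit_deg: "nonneg a \<Longrightarrow> nonneg (a - unit_deg i) \<longleftrightarrow> 0 < a i"
proof -
  assume a: "nonneg a"
  have "0 < a i" if "nonneg (a - unit_deg i)"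
    using that[unfolded nonneg_def, rule_format, of i] by (simp add: unit_deg_def)
  moreover have "nonneg (a - unit_deg i)" if "0 < a i"
    using a that by (simp add: nonneg_def unit_deg_def)
  ultimately show ?thesis by blast
qed

lemma nonneg_diffD: "nonneg (a - b) \<Longrightarrow> nonneg b \<Longrightarrow> nonneg a"
  unfolding nonneg_def by (auto intro: order_trans)

lemma Var_mult_mon: "nonneg a \<Longrightarrow> Var i * mon a = mon (a + unit_deg i)"
  by (simp add: Var_eq_mon mon_mult add.commute)

lemma Var_mult_mon_diff:
  assumes "nonneg (a - unit_deg i)"
  shows "Var i * mon (a - unit_deg i) = mon a"
  using Var_mult_mon[OF assms, of i] by simp

lemma Var_mult_Const_mon_diff:
  assumes "nonneg (a - unit_deg i)"
  shows "Var i * (Const c * mon (a - unit_deg i)) = Const c * mon a"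
    and "Const c * mon (a - unit_deg i) * Var i = Const c * mon a"
  unfolding Var_mult_mon_diff[OF assms, symmetric]
  by (simp_all only: mult.left_commute mult.assoc mult.commute[of _ "Var i"])

text \<open>What is kept of a minimal resolution is the augmentation. Its kernel is the image of the
  first differential, so minimality becomes containment of the kernel in
  \<open>max_ideal_times F\<close>. Rank and basis degrees stay arbitrary.\<close>

locale max_ideal_free_cover =
  fixes q r :: nat and b :: "nat \<Rightarrow> 'n::finite \<Rightarrow> int"
    and aug :: "(nat \<Rightarrow> ('n, 'k::field) mpoly) \<Rightarrow> ('n, 'k) mpoly \<times> (nat \<Rightarrow> ('n, 'k) mpoly)"
    and F :: "('n, 'k, nat \<Rightarrow> ('n, 'k) mpoly) gmod"
    and N :: "('n, 'k, ('n, 'k) mpoly \<times> (nat \<Rightarrow> ('n, 'k) mpoly)) gmod"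
    and S :: "('n, 'k, nat \<Rightarrow> ('n, 'k) mpoly) gmod"
  assumes F: "F = free_gmod r b"
    and N: "N = dsum_gmod (ideal_gmod max_ideal) (free_gmod q (\<lambda>_. 0))"
    and S: "S = kernel_gmod F aug"
    and hom: "graded_hom F N aug"
    and surj: "aug ` gcarrier F = gcarrier N"
    and minimal: "gcarrier S \<subseteq> max_ideal_times F"
begin

sublocale F: multigraded_module F
  unfolding F by (rule multigraded_free)

sublocale N: multigraded_module N
  unfolding N by (rule multigraded_max_ideal_dsum_free)

lemma gscale_F [simp]: "gscale F p v = (\<lambda>j. p * v j)"
  by (simp add: F free_gmod_def)

lemma gcomp_F: "v \<in> gcomp F a \<longleftrightarrow> (\<forall>j < r. v j \<in> poly_comp (a - b j)) \<and> (\<forall>j \<ge> r. v j = 0)"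
  by (simp add: F free_gmod_def)

lemma gcomp_F_coord: "v \<in> gcomp F a \<Longrightarrow> v j \<in> poly_comp (a - b j)"
  by (cases "j < r") (auto simp: gcomp_F poly_comp_zero)

lemma gscale_N [simp]: "gscale N p (x, w) = (p * x, \<lambda>j. p * w j)"
  by (simp add: N dsum_gmod_def ideal_gmod_def free_gmod_def)

lemma gcomp_N:
  "(x, w) \<in> gcomp N a \<longleftrightarrow>
     Poly_Mapping.lookup x 0 = 0 \<and> x \<in> poly_comp a \<and> (\<forall>j < q. w j \<in> poly_comp a) \<and> (\<forall>j \<ge> q. w j = 0)"
  by (simp add: N dsum_gmod_def ideal_gmod_def free_gmod_def max_ideal_iff)

lemma gcomp_N_eq_0:
  assumes "y \<in> gcomp N a" "\<not> nonneg a"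
  shows "y = 0"
proof -
  obtain x w where y: "y = (x, w)" by (cases y)
  have "w j = 0" for j
    using assms unfolding y gcomp_N by (cases "j < q") (auto dest: poly_comp_eq_0)
  moreover have "x = 0" using assms unfolding y gcomp_N by (auto dest: poly_comp_eq_0)
  ultimately show ?thesis by (simp add: y zero_prod_def fun_eq_iff)
qed

lemma gcomp_N_0_fst: "y \<in> gcomp N 0 \<Longrightarrow> fst y = 0"
  by (cases y) (auto simp: gcomp_N dest!: poly_comp_eq)

lemma aug_add: "v \<in> gcomp F a \<Longrightarrow> w \<in> gcomp F a \<Longrightarrow> aug (v + w) = aug v + aug w"
  using hom F.comp_carrier unfolding graded_hom_def by blast

lemma aug_scale:
  assumes "v \<in> gcomp F a"
  shows "aug (\<lambda>j. p * v j) = gscale N p (aug v)"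
proof -
  have "aug (gscale F p v) = gscale N p (aug v)"
    using hom F.comp_carrier[OF assms] unfolding graded_hom_def by blast
  then show ?thesis by simp
qed

lemma aug_comp: "v \<in> gcomp F a \<Longrightarrow> aug v \<in> gcomp N a"
  using hom unfolding graded_hom_def by blast

lemma aug_sum: "(\<And>x. x \<in> A \<Longrightarrow> f x \<in> gcarrier F) \<Longrightarrow> aug (sum f A) = (\<Sum>x \<in> A. aug (f x))"
  by (rule graded_hom_sum[OF hom F.multigraded_module_axioms])

lemma aug_diff: "v \<in> gcomp F a \<Longrightarrow> w \<in> gcomp F a \<Longrightarrow> aug (v - w) = aug v - aug w"
  using aug_add[OF F.comp_diff, of v a w w] by (simp add: algebra_simps)

lemma scale_comp: "v \<in> gcomp F c \<Longrightarrow> (\<lambda>j. Const d * mon (a - c) * v j) \<in> gcomp F a"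
  using F.comp_Const_mon[of v c d a] by simp

lemma mon_scale_comp: "v \<in> gcomp F c \<Longrightarrow> (\<lambda>j. mon (a - c) * v j) \<in> gcomp F a"
  using scale_comp[of v c 1 a] by (simp add: Const_1)

text \<open>Any preimage splits into homogeneous parts, and as \<open>aug\<close> respects degrees,
  its part of degree \<open>a\<close> already maps to \<open>y\<close>.\<close>

lemma graded_lift:
  assumes y: "y \<in> gcomp N a"
  shows "\<exists>v. v \<in> gcomp F a \<and> aug v = y"
proof -
  have "y \<in> aug ` gcarrier F" unfolding surj by (rule N.comp_carrier[OF y])
  then obtain v where v: "v \<in> gcarrier F" "aug v = y" by blast
  obtain f where f: "\<forall>c. f c \<in> gcomp F c" "finite {c. f c \<noteq> 0}" "v = (\<Sum>c | f c \<noteq> 0. f c)"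
    using F.decomposition[OF v(1)] by (elim ex1E conjE)
  let ?A = "insert a {c. f c \<noteq> 0}"
  have "v = sum f ?A" using f(2,3) by (simp add: sum.insert_if)
  moreover have "aug (sum f ?A) = (\<Sum>c \<in> ?A. aug (f c))"
    by (rule aug_sum, rule F.comp_carrier, rule f(1)[rule_format])
  ultimately have "y = (\<Sum>c \<in> ?A. aug (f c))" using v(2) by simp
  then have "(\<Sum>c \<in> ?A. aug (f c) - (if c = a then y else 0)) = 0"
    using f(2) by (simp only: sum_subtractf sum.delta finite_insert insert_iff simp_thms if_True) simp
  then have "aug (f a) - (if a = a then y else 0) = 0"
  proof (rule N.homogeneous_sum_eq_0[rotated 2])
    show "aug (f c) - (if c = a then y else 0) \<in> gcomp N c" for c
      using f(1) y by (auto intro!: N.comp_diff aug_comp N.comp_zero)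
  qed (use f(2) in auto)
  then show ?thesis using f(1) by (intro exI[of _ "f a"]) simp
qed

lemma max_ideal_times_F: "v \<in> max_ideal_times F \<Longrightarrow> Poly_Mapping.lookup (v j) 0 = 0"
  unfolding max_ideal_times_def
proof (induction rule: F.sm.span_induct_alt)
  case (step c x y)
  then obtain p w where x: "x = (\<lambda>j. p * w j)" "p \<in> max_ideal" by auto
  have "Poly_Mapping.lookup (c * w j * p) 0 = 0" using x(2) by (simp add: lookup_mult_0 max_ideal_iff)
  then show ?case using step x(1) by (simp add: lookup_add algebra_simps)
qed simp

text \<open>A coordinate whose basis vector has degree \<open>a\<close> is a constant, and
  minimality forbids constant terms in the kernel.\<close>

lemma kernel_coord_eq_0:
  assumes "v \<in> gcomp F a" "aug v = 0" "b j = a"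
  shows "v j = 0"
proof -
  have "v \<in> gcarrier S" using assms F.comp_carrier by (simp add: S kernel_gmod_def)
  then have "Poly_Mapping.lookup (v j) 0 = 0" using minimal max_ideal_times_F by blast
  then show ?thesis using poly_comp_eq[OF gcomp_F_coord[OF assms(1), of j]] assms(3) by simp
qed

section \<open>Generating the cover by lifts of the variables and its degree zero part\<close>

definition gam :: "'n \<Rightarrow> nat \<Rightarrow> ('n, 'k) mpoly" where
  "gam i = (SOME v. v \<in> gcomp F (unit_deg i) \<and> aug v = (Var i, 0))"

lemma gam: "gam i \<in> gcomp F (unit_deg i)" "aug (gam i) = (Var i, 0)"
proof -
  have "unit_deg i \<noteq> 0" by (auto simp: unit_deg_def fun_eq_iff)
  then have "(Var i, 0) \<in> gcomp N (unit_deg i)"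
    by (auto simp: gcomp_N Var_eq_mon lookup_mon mon_mem poly_comp_zero)
  then show "gam i \<in> gcomp F (unit_deg i)" "aug (gam i) = (Var i, 0)"
    using someI_ex[OF graded_lift] unfolding gam_def by blast+
qed

definition lifted :: "('n \<Rightarrow> int) \<Rightarrow> (nat \<Rightarrow> ('n, 'k) mpoly) \<Rightarrow> ('n \<Rightarrow> 'k) \<Rightarrow> nat \<Rightarrow> ('n, 'k) mpoly" where
  "lifted a t d = (\<lambda>j. mon a * t j + (\<Sum>k \<in> UNIV. Const (d k) * mon (a - unit_deg k) * gam k j))"

text \<open>The degree \<open>a\<close> component of the submodule generated by the degree zero
  component of \<open>F\<close> and the lifts \<open>gam\<close>. One \<open>t\<close> suffices
  because the ring has at most one monomial in each degree.\<close>

definition generated :: "('n \<Rightarrow> int) \<Rightarrow> (nat \<Rightarrow> ('n, 'k) mpoly) set" where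
  "generated a = {lifted a t d | t d. t \<in> gcomp F 0}"

lemma lifted_add: "lifted a t d + lifted a t' d' = lifted a (t + t') (\<lambda>k. d k + d' k)"
  by (simp add: lifted_def fun_eq_iff Const_add algebra_simps sum.distrib)

lemma generatedI: "t \<in> gcomp F 0 \<Longrightarrow> lifted a t d \<in> generated a"
  by (auto simp: generated_def)

lemma generated_add: "v \<in> generated a \<Longrightarrow> w \<in> generated a \<Longrightarrow> v + w \<in> generated a"
proof -
  assume "v \<in> generated a" "w \<in> generated a"
  then obtain t d t' d' where "v = lifted a t d" "w = lifted a t' d'" "t \<in> gcomp F 0" "t' \<in> gcomp F 0"
    by (auto simp: generated_def)
  then show "v + w \<in> generated a" by (simp add: lifted_add generatedI F.comp_add)
qed

lemma generated_0: "0 \<in> generated a"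
proof -
  have "lifted a 0 (\<lambda>_. 0) = 0" by (simp add: lifted_def fun_eq_iff)
  then show ?thesis using generatedI[OF F.comp_zero, of a "\<lambda>_. 0"] by simp
qed

lemma generated_sum: "(\<And>x. x \<in> A \<Longrightarrow> f x \<in> generated a) \<Longrightarrow> sum f A \<in> generated a"
  by (induction A rule: infinite_finite_induct) (auto simp: generated_0 generated_add)

lemma generated_Var:
  assumes "v \<in> generated (a - unit_deg i)"
  shows "(\<lambda>j. Var i * v j) \<in> generated a"
proof -
  obtain t d where t: "t \<in> gcomp F 0" "v = lifted (a - unit_deg i) t d"
    using assms by (auto simp: generated_def)
  show ?thesis
  proof (cases "nonneg (a - unit_deg i)")
    case False
    then have "\<not> nonneg (a - unit_deg i - unit_deg k)" for k
      using nonneg_diffD[of "a - unit_deg i" "unit_deg k"] by auto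
    then have "v j = 0" for j using False by (simp add: t(2) lifted_def mon_not_nonneg)
    then have "(\<lambda>j. Var i * v j) = 0" by (simp add: fun_eq_iff)
    then show ?thesis using generated_0 by simp
  next
    case True
    \<comment> \<open>Where \<open>mon (a - unit_deg i - unit_deg k)\<close> is zero, its product
      with \<open>Var i\<close> is zero but \<open>mon (a - unit_deg k)\<close> need not be, so the
      coefficient has to be reset.\<close>
    define e where "e = (\<lambda>k. if nonneg (a - unit_deg k - unit_deg i) then d k else 0)"
    have coeff: "Var i * (Const (d k) * mon (a - unit_deg i - unit_deg k)) = Const (e k) * mon (a - unit_deg k)" for k
    proof -
      have eq: "a - unit_deg i - unit_deg k = a - unit_deg k - unit_deg i" by (simp add: fun_eq_iff)
      show ?thesis
      proof (cases "nonneg (a - unit_deg k - unit_deg i)")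
        case True
        then show ?thesis unfolding eq Var_mult_Const_mon_diff(1)[OF True] by (simp add: e_def)
      qed (simp add: eq e_def mon_not_nonneg)
    qed
    have "Var i * v j = lifted a t e j" for j
    proof -
      have "Var i * v j = (Var i * mon (a - unit_deg i)) * t j +
          (\<Sum>k \<in> UNIV. Var i * (Const (d k) * mon (a - unit_deg i - unit_deg k)) * gam k j)"
        unfolding t(2) lifted_def distrib_left sum_distrib_left mult.assoc ..
      then show ?thesis unfolding coeff Var_mult_mon_diff[OF True] lifted_def .
    qed
    then have "(\<lambda>j. Var i * v j) = lifted a t e" by (rule ext)
    then show ?thesis using t(1) by (auto simp: generated_def)
  qed
qed

text \<open>In a nonnegative degree other than 0 all coordinates of the image of \<open>v\<close>
  are scalar multiples of \<open>X^a\<close>. Those of the free part are reached from degree zero,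
  the one in the ideal from a single lift \<open>gam i\<close> with \<open>0 < a i\<close>.\<close>

lemma reduce_to_kernel:
  assumes v: "v \<in> gcomp F a"
  shows "\<exists>u. u \<in> generated a \<and> u \<in> gcomp F a \<and> aug u = aug v"
proof -
  consider "\<not> nonneg a" | "a = 0" | "nonneg a" "a \<noteq> 0" by blast
  then show ?thesis
  proof cases
    case 1
    have "aug (0 :: nat \<Rightarrow> ('n, 'k) mpoly) = 0" using aug_sum[of "{}"] by simp
    then show ?thesis
      using gcomp_N_eq_0[OF aug_comp[OF v] 1] generated_0 F.comp_zero by (intro exI[of _ 0]) simp
  next
    case 2
    have "lifted 0 v (\<lambda>_. 0) = v" by (simp add: lifted_def fun_eq_iff)
    then have "v \<in> generated a" using v 2 generatedI[of v 0 "\<lambda>_. 0"] by simp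
    then show ?thesis using v by blast
  next
    case 3
    obtain x w where xw: "aug v = (x, w)" by (cases "aug v")
    then have xw': "x \<in> poly_comp a" "\<And>j. j < q \<Longrightarrow> w j \<in> poly_comp a" "\<And>j. q \<le> j \<Longrightarrow> w j = 0"
      using aug_comp[OF v] by (auto simp: gcomp_N)
    obtain i where "a i \<noteq> 0" using 3(2) by (auto simp: fun_eq_iff)
    then have i: "nonneg (a - unit_deg i)"
      using 3(1) by (simp add: nonneg_diff_unit_deg) (simp add: nonneg_def order_less_le)
    define w' where "w' = (\<lambda>j. if j < q then Const (Poly_Mapping.lookup (w j) (expo a)) else (0 :: ('n, 'k) mpoly))"
    then have "(0, w') \<in> gcomp N 0" by (simp add: gcomp_N w'_def poly_comp_zero Const_mem)
    then obtain t where t: "t \<in> gcomp F 0" "aug t = (0, w')" using graded_lift by blast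
    define d where "d = (\<lambda>k. if k = i then Poly_Mapping.lookup x (expo a) else 0)"
    define g where "g = (\<lambda>j. Const (d i) * mon (a - unit_deg i) * gam i j)"
    have lift: "lifted a t d = (\<lambda>j. mon (a - 0) * t j) + g"
    proof -
      have "(\<Sum>k \<in> UNIV. Const (d k) * mon (a - unit_deg k) * gam k j) = g j" for j
      proof -
        have "(\<Sum>k \<in> UNIV. Const (d k) * mon (a - unit_deg k) * gam k j) = (\<Sum>k \<in> UNIV. if k = i then g j else 0)"
          by (rule sum.cong) (auto simp: d_def g_def)
        then show ?thesis by simp
      qed
      then show ?thesis by (simp add: lifted_def fun_eq_iff)
    qed
    have mem: "(\<lambda>j. mon (a - 0) * t j) \<in> gcomp F a" "g \<in> gcomp F a"
      unfolding g_def by (rule mon_scale_comp[OF t(1)], rule scale_comp[OF gam(1)])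
    have "aug g = (Const (d i) * mon a, 0)"
    proof -
      have "Const (d i) * mon (a - unit_deg i) * Var i = Const (d i) * (mon a :: ('n, 'k) mpoly)"
        by (rule Var_mult_Const_mon_diff(2)[OF i])
      then show ?thesis
        unfolding g_def aug_scale[OF gam(1)] gam(2) by (simp add: zero_fun_def)
    qed
    moreover have "aug (\<lambda>j. mon (a - 0) * t j) = (0, \<lambda>j. mon a * w' j)"
      by (simp add: aug_scale[OF t(1)] t(2))
    moreover have "x = Const (d i) * mon a" using poly_comp_eq[OF xw'(1)] by (simp add: d_def)
    moreover have "w = (\<lambda>j. mon a * w' j)"
    proof
      show "w j = mon a * w' j" for j
        using poly_comp_eq[OF xw'(2), of j] xw'(3)[of j] by (cases "j < q") (auto simp: w'_def mult.commute)
    qed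
    ultimately have "aug (lifted a t d) = aug v"
      unfolding lift xw aug_add[OF mem] by simp
    moreover have "lifted a t d \<in> gcomp F a" unfolding lift by (rule F.comp_add[OF mem])
    ultimately show ?thesis using t(1) by (auto simp: generated_def)
  qed
qed

text \<open>Nakayama's lemma: a kernel element of degree \<open>a\<close> has coordinates without constant terms, hence is
  a sum of products \<open>X i * f\<close> with \<open>f\<close> of degree \<open>a - unit_deg i\<close>, and only finitely many such steps
  can lead to nonzero components of the free module.\<close>

lemma gcomp_generated: "v \<in> gcomp F a \<Longrightarrow> v \<in> generated a"
proof (induction "\<Sum>j < r. nat (1 + (\<Sum>i \<in> UNIV. a i - b j i))" arbitrary: a v rule: less_induct)
  case less
  obtain u where u: "u \<in> generated a" "u \<in> gcomp F a" "aug u = aug v"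
    using reduce_to_kernel[OF less.prems] by blast
  define w where "w = v - u"
  have w: "w \<in> gcomp F a" "aug w = 0"
    unfolding w_def using F.comp_diff[OF less.prems u(2)] aug_diff[OF less.prems u(2)] u(3) by simp_all
  have single: "(\<lambda>k. if k = j then w j else 0) \<in> generated a" if j: "j < r" for j
  proof (cases "w j = 0")
    case True
    then have "(\<lambda>k. if k = j then w j else 0) = 0" by (simp add: fun_eq_iff)
    then show ?thesis by (simp only: generated_0)
  next
    case False
    have wj: "w j \<in> poly_comp (a - b j)" by (rule gcomp_F_coord[OF w(1)])
    then have le: "nonneg (a - b j)" using False poly_comp_eq_0 by blast
    have "b j \<noteq> a" using kernel_coord_eq_0[OF w] False by blast
    then obtain i where "b j i \<noteq> a i" by (auto simp: fun_eq_iff)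
    then have "(a - b j) i \<noteq> 0" by simp
    then have i: "0 < (a - b j) i" using le unfolding nonneg_def by (metis order_less_le)
    have nn: "nonneg (a - b j - unit_deg i)" using nonneg_diff_unit_deg[OF le] i by blast
    define c where "c = Poly_Mapping.lookup (w j) (expo (a - b j))"
    define f where "f = (\<lambda>k. if k = j then Const c * mon (a - b j - unit_deg i) else 0)"
    have "a - unit_deg i - b j = a - b j - unit_deg i" by simp
    then have "(Const c * mon (a - b j - unit_deg i) :: ('n, 'k) mpoly) \<in> poly_comp (a - unit_deg i - b j)"
      by (simp only: Const_mult_mon_mem)
    then have f: "f \<in> gcomp F (a - unit_deg i)"
      using j by (auto simp: gcomp_F f_def poly_comp_zero)
    \<comment> \<open>Truncation by \<open>nat\<close> lets basis vectors out of reach contribute 0.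
      The vector \<open>j\<close> has \<open>a - b j\<close> nonnegative, so it contributes at least
      1 and its summand really drops.\<close>
    have less': "(\<Sum>k < r. nat (1 + (\<Sum>l \<in> UNIV. (a - unit_deg i) l - b k l)))
        < (\<Sum>k < r. nat (1 + (\<Sum>l \<in> UNIV. a l - b k l)))"
    proof (rule sum_strict_mono_ex1)
      have sub: "(\<Sum>l \<in> UNIV. (a - unit_deg i) l - b k l) = (\<Sum>l \<in> UNIV. a l - b k l) - 1" for k
        by (simp add: sum_subtractf unit_deg_def)
      show "\<forall>k \<in> {..<r}. nat (1 + (\<Sum>l \<in> UNIV. (a - unit_deg i) l - b k l)) \<le> nat (1 + (\<Sum>l \<in> UNIV. a l - b k l))"
        unfolding sub by (simp add: nat_mono)
      have "0 \<le> (\<Sum>l \<in> UNIV. a l - b j l)" using le by (intro sum_nonneg) (simp add: nonneg_def)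
      then show "\<exists>k \<in> {..<r}. nat (1 + (\<Sum>l \<in> UNIV. (a - unit_deg i) l - b k l)) < nat (1 + (\<Sum>l \<in> UNIV. a l - b k l))"
        using j unfolding sub by (intro bexI[of _ j]) auto
    qed simp
    have "f \<in> generated (a - unit_deg i)" by (rule less.hyps[OF less' f])
    then have "(\<lambda>k. Var i * f k) \<in> generated a" by (rule generated_Var)
    moreover have "(\<lambda>k. Var i * f k) = (\<lambda>k. if k = j then w j else 0)"
      using poly_comp_eq[OF wj, folded c_def] Var_mult_Const_mon_diff(1)[OF nn, of c]
      by (auto simp: f_def fun_eq_iff)
    ultimately show ?thesis by simp
  qed
  have "w = (\<Sum>j < r. (\<lambda>k. if k = j then w j else 0))"
  proof
    fix k
    have "(\<Sum>j < r. (\<lambda>k. if k = j then w j else 0)) k = (\<Sum>j < r. if k = j then w j else 0)"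
      by (rule sum_fun_apply)
    also have "\<dots> = w k" using w(1) by (auto simp: gcomp_F not_less)
    finally show "w k = (\<Sum>j < r. (\<lambda>k. if k = j then w j else 0)) k" by simp
  qed
  also have "\<dots> \<in> generated a" using single by (intro generated_sum) simp
  finally have "u + w \<in> generated a" using u(1) by (intro generated_add)
  then show ?case by (simp add: w_def)
qed

section \<open>Basis degrees of the cover and independence of the lifts\<close>

lemma generated_not_nonneg:
  assumes "v \<in> generated a" "\<not> nonneg a"
  shows "v = 0"
proof -
  have "\<not> nonneg (a - unit_deg k)" for k using assms(2) nonneg_diffD[of a "unit_deg k"] by auto
  then show ?thesis using assms by (auto simp: generated_def lifted_def mon_not_nonneg fun_eq_iff)
qed

text \<open>The basis vector \<open>j\<close> is a nonzero element of degree \<open>b j\<close>, but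
  nothing nonzero is generated in a degree with a negative entry.\<close>

lemma nonneg_b: assumes "j < r" shows "nonneg (b j)"
proof (rule ccontr)
  assume neg: "\<not> nonneg (b j)"
  let ?v = "\<lambda>k. if k = j then 1 else (0 :: ('n, 'k) mpoly)"
  have "1 \<in> poly_comp (0 :: 'n \<Rightarrow> int)" using mon_mem[of 0] by simp
  then have "?v \<in> gcomp F (b j)" using assms by (auto simp: gcomp_F poly_comp_zero)
  then have "?v = 0" using generated_not_nonneg[OF gcomp_generated neg] by blast
  then have "?v j = 0 j" by (rule fun_cong)
  then show False by simp
qed

lemma degree_zero_coord:
  assumes "t \<in> gcomp F 0" "b j \<noteq> 0"
  shows "t j = 0"
proof (cases "j < r")
  case True
  have "\<not> nonneg (0 - b j)"
  proof
    assume "nonneg (0 - b j)"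
    then have "b j i = 0" for i
      using nonneg_b[OF True] unfolding nonneg_def by (metis antisym diff_0 minus_apply neg_0_le_iff_le zero_fun_apply)
    then show False using assms(2) by (auto simp: fun_eq_iff)
  qed
  then show ?thesis using poly_comp_eq_0 gcomp_F_coord[OF assms(1)] by blast
qed (use assms(1) in \<open>simp add: gcomp_F\<close>)

text \<open>In degree 0 only coordinates at basis vectors of degree 0 can be nonzero; these are
  constants, which minimality excludes from the kernel.\<close>

lemma degree_zero_kernel:
  assumes "t \<in> gcomp F 0" "aug t = 0"
  shows "t = 0"
proof
  fix j show "t j = 0 j"
    using degree_zero_coord[OF assms(1)] kernel_coord_eq_0[OF assms] by (cases "b j = 0") auto
qed

text \<open>Basis degrees are nonnegative, so otherwise only basis vectors of degree 0 would occur
  in \<open>gam i\<close>, making it \<open>Var i\<close> times an element \<open>t\<close> of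
  degree 0. But the image of \<open>t\<close> has ideal part 0, while that of \<open>gam i\<close>
  is \<open>Var i\<close>.\<close>

lemma marker_exists: "\<exists>j. b j = unit_deg i \<and> gam i j \<noteq> 0"
proof (rule ccontr)
  assume no: "\<nexists>j. b j = unit_deg i \<and> gam i j \<noteq> 0"
  define t :: "nat \<Rightarrow> ('n, 'k) mpoly" where "t = (\<lambda>j. if b j = 0 then Const (Poly_Mapping.lookup (gam i j) (expo (unit_deg i))) else 0)"
  have coord: "gam i j \<in> poly_comp (unit_deg i - b j)" for j by (rule gcomp_F_coord[OF gam(1)])
  have "gam i j = mon (unit_deg i) * t j" for j
  proof (cases "b j = 0")
    case True
    then show ?thesis using poly_comp_eq[OF coord[of j]] by (simp add: t_def mult.commute)
  next
    case False
    have "gam i j = 0"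
    proof (rule ccontr)
      assume nz: "gam i j \<noteq> 0"
      then have "j < r" using gam(1)[of i] by (metis gcomp_F not_less)
      then have nn: "nonneg (b j)" by (rule nonneg_b)
      have le: "nonneg (unit_deg i - b j)" using nz coord poly_comp_eq_0 by blast
      have off: "b j k = 0" if "k \<noteq> i" for k
        using nn[unfolded nonneg_def, rule_format, of k] le[unfolded nonneg_def, rule_format, of k] that
        by (simp add: unit_deg_def)
      have "0 \<le> b j i" "b j i \<le> 1"
        using nn[unfolded nonneg_def, rule_format, of i] le[unfolded nonneg_def, rule_format, of i]
        by (simp_all add: unit_deg_def)
      then have "b j i = 0 \<or> b j i = 1" by arith
      then have "b j = 0 \<or> b j = unit_deg i"
      proof
        assume "b j i = 0"
        then have "b j k = 0" for k using off by (cases "k = i") auto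
        then show ?thesis by (simp add: fun_eq_iff)
      next
        assume "b j i = 1"
        then have "b j k = unit_deg i k" for k using off by (simp add: unit_deg_def)
        then show ?thesis by (simp add: fun_eq_iff)
      qed
      then show False using False no nz by blast
    qed
    then show ?thesis using False by (simp add: t_def)
  qed
  then have g: "gam i = (\<lambda>j. mon (unit_deg i) * t j)" by (simp add: fun_eq_iff)
  have "gam i j = 0" if "r \<le> j" for j using gam(1)[of i] that by (simp add: gcomp_F)
  then have t: "t \<in> gcomp F 0" by (auto simp: gcomp_F t_def poly_comp_zero Const_mem)
  obtain x w where xw: "aug t = (x, w)" by (cases "aug t")
  then have "x = 0" using gcomp_N_0_fst[OF aug_comp[OF t]] by simp
  then have "fst (aug (gam i)) = 0" unfolding g by (simp add: aug_scale[OF t] xw)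
  then have "(Var i :: ('n, 'k) mpoly) = 0" by (simp add: gam(2))
  then have "Const 1 * mon (unit_deg i) = (0 :: ('n, 'k) mpoly)" by (simp add: Var_eq_mon Const_1)
  then show False by (simp add: Const_mult_mon_eq_0_iff)
qed

definition marker :: "'n \<Rightarrow> nat" where
  "marker i = (SOME j. b j = unit_deg i \<and> gam i j \<noteq> 0)"

lemma marker: "b (marker i) = unit_deg i" "gam i (marker i) \<noteq> 0"
  using someI_ex[OF marker_exists[of i]] unfolding marker_def by blast+

lemma gam_marker:
  obtains g where "g \<noteq> 0" "gam i (marker i) = Const g"
proof
  have eq: "gam i (marker i) = Const (Poly_Mapping.lookup (gam i (marker i)) (expo 0)) * mon 0"
    using poly_comp_eq[OF gcomp_F_coord[OF gam(1), of i "marker i"]] marker(1) by simp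
  then show "gam i (marker i) = Const (Poly_Mapping.lookup (gam i (marker i)) (expo 0))" by simp
  show "Poly_Mapping.lookup (gam i (marker i)) (expo 0) \<noteq> 0"
    using eq marker(2)[of i] by (metis Const_0 mult_zero_left)
qed

text \<open>The coordinate has degree \<open>unit_deg k - unit_deg i\<close>, with entry -1 at
  \<open>i\<close>. Together with \<open>gam_marker\<close>, the coordinates at the markers form a
  diagonal matrix of nonzero constants, which makes the lifts independent.\<close>

lemma gam_other_marker:
  assumes "k \<noteq> i"
  shows "gam k (marker i) = 0"
proof -
  have "(unit_deg k - unit_deg i :: 'n \<Rightarrow> int) i = - 1" using assms by (simp add: unit_deg_def)
  then have "\<not> nonneg (unit_deg k - unit_deg i :: 'n \<Rightarrow> int)" unfolding nonneg_def by (metis neg_0_le_iff_le not_one_le_zero)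
  then show ?thesis using poly_comp_eq_0 gcomp_F_coord[OF gam(1), of k "marker i"] marker(1) by metis
qed


subsection \<open>The Koszul syzygies\<close>

definition koszul :: "'n \<times> 'n \<Rightarrow> nat \<Rightarrow> ('n, 'k) mpoly" where
  "koszul = (\<lambda>(i, j) t. Var j * gam i t - Var i * gam j t)"

definition koszul_deg :: "'n \<times> 'n \<Rightarrow> 'n \<Rightarrow> int" where
  "koszul_deg = (\<lambda>(i, j). unit_deg i + unit_deg j)"

lemma gcomp_S: "x \<in> gcomp S a \<longleftrightarrow> x \<in> gcomp F a \<and> aug x = 0"
  by (simp add: S kernel_gmod_def)

lemma gscale_S [simp]: "gscale S p v = (\<lambda>j. p * v j)"
  by (simp add: S kernel_gmod_def)

lemma koszul_mem: "koszul p \<in> gcomp S (koszul_deg p)"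
proof -
  obtain i j where p: "p = (i, j)" by (cases p)
  have m: "(\<lambda>t. Var l * gam k t) \<in> gcomp F (unit_deg k + unit_deg l)" for k l
    using mon_scale_comp[OF gam(1), of "unit_deg k + unit_deg l" k] by (simp add: Var_eq_mon)
  have eq: "koszul p = (\<lambda>t. Var j * gam i t) - (\<lambda>t. Var i * gam j t)"
    by (simp add: koszul_def p fun_eq_iff)
  have m2: "(\<lambda>t. Var i * gam j t) \<in> gcomp F (unit_deg i + unit_deg j)"
    using m[of i j] by (simp add: add.commute)
  have "aug (koszul p) = 0"
    unfolding eq aug_diff[OF m m2] aug_scale[OF gam(1)] gam(2) by (simp add: zero_prod_def zero_fun_def mult.commute)
  then show ?thesis
    using F.comp_diff[OF m m2, folded eq] by (simp add: gcomp_S koszul_deg_def p)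
qed

text \<open>The image of \<open>lifted a t d\<close> has as ideal part the sum of the active
  \<open>d k\<close> times \<open>X^a\<close>, and as free part \<open>X^a\<close> times that of
  \<open>aug t\<close>. Both vanish, so the coefficients sum to 0 and \<open>t\<close> is a kernel
  element of degree zero, hence 0.\<close>

lemma kernel_normal_form:
  assumes "x \<in> gcomp S a" "nonneg a"
  obtains d where "x = (\<lambda>j. \<Sum>k | 0 < a k. Const (d k) * mon (a - unit_deg k) * gam k j)"
    "(\<Sum>k | 0 < a k. d k) = 0"
proof -
  have x: "x \<in> gcomp F a" "aug x = 0" using assms(1) by (auto simp: gcomp_S)
  obtain t d where t: "t \<in> gcomp F 0" "x = lifted a t d"
    using gcomp_generated[OF x(1)] by (auto simp: generated_def)
  let ?A = "{k. 0 < a k}"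
  define g where "g = (\<lambda>k j. Const (d k) * mon (a - unit_deg k) * gam k j)"
  have "(\<Sum>k \<in> UNIV. g k j) = (\<Sum>k \<in> ?A. g k j)" for j
    using nonneg_diff_unit_deg[OF assms(2)]
    by (intro sum.mono_neutral_right) (auto simp: g_def mon_not_nonneg)
  then have xt: "x = (\<lambda>j. mon (a - 0) * t j) + (\<Sum>k \<in> ?A. g k)"
    unfolding t(2) by (simp add: lifted_def g_def fun_eq_iff sum_fun_apply)
  have gm: "g k \<in> gcomp F a" for k unfolding g_def by (rule scale_comp[OF gam(1)])
  have "aug (g k) = (Const (d k) * mon a, 0)" if "k \<in> ?A" for k
  proof -
    have k: "nonneg (a - unit_deg k)" using that nonneg_diff_unit_deg[OF assms(2)] by simp
    show ?thesis
      unfolding g_def aug_scale[OF gam(1)] gam(2)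
      by (simp only: gscale_N Var_mult_Const_mon_diff(2)[OF k]) (simp add: zero_fun_def)
  qed
  then have "(\<Sum>k \<in> ?A. aug (g k)) = (\<Sum>k \<in> ?A. (Const (d k) * mon a, 0))"
    by (intro sum.cong refl)
  moreover have "aug (\<Sum>k \<in> ?A. g k) = (\<Sum>k \<in> ?A. aug (g k))"
    by (rule aug_sum, rule F.comp_carrier, rule gm)
  ultimately have "aug (\<Sum>k \<in> ?A. g k) = (\<Sum>k \<in> ?A. (Const (d k) * mon a, 0))" by simp
  also have "\<dots> = (Const (\<Sum>k \<in> ?A. d k) * mon a, 0)"
  proof -
    have "(\<Sum>k \<in> A. Const (d k)) = (Const (sum d A) :: ('n, 'k) mpoly)" for A
      by (induction A rule: infinite_finite_induct) (auto simp: Const_add)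
    then show ?thesis by (simp add: prod_sum sum_distrib_right[symmetric])
  qed
  finally have "aug (\<Sum>k \<in> ?A. g k) = (Const (\<Sum>k \<in> ?A. d k) * mon a, 0)" .
  moreover obtain u w where uw: "aug t = (u, w)" by (cases "aug t")
  moreover have "u = 0" using gcomp_N_0_fst[OF aug_comp[OF t(1)]] uw by simp
  moreover have "(\<Sum>k \<in> ?A. g k) \<in> gcomp F a" using gm by (intro F.comp_sum)
  ultimately have "(Const (\<Sum>k \<in> ?A. d k) * mon a, \<lambda>j. mon a * w j) = 0"
    using x(2) unfolding xt by (simp add: aug_add[OF mon_scale_comp[OF t(1), of a, simplified]] aug_scale[OF t(1)])
  then have 0: "Const (\<Sum>k \<in> ?A. d k) * mon a = (0 :: ('n, 'k) mpoly)" "mon a * w j = 0" for j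
    by (auto simp: zero_prod_def fun_eq_iff)
  have "w j = 0" for j
  proof -
    have "w j \<in> poly_comp 0"
      using aug_comp[OF t(1)] unfolding uw gcomp_N by (cases "j < q") (auto simp: poly_comp_zero)
    then obtain c where "w j = Const c" using poly_comp_eq[of "w j" 0] by auto
    then show ?thesis using 0(2)[of j] assms(2) Const_mult_mon_eq_0_iff[of c a] by (auto simp: mult.commute)
  qed
  then have "aug t = 0" using uw \<open>u = 0\<close> by (simp add: zero_prod_def fun_eq_iff)
  then have "t = 0" by (rule degree_zero_kernel[OF t(1)])
  then have "x = (\<lambda>j. \<Sum>k \<in> ?A. Const (d k) * mon (a - unit_deg k) * gam k j)"
    unfolding xt by (simp add: fun_eq_iff sum_fun_apply g_def)
  moreover have "(\<Sum>k \<in> ?A. d k) = 0" using 0(1) assms(2) by (simp add: Const_mult_mon_eq_0_iff)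
  ultimately show ?thesis by (rule that)
qed

section \<open>A Stanley decomposition of the Koszul syzygies\<close>

context
  fixes rank :: "'n \<Rightarrow> nat"
  assumes rank: "inj rank"
begin

definition koszul_index :: "('n \<times> 'n) set" where
  "koszul_index = {(i, j). rank i < rank j}"

text \<open>\<open>rank\<close> orders the variables. Allowing only variables from \<open>i\<close>
  on makes \<open>i\<close> the least variable of the support wherever the piece is active, which
  leaves one pair per further variable. The decomposition provides the Hilbert function and shows
  that decompositions exist.\<close>

definition koszul_vars :: "'n \<times> 'n \<Rightarrow> 'n set" where
  "koszul_vars = (\<lambda>(i, j). {k. rank i \<le> rank k})"

lemma active_koszul_not_nonneg:
  assumes "\<not> nonneg a"
  shows "active koszul_index koszul_vars koszul_deg a = {}"
proof -
  obtain k where "a k < 0" using assms by (auto simp: nonneg_def not_le)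
  moreover have "0 \<le> koszul_deg p k" for p by (cases p) (simp add: koszul_deg_def unit_deg_def)
  ultimately have "\<not> koszul_deg p k \<le> a k" for p by (metis not_le order_trans)
  then show ?thesis by (auto simp: active_def)
qed

lemma active_koszul_0: "active koszul_index koszul_vars koszul_deg 0 = {}"
proof -
  have "1 \<le> koszul_deg p (fst p)" for p by (cases p) (simp add: koszul_deg_def unit_deg_def)
  then have "\<not> koszul_deg p (fst p) \<le> 0" for p by (metis not_one_le_zero order_trans)
  then show ?thesis by (auto simp: active_def)
qed

lemma active_koszul:
  assumes "nonneg a" "0 < a i" and min: "\<And>k. 0 < a k \<Longrightarrow> rank i \<le> rank k"
  shows "active koszul_index koszul_vars koszul_deg a = Pair i ` ({k. 0 < a k} - {i})"
proof (intro set_eqI iffI)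
  fix p assume p: "p \<in> active koszul_index koszul_vars koszul_deg a"
  obtain k l where kl: "p = (k, l)" by (cases p)
  have act: "koszul_deg p t \<le> a t" "koszul_deg p t < a t \<Longrightarrow> rank k \<le> rank t" for t
    using p by (auto simp: active_def kl koszul_vars_def)
  have less: "rank k < rank l" using p by (simp add: active_def kl koszul_index_def)
  have pos: "0 < a k" "0 < a l"
    using act(1)[of k] act(1)[of l] by (simp_all add: kl koszul_deg_def unit_deg_def split: if_splits)
  \<comment> \<open>If \<open>i\<close> is neither \<open>k\<close> nor \<open>l\<close>, its
    positive exponent in \<open>a\<close> comes from the subalgebra of the piece, which contains
    only variables of rank at least \<open>rank k\<close>.\<close>
  have "rank k \<le> rank i"
  proof (cases "i = k \<or> i = l")
    case False
    then show ?thesis using act(2)[of i] assms(2) by (simp add: kl koszul_deg_def unit_deg_def)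
  qed (use less in auto)
  then have "k = i" using min[OF pos(1)] rank by (simp add: inj_eq)
  then show "p \<in> Pair i ` ({k. 0 < a k} - {i})" using pos(2) less kl by auto
next
  fix p assume "p \<in> Pair i ` ({k. 0 < a k} - {i})"
  then obtain l where l: "p = (i, l)" "0 < a l" "l \<noteq> i" by auto
  have "rank i < rank l" using min[OF l(2)] l(3) rank by (simp add: order_less_le inj_eq)
  moreover have "koszul_deg p t \<le> a t" for t
    using assms(1,2) l by (auto simp: koszul_deg_def unit_deg_def nonneg_def int_one_le_iff_zero_less)
  moreover have "rank i \<le> rank t" if "koszul_deg p t < a t" for t
  proof (rule min)
    have "0 \<le> koszul_deg p t" by (simp add: l koszul_deg_def unit_deg_def)
    then show "0 < a t" using that by (rule order_le_less_trans)
  qed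
  ultimately show "p \<in> active koszul_index koszul_vars koszul_deg a"
    by (auto simp: active_def l koszul_index_def koszul_vars_def)
qed

lemma min_rank_exists:
  assumes "nonneg a" "a \<noteq> 0"
  shows "\<exists>i. 0 < a i \<and> (\<forall>k. 0 < a k \<longrightarrow> rank i \<le> rank k)"
proof -
  obtain k where "a k \<noteq> 0" using assms(2) by (auto simp: fun_eq_iff)
  then have k: "0 < a k" using assms(1) by (simp add: nonneg_def order_less_le)
  show ?thesis
    using arg_min_natI[where P = "\<lambda>k. 0 < a k", OF k] arg_min_nat_le[where P = "\<lambda>k. 0 < a k"]
    by (intro exI[of _ "arg_min rank (\<lambda>k. 0 < a k)"]) simp
qed

lemma card_active_koszul:
  assumes "nonneg a"
  shows "card (active koszul_index koszul_vars koszul_deg a) = card {k. 0 < a k} - 1"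
proof (cases "a = 0")
  case True
  then show ?thesis by (simp add: active_koszul_0)
next
  case False
  obtain i where i: "0 < a i" "\<And>k. 0 < a k \<Longrightarrow> rank i \<le> rank k"
    using min_rank_exists[OF assms False] by blast
  have "card (Pair i ` ({k. 0 < a k} - {i})) = card ({k. 0 < a k} - {i})"
    by (rule card_image) (auto simp: inj_on_def)
  then show ?thesis using i(1) by (simp add: active_koszul[OF assms i])
qed

lemma koszul_monomial:
  assumes "nonneg a" "0 < a i" "0 < a j" "i \<noteq> j"
  shows "Const c * mon (a - koszul_deg (i, j)) * koszul (i, j) t =
    Const c * mon (a - unit_deg i) * gam i t - Const c * mon (a - unit_deg j) * gam j t"
proof -
  have d: "a - koszul_deg (i, j) = a - unit_deg i - unit_deg j" "a - koszul_deg (i, j) = a - unit_deg j - unit_deg i"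
    by (simp_all add: koszul_deg_def fun_eq_iff)
  have "nonneg (a - unit_deg i - unit_deg j)"
    using assms by (auto simp: nonneg_def unit_deg_def int_one_le_iff_zero_less)
  moreover have "nonneg (a - unit_deg j - unit_deg i)"
    using assms by (auto simp: nonneg_def unit_deg_def int_one_le_iff_zero_less)
  ultimately have "Const c * mon (a - koszul_deg (i, j)) * Var j = Const c * mon (a - unit_deg i)"
      "Const c * mon (a - koszul_deg (i, j)) * Var i = (Const c * mon (a - unit_deg j) :: ('n, 'k) mpoly)"
    using Var_mult_Const_mon_diff(2)[of "a - unit_deg i" j c] Var_mult_Const_mon_diff(2)[of "a - unit_deg j" i c]
    unfolding d(1)[symmetric] d(2)[symmetric] by blast+
  then show ?thesis by (simp add: koszul_def right_diff_distrib mult.assoc[symmetric])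
qed

text \<open>Through the independent elements \<open>mon (a - unit_deg k) * gam k\<close>, the
  component becomes the space of coefficient vectors on the support with sum 0. The active Koszul
  elements are the differences between the least variable and each of the others, a basis of that
  space.\<close>

lemma homogeneous_basis_koszul: "homogeneous_basis S koszul_index koszul_vars koszul koszul_deg a"
proof -
  have zero: "x = 0" if "x \<in> gcomp S a" "\<not> nonneg a \<or> a = 0" for x
  proof (cases "nonneg a")
    case True
    then have "a = 0" using that(2) by blast
    then show ?thesis using degree_zero_kernel that(1) by (simp add: gcomp_S)
  next
    case False
    then show ?thesis using generated_not_nonneg[OF gcomp_generated False] that(1) by (simp add: gcomp_S)
  qed
  show ?thesis
  proof (cases "\<not> nonneg a \<or> a = 0")
    case True
    then have "active koszul_index koszul_vars koszul_deg a = {}"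
      using active_koszul_not_nonneg active_koszul_0 by blast
    then show ?thesis using zero[OF _ True] by (simp add: homogeneous_basis_def)
  next
    case False
    then have a: "nonneg a" "a \<noteq> 0" by blast+
    obtain i where i: "0 < a i" "\<And>k. 0 < a k \<Longrightarrow> rank i \<le> rank k"
      using min_rank_exists[OF a] by blast
    let ?B = "{k. 0 < a k} - {i}"
    have act: "active koszul_index koszul_vars koszul_deg a = Pair i ` ?B"
      by (rule active_koszul[OF a(1) i])
    have sum: "(\<Sum>p \<in> active koszul_index koszul_vars koszul_deg a.
        gscale S (Const (c p) * mon (a - koszul_deg p)) (koszul p)) =
        (\<lambda>t. \<Sum>j \<in> ?B. Const (c (i, j)) * mon (a - unit_deg i) * gam i t
            - Const (c (i, j)) * mon (a - unit_deg j) * gam j t)" for c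
    proof
      fix t
      have "(\<Sum>p \<in> active koszul_index koszul_vars koszul_deg a.
          gscale S (Const (c p) * mon (a - koszul_deg p)) (koszul p)) t =
        (\<Sum>j \<in> ?B. Const (c (i, j)) * mon (a - koszul_deg (i, j)) * koszul (i, j) t)"
        unfolding act sum_fun_apply by (subst sum.reindex) (simp_all add: inj_on_def)
      also have "\<dots> = (\<Sum>j \<in> ?B. Const (c (i, j)) * mon (a - unit_deg i) * gam i t
            - Const (c (i, j)) * mon (a - unit_deg j) * gam j t)"
        by (rule sum.cong[OF refl], rule koszul_monomial) (use a(1) i(1) in auto)
      finally show "(\<Sum>p \<in> active koszul_index koszul_vars koszul_deg a.
          gscale S (Const (c p) * mon (a - koszul_deg p)) (koszul p)) t = \<dots>" .
    qed
    show ?thesis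
      unfolding homogeneous_basis_def sum
    proof (intro conjI ballI allI impI)
      fix x assume "x \<in> gcomp S a"
      then obtain d where d: "x = (\<lambda>t. \<Sum>k | 0 < a k. Const (d k) * mon (a - unit_deg k) * gam k t)"
          "(\<Sum>k | 0 < a k. d k) = 0"
        by (rule kernel_normal_form[OF _ a(1)])
      \<comment> \<open>The vanishing sum determines the coefficient of \<open>i\<close>, so the
        negated coefficients of the other variables serve as \<open>c\<close>.\<close>
      have di: "d i = (\<Sum>k \<in> ?B. - d k)"
        using d(2) i(1) by (simp add: sum.remove[of _ i] sum_negf eq_neg_iff_add_eq_0)
      have Csum: "Const (sum f A) = (\<Sum>k \<in> A. (Const (f k) :: ('n, 'k) mpoly))" for f :: "'n \<Rightarrow> 'k" and A
        by (induction A rule: infinite_finite_induct) (auto simp: Const_add)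
      have "x = (\<lambda>t. \<Sum>j \<in> ?B. Const (- d j) * mon (a - unit_deg i) * gam i t
            - Const (- d j) * mon (a - unit_deg j) * gam j t)"
      proof
        fix t
        have "x t = Const (d i) * mon (a - unit_deg i) * gam i t +
            (\<Sum>k \<in> ?B. Const (d k) * mon (a - unit_deg k) * gam k t)"
          unfolding d(1) using i(1) by (subst sum.remove[of _ i]) auto
        also have "Const (d i) * mon (a - unit_deg i) * gam i t =
            (\<Sum>k \<in> ?B. Const (- d k) * mon (a - unit_deg i) * gam i t)"
          unfolding di Csum by (simp add: sum_distrib_right)
        finally show "x t = (\<Sum>j \<in> ?B. Const (- d j) * mon (a - unit_deg i) * gam i t
            - Const (- d j) * mon (a - unit_deg j) * gam j t)"
          by (simp only: Const_uminus mult_minus_left diff_minus_eq_add sum.distrib)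
      qed
      then show "\<exists>c. x = (\<lambda>t. \<Sum>j \<in> ?B. Const (c (i, j)) * mon (a - unit_deg i) * gam i t
            - Const (c (i, j)) * mon (a - unit_deg j) * gam j t)"
        by (intro exI[of _ "\<lambda>(i, j). - d j"]) simp
    next
      fix c :: "'n \<times> 'n \<Rightarrow> 'k" and p
      assume 0: "(\<lambda>t. \<Sum>j \<in> ?B. Const (c (i, j)) * mon (a - unit_deg i) * gam i t
            - Const (c (i, j)) * mon (a - unit_deg j) * gam j t) = 0"
        and "p \<in> active koszul_index koszul_vars koszul_deg a"
      then obtain l where l: "p = (i, l)" "0 < a l" "l \<noteq> i" unfolding act by auto
      \<comment> \<open>At the coordinate \<open>marker l\<close> every lift except
        \<open>gam l\<close> vanishes, which isolates the coefficient of \<open>l\<close>.\<close>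
      obtain g where g: "g \<noteq> 0" "gam l (marker l) = Const g" by (rule gam_marker)
      have "(\<Sum>j \<in> ?B. Const (c (i, j)) * mon (a - unit_deg i) * gam i (marker l)
            - Const (c (i, j)) * mon (a - unit_deg j) * gam j (marker l)) =
          (\<Sum>j \<in> ?B. if j = l then - (Const (c (i, l)) * mon (a - unit_deg l) * Const g) else 0)"
        by (rule sum.cong[OF refl]) (use l(3) in \<open>auto simp: gam_other_marker g(2)\<close>)
      also have "\<dots> = - (Const (c (i, l)) * mon (a - unit_deg l) * Const g)"
        using l(2,3) by simp
      finally have "Const (c (i, l)) * mon (a - unit_deg l) * Const g = 0"
        using fun_cong[OF 0, of "marker l"] by simp
      then have "Const (c (i, l) * g) * mon (a - unit_deg l) = (0 :: ('n, 'k) mpoly)"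
        by (simp add: Const_mult mult.assoc mult.commute[of "mon (a - unit_deg l)"])
      moreover have "nonneg (a - unit_deg l)" using l(2) nonneg_diff_unit_deg[OF a(1)] by blast
      ultimately show "c p = 0" using g(1) l(1) by (simp add: Const_mult_mon_eq_0_iff)
    qed
  qed
qed

end

end

text \<open>\<open>sdepth\<close> ranges over families indexed by natural numbers, while the Koszul
  pieces are indexed by pairs of variables.\<close>

lemma (in multigraded_module) stanley_decomposition_reindex:
  assumes sd: "stanley_decomposition N I Z m"
  shows "\<exists>(J :: nat set) Z m. stanley_decomposition N J Z m"
proof -
  have fin: "finite I" using sd by (simp add: stanley_decomposition_def)
  obtain dg where dg: "\<forall>p \<in> I. m p \<in> gcomp N (dg p)"
    using stanley_decomposition_degrees[OF sd] by (rule exE)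
  obtain h where h: "bij_betw h {..<card I} I"
    using ex_bij_betw_nat_finite[OF fin] by (auto simp: atLeast0LessThan)
  have hI: "h p \<in> I" if "p < card I" for p using bij_betwE[OF h] that by blast
  have act: "bij_betw h (active {..<card I} (Z \<circ> h) (dg \<circ> h) a) (active I Z dg a)" for a
  proof (rule bij_betw_subset[OF h])
    show "h ` active {..<card I} (Z \<circ> h) (dg \<circ> h) a = active I Z dg a"
      using bij_betw_imp_surj_on[OF h] by (force simp: active_def)
  qed (auto simp: active_def)
  have "homogeneous_basis N {..<card I} (Z \<circ> h) (m \<circ> h) (dg \<circ> h) a" for a
    unfolding homogeneous_basis_def
  proof (intro conjI ballI allI impI)
    have basis: "homogeneous_basis N I Z m dg a"
      by (rule homogeneous_basis_if_stanley_decomposition[OF sd]) (use dg in blast)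
    have reindex: "(\<Sum>p \<in> active {..<card I} (Z \<circ> h) (dg \<circ> h) a.
        gscale N (Const (c (h p)) * mon (a - (dg \<circ> h) p)) ((m \<circ> h) p)) =
        (\<Sum>p \<in> active I Z dg a. gscale N (Const (c p) * mon (a - dg p)) (m p))" for c
      using sum.reindex_bij_betw[OF act, of "\<lambda>p. gscale N (Const (c p) * mon (a - dg p)) (m p)"] by simp
    {
      fix x assume "x \<in> gcomp N a"
      then obtain c where "x = (\<Sum>p \<in> active I Z dg a. gscale N (Const (c p) * mon (a - dg p)) (m p))"
        using basis unfolding homogeneous_basis_def by blast
      then show "\<exists>c. x = (\<Sum>p \<in> active {..<card I} (Z \<circ> h) (dg \<circ> h) a.
          gscale N (Const (c p) * mon (a - (dg \<circ> h) p)) ((m \<circ> h) p))"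
        unfolding reindex[symmetric] by (rule exI[of _ "\<lambda>p. c (h p)"])
    next
      fix c p
      assume 0: "(\<Sum>p \<in> active {..<card I} (Z \<circ> h) (dg \<circ> h) a.
          gscale N (Const (c p) * mon (a - (dg \<circ> h) p)) ((m \<circ> h) p)) = 0"
        and p: "p \<in> active {..<card I} (Z \<circ> h) (dg \<circ> h) a"
      let ?d = "\<lambda>i. c (the_inv_into {..<card I} h i)"
      have d: "?d (h p) = c p" if "p \<in> active {..<card I} (Z \<circ> h) (dg \<circ> h) a" for p
        using the_inv_into_f_f[OF bij_betw_imp_inj_on[OF h], of p] that by (simp add: active_def)
      have "(\<Sum>p \<in> active {..<card I} (Z \<circ> h) (dg \<circ> h) a.
          gscale N (Const (?d (h p)) * mon (a - (dg \<circ> h) p)) ((m \<circ> h) p)) = 0"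
        using 0 d by (simp cong: sum.cong)
      then have "(\<Sum>p \<in> active I Z dg a. gscale N (Const (?d p) * mon (a - dg p)) (m p)) = 0"
        by (rule trans[OF reindex[of ?d, symmetric]])
      then have "\<forall>p \<in> active I Z dg a. ?d p = 0"
        using conjunct2[OF basis[unfolded homogeneous_basis_def], rule_format, of ?d] by blast
      moreover have "h p \<in> active I Z dg a" using bij_betwE[OF act] p by blast
      ultimately show "c p = 0" using d[OF p] by simp
    }
  qed
  then have "stanley_decomposition N {..<card I} (Z \<circ> h) (m \<circ> h)"
    by (intro stanley_decomposition_if_homogeneous_bases[where dg = "dg \<circ> h"]) (use dg hI in auto)
  then show ?thesis by blast
qed

section \<open>Counting pairs and triples of variables\<close>

definition indicator_deg :: "'n set \<Rightarrow> 'n \<Rightarrow> int" where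
  "indicator_deg B = (\<lambda>k. if k \<in> B then 1 else 0)"

lemma nonneg_indicator_deg [simp]: "nonneg (indicator_deg B)"
  by (simp add: nonneg_def indicator_deg_def)

lemma indicator_deg_support [simp]: "{k. 0 < indicator_deg B k} = B"
  by (auto simp: indicator_deg_def)

lemma indicator_deg_inject: "indicator_deg B = indicator_deg C \<longleftrightarrow> B = C"
  by (metis indicator_deg_support)

text \<open>A piece of depth at least \<open>n - 1\<close> misses at most one variable. One piece starts in every
  degree with two-element support, and the three of them inside a three-element support cannot all
  be active there. So every three-element set is a two-element set \<open>B\<close> extended by the variable
  missing from the piece of \<open>B\<close>.\<close>

lemma card_triples_le_card_pairs:
  fixes Z :: "'i \<Rightarrow> 'n::finite set"
  assumes fin: "finite I"
    and card: "\<And>a. nonneg a \<Longrightarrow> card (active I Z dg a) = card {k. 0 < a k} - 1"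
    and empty: "\<And>a. \<not> nonneg a \<Longrightarrow> active I Z dg a = {}"
    and depth: "\<And>p. p \<in> I \<Longrightarrow> CARD('n) \<le> Suc (card (Z p))"
  shows "card {T :: 'n set. card T = 3} \<le> card {B :: 'n set. card B = 2}"
proof -
  have "\<exists>p. active I Z dg (indicator_deg B) = {p}" if "card B = 2" for B
    using card[of "indicator_deg B"] that by (simp add: card_1_singleton_iff)
  then obtain P where P: "\<And>B. card B = 2 \<Longrightarrow> active I Z dg (indicator_deg B) = {P B}"
    by metis
  have PI: "P B \<in> I" if "card B = 2" for B
    using P[OF that] by (auto simp: active_def)
  \<comment> \<open>The generator is active in its own degree, so the support of that degree has at
    least two elements by the Hilbert function. As the degree lies below
    \<open>indicator_deg B\<close>, the two agree.\<close>
  have dgP: "dg (P B) = indicator_deg B" if B: "card B = 2" for B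
  proof -
    have le: "dg (P B) k \<le> indicator_deg B k" for k
      using P[OF B] by (auto simp: active_def)
    have self: "P B \<in> active I Z dg (dg (P B))" by (rule active_self[OF PI[OF B]])
    then have nn: "nonneg (dg (P B))" using empty by blast
    let ?C = "{k. 0 < dg (P B) k}"
    have "0 < card (active I Z dg (dg (P B)))"
      using self fin by (auto simp: card_gt_0_iff active_def)
    then have "card B \<le> card ?C" using card[OF nn] B by simp
    moreover have "?C \<subseteq> B"
    proof
      fix k assume "k \<in> ?C"
      then show "k \<in> B" using le[of k] by (auto simp: indicator_deg_def split: if_splits)
    qed
    ultimately have C: "?C = B" by (intro card_seteq) auto
    show ?thesis
    proof
      fix k
      show "dg (P B) k = indicator_deg B k"
      proof (cases "k \<in> B")
        case True
        then have "0 < dg (P B) k" using C by blast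
        then show ?thesis using le[of k] True by (simp add: indicator_deg_def)
      next
        case False
        then show ?thesis using le[of k] nn by (simp add: indicator_deg_def nonneg_def antisym)
      qed
    qed
  qed
  have missing: "\<exists>t. t \<in> T \<and> t \<notin> Z (P (T - {t}))" if T: "card T = 3" for T
  proof (rule ccontr)
    assume "\<nexists>t. t \<in> T \<and> t \<notin> Z (P (T - {t}))"
    then have all: "t \<in> Z (P (T - {t}))" if "t \<in> T" for t using that by blast
    have B: "card (T - {t}) = 2" if "t \<in> T" for t using T that by simp
    have "P (T - {t}) \<in> active I Z dg (indicator_deg T)" if t: "t \<in> T" for t
      using PI[OF B[OF t]] dgP[OF B[OF t]] all[OF t] t
      by (auto simp: active_def indicator_deg_def)
    then have "(\<lambda>t. P (T - {t})) ` T \<subseteq> active I Z dg (indicator_deg T)" by blast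
    moreover have "inj_on (\<lambda>t. P (T - {t})) T"
    proof (rule inj_onI)
      fix s t assume st: "s \<in> T" "t \<in> T" "P (T - {s}) = P (T - {t})"
      then have "T - {s} = T - {t}" using dgP[OF B] by (metis indicator_deg_inject)
      then show "s = t" using st(1,2) by blast
    qed
    moreover have "finite (active I Z dg (indicator_deg T))" using fin by (simp add: active_def)
    ultimately have "card T \<le> card (active I Z dg (indicator_deg T))" by (metis card_inj_on_le)
    then show False using card[of "indicator_deg T"] T by simp
  qed
  define t where "t = (\<lambda>T. SOME t. t \<in> T \<and> t \<notin> Z (P (T - {t})))"
  have t: "t T \<in> T" "t T \<notin> Z (P (T - {t T}))" if "card T = 3" for T
    using someI_ex[OF missing[OF that]] unfolding t_def by blast+
  show ?thesis
  proof (rule card_inj_on_le)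
    show "(\<lambda>T. T - {t T}) ` {T. card T = 3} \<subseteq> {B. card B = 2}" using t(1) by auto
    show "inj_on (\<lambda>T. T - {t T}) {T. card T = 3}"
    proof (rule inj_onI)
      fix T U assume TU: "T \<in> {T. card T = 3}" "U \<in> {T. card T = 3}" "T - {t T} = U - {t U}"
      \<comment> \<open>Both \<open>t T\<close> and \<open>t U\<close> are missing from the piece of
        the common pair, which misses at most one variable.\<close>
      let ?B = "T - {t T}"
      have "card ?B = 2" using TU(1) t(1) by simp
      then have "CARD('n) \<le> Suc (card (Z (P ?B)))" by (intro depth PI)
      moreover have "card (- Z (P ?B)) = CARD('n) - card (Z (P ?B))"
        by (simp add: Compl_eq_Diff_UNIV card_Diff_subset)
      ultimately have "card (- Z (P ?B)) \<le> Suc 0" by simp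
      moreover have "t T \<in> - Z (P ?B)" "t U \<in> - Z (P ?B)" using TU t(2)[of T] t(2)[of U] by auto
      ultimately have "t T = t U" by (simp add: card_le_Suc0_iff_eq)
      then have "insert (t T) (T - {t T}) = insert (t U) (U - {t U})" using TU(3) by simp
      moreover have "t T \<in> T" "t U \<in> U" using t(1) TU(1,2) by blast+
      ultimately show "T = U" by (simp only: insert_Diff)
    qed
  qed simp
qed

lemma stanley_depth_syzygy:
  assumes S: "multigraded_module S"
    and cover: "max_ideal_free_cover q r b aug F N (S :: ('n::finite, 'k::field, _) gmod)"
    and n: "CARD('n) = 6"
  shows "\<exists>(I :: nat set) Z m. stanley_decomposition S I Z m"
    and "stanley_decomposition S (I :: nat set) Z m \<Longrightarrow> stanley_depth I Z \<le> 4"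
proof -
  interpret S: multigraded_module S by fact
  interpret max_ideal_free_cover q r b aug F N S by fact
  obtain rank :: "'n \<Rightarrow> nat" where rank: "inj rank"
    using finite_imp_inj_to_nat_seg[of "UNIV :: 'n set"] by auto
  have koszul: "stanley_decomposition S (koszul_index rank) (koszul_vars rank) koszul"
    by (rule S.stanley_decomposition_if_homogeneous_bases[OF _ koszul_mem homogeneous_basis_koszul[OF rank]]) simp
  then show "\<exists>(I :: nat set) Z m. stanley_decomposition S I Z m"
    by (rule S.stanley_decomposition_reindex)
  assume sd: "stanley_decomposition S I Z m"
  obtain dg where dg: "\<forall>p \<in> I. m p \<in> gcomp S (dg p)"
    using stanley_decomposition_degrees[OF sd] by (rule exE)
  have fin: "finite I" using sd by (simp add: stanley_decomposition_def)
  have cong: "card (active I Z dg a) = card (active (koszul_index rank) (koszul_vars rank) koszul_deg a)" for a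
    by (rule S.card_active_cong[OF sd _ koszul koszul_mem]) (use dg in blast)
  have card: "card (active I Z dg a) = card {k. 0 < a k} - 1" if "nonneg a" for a
    unfolding cong by (rule card_active_koszul[OF rank that])
  have empty: "active I Z dg a = {}" if "\<not> nonneg a" for a
  proof -
    have "card (active I Z dg a) = 0" unfolding cong active_koszul_not_nonneg[OF rank that] by simp
    moreover have "finite (active I Z dg a)" using fin by (simp add: active_def)
    ultimately show ?thesis by simp
  qed
  show "stanley_depth I Z \<le> 4"
  proof (rule ccontr)
    assume deep: "\<not> stanley_depth I Z \<le> 4"
    obtain B :: "'n set" where B: "card B = 2"
      using obtain_subset_with_card_n[of 2 "UNIV :: 'n set"] n by auto
    then have "I \<noteq> {}" using card[of "indicator_deg B"] by (auto simp: active_def)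
    then have depth: "CARD('n) \<le> Suc (card (Z p))" if "p \<in> I" for p
      using deep le_stanley_depth_iff[OF fin, of 5 Z] that n by fastforce
    have "card {T :: 'n set. card T = 3} \<le> card {B :: 'n set. card B = 2}"
      by (rule card_triples_le_card_pairs[OF fin card empty depth])
    \<comment> \<open>This gives 20 triples and 15 pairs, against the inequality just
      obtained.\<close>
    moreover have "card {T :: 'n set. card T = k} = 6 choose k" for k
      using n_subsets[of "UNIV :: 'n set" k] n by simp
    ultimately show False by (simp add: numeral_eq_Suc)
  qed
qed

lemma first_syzygy_cover:
  assumes "is_first_syzygy (dsum_gmod (ideal_gmod max_ideal) (free_gmod q (\<lambda>_. 0))) S"
  shows "\<exists>r b aug. max_ideal_free_cover q r b aug (free_gmod r b)
    (dsum_gmod (ideal_gmod max_ideal) (free_gmod q (\<lambda>_. 0))) S"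
proof -
  obtain r b aug d where res: "minimal_free_resolution
      (dsum_gmod (ideal_gmod max_ideal) (free_gmod q (\<lambda>_. 0))) r b aug d"
    and S: "S = kernel_gmod (free_gmod (r 0) (b 0)) aug"
    using assms by (auto simp: is_first_syzygy_def)
  have "max_ideal_free_cover q (r 0) (b 0) aug (free_gmod (r 0) (b 0))
    (dsum_gmod (ideal_gmod max_ideal) (free_gmod q (\<lambda>_. 0))) S"
    by unfold_locales (use res in \<open>simp_all add: S minimal_free_resolution_def Let_def\<close>)
  then show ?thesis by blast
qed

theorem mainTheorem3:
  fixes M :: "(6, 'k::field, (6, 'k) mpoly \<times> (nat \<Rightarrow> (6, 'k) mpoly)) gmod"
  assumes "infinite (UNIV :: 'k set)"
    and "M = dsum_gmod (ideal_gmod max_ideal) (free_gmod 9 (\<lambda>_. 0))"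
  shows "sdepth M = 5 \<and> (5::nat) > 4 \<and>
         (\<forall>S. is_first_syzygy M S \<longrightarrow> 4 \<ge> sdepth S \<and> sdepth M > sdepth S)"
proof -
  have n: "CARD(6) = 6" by simp
  obtain h :: "6 \<Rightarrow> nat" where h: "bij_betw h UNIV {..<6}"
    using ex_bij_betw_finite_nat[of "UNIV :: 6 set"] by (auto simp: atLeast0LessThan)
  interpret six_variables h "the_inv_into UNIV h"
  proof
    show "the_inv_into UNIV h (h i) = i" for i
      using the_inv_into_f_f[OF bij_betw_imp_inj_on[OF h]] by simp
    show "h (the_inv_into UNIV h k) = k" if "k < 6" for k
      using f_the_inv_into_f_bij_betw[OF h] that by simp
    show "h i < 6" for i using bij_betwE[OF h] by auto
  qed
  have M: "sdepth M = 5" unfolding assms(2) by (rule sdepth_max_ideal_plus_free)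
  have "sdepth S \<le> 4" if S: "is_first_syzygy M S" for S
  proof -
    have mS: "multigraded_module S"
      by (rule multigraded_syzygy[OF _ S]) (simp add: assms(2) multigraded_max_ideal_dsum_free)
    obtain r b aug where cover: "max_ideal_free_cover 9 r b aug (free_gmod r b) M S"
      using first_syzygy_cover S unfolding assms(2) by blast
    show ?thesis
      by (rule sdepth_le[OF stanley_depth_syzygy[OF mS cover n]])
  qed
  then show ?thesis using M by fastforce
qed

end
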